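(* Let $\gamma^\sharp(L^m_\infty(\mathbb{R}))$ denote the sharp multiplicative finiteness constant for $L^m_\infty(\mathbb{R})$ (with finiteness number $m+1$), $m\in\mathbb{N}$. Then: (i) $\gamma^\sharp(L^1_\infty(\mathbb{R}))=1$ and $\gamma^\sharp(L^2_\infty(\mathbb{R}))=2$. (ii) For every $m\in\mathbb{N}$, $m>2$, $$\left(\frac{\pi}{2}\right)^{m-1}<\gamma^\sharp(L^m_\infty(\mathbb{R}))<(m-1)\,9^m.$$
   Context: $L^m_\infty(\mathbb{R})$ is the space of functions $F:\mathbb{R}\to\mathbb{R}$ such that $F^{(m-1)}$ exists and is (locally) absolutely continuous and $F^{(m)}\in L_\infty(\mathbb{R})$ (i.e. $F\in C^{m-1}$ with $F^{(m-1)}$ Lipschitz), seminormed by $\|F\|_{L^m_\infty(\mathbb{R})}=\|F^{(m)}\|_{L_\infty(\mathbb{R})}$. For $A\subset\mathbb{R}$, $L^m_\infty(\mathbb{R})|_A$ is the space of restrictions to $A$ of functions of $L^m_\infty(\mathbb{R})$, with trace seminorm $\|f\|_{L^m_\infty(\mathbb{R})|_A}=\inf\{\|F\|_{L^m_\infty(\mathbb{R})}:F\in L^m_\infty(\mathbb{R}),\,F|_A=f\}$. The constant $\gamma^\sharp(L^m_\infty(\mathbb{R}))$ is the infimum of all constants $\gamma>0$ such that for every closed set $E\subset\mathbb{R}$ with $\#E\ge m+1$ and every $f\in L^m_\infty(\mathbb{R})|_E$, $$\|f\|_{L^m_\infty(\mathbb{R})|_E}\le\gamma\sup_{S\subset E,\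 \#S=m+1}\|f|_S\|_{L^m_\infty(\mathbb{R})|_S}.$$ Equivalently it is the supremum over such $E$ and $f$ of the ratio of $\|f\|_{L^m_\infty(\mathbb{R})|_E}$ to the supremum on the right. *)

theory Defs
  imports "HOL-Analysis.Analysis" "HOL-Probability.Essential_Supremum"
begin

(* Absolute continuity on [a,b]: the finite index set I collects pairs (u,v) encoding
   subintervals [u,v] of [a,b] with pairwise disjoint interiors. *)

definition abs_continuous_on_interval :: "(real \<Rightarrow> real) \<Rightarrow> real \<Rightarrow> real \<Rightarrow> bool" where
  "abs_continuous_on_interval f a b \<longleftrightarrow>
     (\<forall>\<epsilon>>0. \<exists>\<delta>>0. \<forall>I. finite I
        \<and> (\<forall>(u, v)\<in>I. a \<le> u \<and> u \<le> v \<and> v \<le> b)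
        \<and> disjoint_family_on (\<lambda>(u, v). {u<..<v}) I
        \<and> (\<Sum>(u, v)\<in>I. v - u) < \<delta>
        \<longrightarrow> (\<Sum>(u, v)\<in>I. \<bar>f v - f u\<bar>) < \<epsilon>)"

definition locally_abs_continuous :: "(real \<Rightarrow> real) \<Rightarrow> bool" where
  "locally_abs_continuous f \<longleftrightarrow> (\<forall>a b. a \<le> b \<longrightarrow> abs_continuous_on_interval f a b)"

(* When the derivative of order m - 1 is locally absolutely continuous, the m-th derivative
   exists outside a Lebesgue null set. At the exceptional points deriv returns an unspecified
   value, which does not affect the essential supremum. Since lebesgue is complete it does not
   affect measurability either; esssup is infinite on nonmeasurable functions. *)

definition L_seminorm :: "nat \<Rightarrow> (real \<Rightarrow> real) \<Rightarrow> ereal" where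
  "L_seminorm m F = esssup lebesgue (\<lambda>x. ereal \<bar>(deriv ^^ m) F x\<bar>)"

(* For m \<ge> 1. The first clause says that the derivatives of order up to m - 1 exist everywhere. *)

definition L_space :: "nat \<Rightarrow> (real \<Rightarrow> real) set" where
  "L_space m = {F.
     (\<forall>k<m - 1. \<forall>x. (deriv ^^ k) F differentiable (at x))
     \<and> locally_abs_continuous ((deriv ^^ (m - 1)) F)
     \<and> L_seminorm m F < \<infinity>}"

(* A function on A is represented by a total function of which only the values on A matter. *)

definition trace_space :: "nat \<Rightarrow> real set \<Rightarrow> (real \<Rightarrow> real) set" where
  "trace_space m A = {f. \<exists>F\<in>L_space m. \<forall>x\<in>A. F x = f x}"

definition trace_seminorm :: "nat \<Rightarrow> real set \<Rightarrow> (real \<Rightarrow> real) \<Rightarrow> ereal" where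
  "trace_seminorm m A f = Inf {L_seminorm m F | F. F \<in> L_space m \<and> (\<forall>x\<in>A. F x = f x)}"

definition finiteness_constant :: "nat \<Rightarrow> real \<Rightarrow> bool" where
  "finiteness_constant m \<gamma> \<longleftrightarrow> \<gamma> > 0 \<and>
     (\<forall>E f. closed E \<and> (infinite E \<or> card E \<ge> m + 1) \<and> f \<in> trace_space m E \<longrightarrow>
        trace_seminorm m E f
          \<le> ereal \<gamma> * (SUP S\<in>{S. S \<subseteq> E \<and> card S = m + 1}. trace_seminorm m S f))"

(* The infimum is taken in ereal, so that it is infinite if there is no admissible constant. *)

definition gamma_sharp :: "nat \<Rightarrow> ereal" where
  "gamma_sharp m = Inf (ereal ` {\<gamma>. finiteness_constant m \<gamma>})"

end

theory Submission
  imports Defs "HOL-Complex_Analysis.Cauchy_Integral_Formula"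
begin

text \<open>By Lebesgue's theorem for absolutely continuous functions, the seminorm of \<open>F\<close> is the Lipschitz
  constant of its derivative of order \<open>m - 1\<close>, and on \<open>m + 1\<close> points the trace seminorm of \<open>f\<close> is
  \<open>m!\<close> times its divided difference.

  Upper bound: let \<open>P\<^sub>i\<close> interpolate \<open>f\<close> at \<open>t\<^sub>i, \<dots>, t\<^sub>i\<^sub>+\<^sub>m\<^sub>-\<^sub>1\<close>. The interpolant starts with \<open>P\<^sub>0\<close>
  and switches from \<open>P\<^sub>i\<close> to \<open>P\<^sub>i\<^sub>+\<^sub>1\<close> smoothly across all of \<open>[t\<^sub>i, t\<^sub>i\<^sub>+\<^sub>m]\<close>; the difference
  \<open>P\<^sub>i\<^sub>+\<^sub>1 - P\<^sub>i\<close> vanishes at the interior nodes, so the values are right, and at most \<open>m\<close> switches are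
  active at a point. For \<open>m = 2\<close> a quadratic spline with slopes read off from parabolas gives the
  sharp constant 2. Closed sets follow by compactness.

  Lower bound: take \<open>E = \<int>\<close> and \<open>f n = (- 1) ^ n\<close>, for which the right-hand supremum is at most \<open>2 ^ m\<close>.
  Averaging makes an extension antiperiodic with period 1, and Wirtinger's inequality applied to its
  successive derivatives bounds the derivative of order \<open>m\<close> from below.\<close>

section \<open>Absolutely continuous functions\<close>

text \<open>Spreading a switch over all of [t_i, t_(i+m)] keeps mesh ratios out of the constant. The
  difference P_(i+1) - P_i is a divided difference times t_(i+m) - t_i times m - 1 linear factors,
  and this one factor of length cancels the single length that m derivatives of switch times product
  leave in the denominator; a switch inside one gap would be paid for by the smallness of that gap.
  The overlap of m switches is absorbed because each contributes (m - 1)! where the seminorm has m!.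
  Derivatives of order m exist only almost everywhere, so neither Rolle's theorem nor Wirtinger's
  inequality is carried beyond order m - 1; the last step uses the Lipschitz constant instead. The
  resulting mean-square bound for m > 2 still exceeds (pi / 2)^(m - 1) by the factor sqrt 48 / (2
  pi) > 1. For m = 1 and m = 2 pointwise arguments give the exact values. A pointwise limit of
  smooth functions need not be smooth, so compactness is applied to all derivatives together; the
  same lemma serves for closed sets and for the limit of the averages.\<close>

abbreviation cint :: "real \<times> real \<Rightarrow> real set" where
  "cint I \<equiv> {fst I..snd I}"

abbreviation separated :: "(real \<times> real) set \<Rightarrow> bool" where
  "separated D \<equiv> pairwise (\<lambda>I J. disjnt (cint I) (cint J)) D"

abbreviation nonoverlapping :: "(real \<times> real) set \<Rightarrow> bool" where
  "nonoverlapping G \<equiv> disjoint_family_on (\<lambda>(u, v). {u<..<v}) G"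

abbreviation incr :: "(real \<Rightarrow> real) \<Rightarrow> (real \<times> real) set \<Rightarrow> real" where
  "incr f D \<equiv> \<Sum>I\<in>D. f (snd I) - f (fst I)"

text \<open>Vitali's theorem in the finite form that the definition of absolute continuity can use:
  a countable disjoint selection covers almost all of S, and finitely many of its members lose less
  than e. The intervals need only contain x, since each is a closed ball about its own midpoint;
  those not inside U can be discarded because arbitrarily short ones remain.\<close>

lemma finite_Vitali_cover:
  fixes S :: "real set" and K :: "(real \<times> real) set"
  assumes S: "S \<in> lmeasurable" and U: "open U" "S \<subseteq> U"
    and K: "\<And>I. I \<in> K \<Longrightarrow> fst I < snd I"
    and fine: "\<And>x d. x \<in> S \<Longrightarrow> 0 < d \<Longrightarrow> \<exists>I\<in>K. x \<in> cint I \<and> snd I - fst I < d"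
    and e: "0 < e"
  shows "\<exists>D. finite D \<and> D \<subseteq> K \<and> (\<forall>I\<in>D. cint I \<subseteq> U) \<and>
    separated D \<and>
    measure lebesgue S - e < (\<Sum>I\<in>D. measure lebesgue (S \<inter> cint I))"
proof -
  define K' where "K' = {I\<in>K. cint I \<subseteq> U}"
  define a where "a = (\<lambda>I::real\<times>real. (fst I + snd I) / 2)"
  define r where "r = (\<lambda>I::real\<times>real. (snd I - fst I) / 2)"
  have cb: "cball (a I) (r I) = cint I" for I
    by (simp add: cball_eq_atLeastAtMost a_def r_def field_simps)
  have "\<exists>I. I \<in> K' \<and> x \<in> cball (a I) (r I) \<and> r I < d" if "x \<in> S" "0 < d" for x d
  proof -
    obtain \<epsilon> where \<epsilon>: "\<epsilon> > 0" "ball x \<epsilon> \<subseteq> U"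
      using U \<open>x \<in> S\<close> open_contains_ball by blast
    have "\<exists>I\<in>K. x \<in> cint I \<and> snd I - fst I < min \<epsilon> d"
      using \<epsilon> \<open>0 < d\<close> by (intro fine[OF \<open>x \<in> S\<close>]) simp
    then obtain I where I: "I \<in> K" "x \<in> cint I" "snd I - fst I < min \<epsilon> d"
      by blast
    have "cint I \<subseteq> ball x \<epsilon>"
      using I by (auto simp: dist_real_def)
    with I \<epsilon> K[OF I(1)] show ?thesis
      unfolding cb by (intro exI[of _ I]) (auto simp: K'_def r_def)
  qed
  note short = this
  have rpos: "0 < r I" if "I \<in> K'" for I
    using K that by (simp add: K'_def r_def)
  obtain C where "countable C" "C \<subseteq> K'"
      "pairwise (\<lambda>I J. disjnt (cball (a I) (r I)) (cball (a J) (r J))) C"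
      "negligible (S - (\<Union>I\<in>C. cball (a I) (r I)))"
    by (rule Vitali_covering_theorem_cballs[OF rpos short]) auto
  note C = this[unfolded cb]
  define T where "T = (\<lambda>I. S \<inter> cint I)"
  have T: "T I \<in> lmeasurable" for I
    unfolding T_def using S by (intro fmeasurable.Int) auto
  have bound: "measure lebesgue (\<Union>\<D>) \<le> measure lebesgue S" if "\<D> \<subseteq> T ` C" "finite \<D>" for \<D>
  proof (rule measure_mono_fmeasurable[OF _ _ S])
    show "\<Union>\<D> \<in> sets lebesgue"
      using that T by (intro sets.finite_Union) auto
  qed (use that in \<open>auto simp: T_def\<close>)
  have "countable (T ` C)" "\<And>d. d \<in> T ` C \<Longrightarrow> d \<in> lmeasurable"
    using C(1) T by auto
  then obtain \<D> where \<D>: "\<D> \<subseteq> T ` C" "finite \<D>"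
      "measure lebesgue (\<Union>(T ` C)) - e < measure lebesgue (\<Union>\<D>)"
    by (rule measure_countable_Union_approachable[OF _ e _ bound])
  obtain D where D: "D \<subseteq> C" "finite D" "\<D> = T ` D"
    using \<D> by (meson finite_subset_image)
  have "measure lebesgue (\<Union>(T ` C)) = measure lebesgue S"
  proof (rule measure_negligible_symdiff[OF S], rule negligible_subset[OF C(4)])
    show "S - \<Union>(T ` C) \<union> (\<Union>(T ` C) - S) \<subseteq> S - (\<Union>I\<in>C. cint I)"
      unfolding T_def by blast
  qed
  moreover have "measure lebesgue (\<Union>(T ` D)) = (\<Sum>I\<in>D. measure lebesgue (T I))"
  proof (rule measure_UNION'[OF D(2) T])
    show "pairwise (\<lambda>I J. disjnt (T I) (T J)) D"
      using C(3) D(1) unfolding T_def pairwise_def disjnt_def by blast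
  qed
  moreover have "separated D"
    by (rule pairwise_subset[OF C(3) D(1)])
  ultimately show ?thesis
    using \<D>(3) D C(2) unfolding T_def by (intro exI[of _ D]) (auto simp: K'_def)
qed

text \<open>G consists of the gaps that D leaves in [a, b]. The increment formula holds for every f:
  with the identity it measures the total length of the gaps, with the function under study it
  isolates their contribution.\<close>

lemma interval_gaps:
  assumes "finite D" "a \<le> b"
    and "\<And>I. I \<in> D \<Longrightarrow> a \<le> fst I \<and> fst I < snd I \<and> snd I \<le> b"
    and "separated D"
  shows "\<exists>G. finite G \<and> (\<forall>I\<in>G. a \<le> fst I \<and> fst I \<le> snd I \<and> snd I \<le> b)
    \<and> nonoverlapping G
    \<and> (\<forall>f::real\<Rightarrow>real. f b - f a = incr f D + incr f G)"
  using assms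
\<comment> \<open>Ranking by right endpoint makes the inserted interval the last one, so the others
  lie in [a, \<open>fst I\<close>]; hence b is generalised.\<close>
proof (induction arbitrary: b rule: finite_ranking_induct[where f=snd])
  case empty
  then show ?case
    by (intro exI[of _ "{(a,b)}"]) (auto simp: disjoint_family_on_def)
next
  case (insert I D)
  show ?case
  proof (cases "I \<in> D")
    case True
    then show ?thesis
      using insert.IH[of b] insert.prems by (simp add: insert_absorb)
  next
    case False
    have x: "a \<le> fst I" "fst I < snd I" "snd I \<le> b"
      using insert.prems by auto
    have D: "a \<le> fst J \<and> fst J < snd J \<and> snd J < fst I" if "J \<in> D" for J
    proof -
      have "disjnt (cint J) (cint I)"
        using insert.prems(3) that False by (force simp: pairwise_insert)
      then have "snd J \<notin> cint I"
        using insert.prems(2)[of J] that by (auto simp: disjnt_def)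
      then show ?thesis
        using insert.hyps(2)[of J] insert.prems(2)[of J] that by auto
    qed
    have "separated D"
      using insert.prems by (auto simp: pairwise_insert)
    then obtain G where G: "finite G" "\<forall>J\<in>G. a \<le> fst J \<and> fst J \<le> snd J \<and> snd J \<le> fst I"
       "nonoverlapping G"
       "\<forall>f::real\<Rightarrow>real. f (fst I) - f a = incr f D + incr f G"
      using insert.IH[of "fst I"] x D by force
    have nG: "(snd I, b) \<notin> G"
      using G(2) x by force
    show ?thesis
    proof (intro exI[of _ "insert (snd I, b) G"] conjI allI)
      show "disjoint_family_on (\<lambda>(u, v). {u<..<v}) (insert (snd I, b) G)"
        unfolding disjoint_family_on_insert[OF nG]
        using G x by (force simp: disjoint_family_on_insert)
      fix f :: "real \<Rightarrow> real"
      show "f b - f a = (\<Sum>J\<in>insert I D. f (snd J) - f (fst J))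
         + (\<Sum>J\<in>insert (snd I, b) G. f (snd J) - f (fst J))"
        using G(4)[rule_format, of f] insert.hyps False G(1) nG by simp
    qed (use G x in \<open>force+\<close>)
  qed
qed

lemma abs_continuous_on_intervalD:
  assumes "abs_continuous_on_interval f a b" "\<epsilon> > 0"
  shows "\<exists>\<delta>>0. \<forall>G. finite G \<longrightarrow> (\<forall>I\<in>G. a \<le> fst I \<and> fst I \<le> snd I \<and> snd I \<le> b)
    \<longrightarrow> nonoverlapping G \<longrightarrow> (\<Sum>I\<in>G. snd I - fst I) < \<delta>
    \<longrightarrow> \<bar>incr f G\<bar> < \<epsilon>"
proof -
  obtain \<delta> where "\<delta> > 0" and \<delta>: "\<And>G. finite G \<Longrightarrow> (\<forall>(u, v)\<in>G. a \<le> u \<and> u \<le> v \<and> v \<le> b)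
    \<Longrightarrow> nonoverlapping G \<Longrightarrow> (\<Sum>(u,v)\<in>G. v - u) < \<delta>
    \<Longrightarrow> (\<Sum>(u,v)\<in>G. \<bar>f v - f u\<bar>) < \<epsilon>"
    using assms unfolding abs_continuous_on_interval_def by meson
  show ?thesis
  proof (intro exI[of _ \<delta>] conjI allI impI \<open>\<delta> > 0\<close>)
    fix G :: "(real \<times> real) set"
    assume G: "finite G" "\<forall>I\<in>G. a \<le> fst I \<and> fst I \<le> snd I \<and> snd I \<le> b"
      "nonoverlapping G" "(\<Sum>I\<in>G. snd I - fst I) < \<delta>"
    have "(\<Sum>I\<in>G. \<bar>f (snd I) - f (fst I)\<bar>) < \<epsilon>"
      using \<delta>[of G] G by (force simp: case_prod_unfold)
    then show "\<bar>incr f G\<bar> < \<epsilon>"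
      using sum_abs[of "\<lambda>I. f (snd I) - f (fst I)" G] by linarith
  qed
qed

lemma disjnt_cint_imp_disjoint_family:
  assumes "separated D"
  shows "nonoverlapping D"
  using assms unfolding disjoint_family_on_def pairwise_def disjnt_def
  by (fastforce simp: case_prod_unfold)

lemma sum_cint_le_measure:
  assumes "finite D" "separated D"
    "\<And>I. I \<in> D \<Longrightarrow> fst I \<le> snd I \<and> cint I \<subseteq> U" "U \<in> lmeasurable"
  shows "(\<Sum>I\<in>D. snd I - fst I) \<le> measure lebesgue U"
proof -
  have "(\<Sum>I\<in>D. snd I - fst I) = (\<Sum>I\<in>D. measure lebesgue (cint I))"
    using assms(3) by (intro sum.cong) auto
  also have "\<dots> = measure lebesgue (\<Union>I\<in>D. cint I)"
    by (rule measure_UNION'[symmetric]) (use assms in auto)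
  also have "\<dots> \<le> measure lebesgue U"
    by (rule measure_mono_fmeasurable) (use assms in auto)
  finally show ?thesis .
qed

section \<open>Upper derivates and Lebesgue's differentiation theorem\<close>

lemma abs_continuous_on_interval_subtract_linear:
  assumes "abs_continuous_on_interval f a b"
  shows "abs_continuous_on_interval (\<lambda>x. f x - p * x) a b"
  unfolding abs_continuous_on_interval_def
proof (intro allI impI)
  fix \<epsilon> :: real assume "\<epsilon> > 0"
  then obtain \<delta> where "\<delta> > 0" and \<delta>: "\<And>I. finite I \<Longrightarrow> (\<forall>(u, v)\<in>I. a \<le> u \<and> u \<le> v \<and> v \<le> b)
    \<Longrightarrow> disjoint_family_on (\<lambda>(u, v). {u<..<v}) I \<Longrightarrow> (\<Sum>(u, v)\<in>I. v - u) < \<delta>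
        \<Longrightarrow> (\<Sum>(u, v)\<in>I. \<bar>f v - f u\<bar>) < \<epsilon> / 2"
    using assms half_gt_zero[OF \<open>\<epsilon> > 0\<close>] unfolding abs_continuous_on_interval_def by meson
  define \<eta> where "\<eta> = \<epsilon> / (2 * (\<bar>p\<bar> + 1))"
  have "\<eta> > 0" using \<open>\<epsilon> > 0\<close> by (auto simp: \<eta>_def intro!: divide_pos_pos)
  have \<eta>: "\<bar>p\<bar> * \<eta> \<le> \<epsilon> / 2"
  proof -
    have "\<bar>p\<bar> * \<eta> = (\<epsilon> / 2) * (\<bar>p\<bar> / (\<bar>p\<bar> + 1))"
      unfolding \<eta>_def using abs_ge_zero[of p] by (simp add: field_simps)
    also have "\<dots> \<le> (\<epsilon> / 2) * 1"
      using \<open>\<epsilon> > 0\<close> by (intro mult_left_mono) (auto simp: divide_le_eq)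
    finally show ?thesis by simp
  qed
  show "\<exists>\<delta>>0. \<forall>I. finite I \<and> (\<forall>(u, v)\<in>I. a \<le> u \<and> u \<le> v \<and> v \<le> b)
        \<and> disjoint_family_on (\<lambda>(u, v). {u<..<v}) I \<and> (\<Sum>(u, v)\<in>I. v - u) < \<delta>
        \<longrightarrow> (\<Sum>(u, v)\<in>I. \<bar>f v - p * v - (f u - p * u)\<bar>) < \<epsilon>"
  proof (intro exI[of _ "min \<delta> \<eta>"] conjI allI impI; (elim conjE)?)
    fix I :: "(real \<times> real) set"
    assume I: "finite I" "\<forall>(u, v)\<in>I. a \<le> u \<and> u \<le> v \<and> v \<le> b"
        "disjoint_family_on (\<lambda>(u, v). {u<..<v}) I" "(\<Sum>(u, v)\<in>I. v - u) < min \<delta> \<eta>"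
    have "(\<Sum>(u, v)\<in>I. \<bar>f v - p * v - (f u - p * u)\<bar>) \<le> (\<Sum>(u, v)\<in>I. \<bar>f v - f u\<bar> + \<bar>p\<bar> * (v - u))"
    proof (rule sum_mono, clarify)
      fix u v assume "(u, v) \<in> I"
      then have "u \<le> v" using I by auto
      then have "\<bar>p * (v - u)\<bar> = \<bar>p\<bar> * (v - u)" by (simp add: abs_mult)
      then show "\<bar>f v - p * v - (f u - p * u)\<bar> \<le> \<bar>f v - f u\<bar> + \<bar>p\<bar> * (v - u)"
        by (simp add: algebra_simps abs_le_iff)
    qed
    also have "\<dots> = (\<Sum>(u, v)\<in>I. \<bar>f v - f u\<bar>) + \<bar>p\<bar> * (\<Sum>(u, v)\<in>I. v - u)"
      by (simp add: case_prod_unfold sum.distrib sum_distrib_left)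
    also have "\<bar>p\<bar> * (\<Sum>(u, v)\<in>I. v - u) \<le> \<bar>p\<bar> * \<eta>"
      using I by (intro mult_left_mono) auto
    also have "(\<Sum>(u, v)\<in>I. \<bar>f v - f u\<bar>) < \<epsilon> / 2"
      by (rule \<delta>) (use I in auto)
    finally show "(\<Sum>(u, v)\<in>I. \<bar>f v - p * v - (f u - p * u)\<bar>) < \<epsilon>"
      using \<eta> by simp
  qed (use \<open>\<delta> > 0\<close> \<open>\<eta> > 0\<close> in auto)
qed

text \<open>A level set of the two-sided upper derivate: it contains all points where the derivate
  exceeds q, and at each of its points the derivate is at least q. The frequency quantifier yields
  arbitrarily short intervals at x with slope above q, as a Vitali cover needs; lower derivates are
  reached through -f.\<close>

definition upper_slope_set :: "(real \<Rightarrow> real) \<Rightarrow> real \<Rightarrow> real set" where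
  "upper_slope_set f q = {x. \<exists>\<^sub>F y in at x. q < (f y - f x) / (y - x)}"

lemma upper_slope_set_short:
  assumes "x \<in> upper_slope_set f q" "0 < d"
  shows "\<exists>I. fst I < snd I \<and> q * (snd I - fst I) < f (snd I) - f (fst I) \<and> x \<in> cint I \<and> snd I - fst I < d"
proof -
  have "\<exists>y. y \<noteq> x \<and> dist y x < d \<and> q < (f y - f x) / (y - x)"
    using assms unfolding upper_slope_set_def frequently_at by auto
  then obtain y where y: "y \<noteq> x" "\<bar>y - x\<bar> < d" "q < (f y - f x) / (y - x)"
    by (auto simp: dist_real_def)
  show ?thesis
  proof (cases "x < y")
    case True
    then show ?thesis using y by (intro exI[of _ "(x, y)"]) (auto simp: field_simps)
  next
    case False
    then have "y < x" using y by auto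
    then show ?thesis using y by (intro exI[of _ "(y, x)"]) (auto simp: field_simps)
  qed
qed

text \<open>A G-delta set: having some y within 1 / (n + 1) with slope above q is an open condition
  on x when f is continuous.\<close>

lemma borel_upper_slope_set:
  assumes "continuous_on UNIV f"
  shows "upper_slope_set f q \<in> sets borel"
proof -
  define W where "W = (\<lambda>n::nat. {x. \<exists>y. y \<noteq> x \<and> dist y x < 1 / Suc n \<and> q < (f y - f x) / (y - x)})"
  \<comment> \<open>Multiplying by the square of the denominator removes the division without a case
    distinction on its sign and leaves continuous functions of x.\<close>
  have slope: "q < c / d \<longleftrightarrow> q * d^2 < c * d" if "d \<noteq> 0" for c d :: real
  proof -
    have "c / d = c * d / d^2" using that by (simp add: power2_eq_square)
    then show ?thesis using that by (simp add: pos_less_divide_eq)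
  qed
  have slope: "y \<noteq> x \<and> dist y x < e \<and> q < (f y - f x) / (y - x) \<longleftrightarrow>
      y \<noteq> x \<and> dist y x < e \<and> q * (y - x)^2 < (f y - f x) * (y - x)" for x y e
    using slope[of "y - x" "f y - f x"] by auto
  have "open (W n)" for n
  proof -
    have "W n = (\<Union>y. {x. y \<noteq> x \<and> dist y x < 1 / Suc n \<and> q * (y - x)^2 < (f y - f x) * (y - x)})"
      unfolding W_def using slope by blast
    moreover have "open {x. y \<noteq> x \<and> dist y x < 1 / Suc n \<and> q * (y - x)^2 < (f y - f x) * (y - x)}" for y
      by (intro open_Collect_conj open_Collect_neq open_Collect_less continuous_intros assms)
    ultimately show ?thesis by auto
  qed
  moreover have "upper_slope_set f q = (\<Inter>n. W n)"
  proof (intro set_eqI iffI)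
    fix x assume "x \<in> upper_slope_set f q"
    then show "x \<in> (\<Inter>n. W n)"
      unfolding upper_slope_set_def frequently_at W_def by (auto simp del: of_nat_Suc)
  next
    fix x assume x: "x \<in> (\<Inter>n. W n)"
    show "x \<in> upper_slope_set f q"
      unfolding upper_slope_set_def frequently_at mem_Collect_eq
    proof (intro allI impI)
      fix d :: real assume "d > 0"
      then obtain n where "1 / Suc n < d" using nat_approx_posE by blast
      then show "\<exists>y\<in>UNIV. y \<noteq> x \<and> dist y x < d \<and> q < (f y - f x) / (y - x)"
        using x unfolding W_def by (fastforce intro: less_trans)
    qed
  qed
  ultimately show ?thesis by auto
qed

lemma measure_Int_cint_le:
  assumes "fst I \<le> snd I"
  shows "measure lebesgue (S \<inter> cint I) \<le> snd I - fst I"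
proof (cases "S \<inter> cint I \<in> sets lebesgue")
  case True
  then have "measure lebesgue (S \<inter> cint I) \<le> measure lebesgue (cint I)"
    by (intro measure_mono_fmeasurable) auto
  then show ?thesis using assms by simp
next
  case False
  then show ?thesis using assms by (simp add: measure_notin_sets)
qed

text \<open>If the set had measure \<open>\<mu>\<close> > 0 near x, disjoint intervals of slope
  above n would have total length above \<open>\<mu>\<close> / 2 and thus total increment above n
  \<open>\<mu>\<close> / 2 > 1. Absolute continuity on [x - 1, x + 1] keeps this increment below 1
  once the neighbourhood is shorter than \<open>\<delta>\<close>.\<close>

lemma negligible_infinite_upper_slope:
  assumes cont: "continuous_on UNIV f" and ac: "locally_abs_continuous f"
  shows "negligible (\<Inter>n::nat. upper_slope_set f (real n))" (is "negligible ?S")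
proof (rule locally_negligible_alt[THEN iffD2], rule ballI)
  fix x assume "x \<in> ?S"
  have "abs_continuous_on_interval f (x - 1) (x + 1)"
    using ac by (simp add: locally_abs_continuous_def)
  then obtain \<delta> where "\<delta> > 0" and \<delta>: "\<forall>G. finite G \<longrightarrow> (\<forall>I\<in>G. x - 1 \<le> fst I \<and> fst I \<le> snd I \<and> snd I \<le> x + 1)
    \<longrightarrow> nonoverlapping G \<longrightarrow> (\<Sum>I\<in>G. snd I - fst I) < \<delta>
    \<longrightarrow> \<bar>incr f G\<bar> < 1"
    using abs_continuous_on_intervalD[of f _ _ 1] zero_less_one by blast
  define \<eta> where "\<eta> = min 1 \<delta> / 3"
  define U where "U = {x - \<eta><..<x + \<eta>}"
  have \<eta>: "\<eta> > 0" "\<eta> \<le> 1" "2 * \<eta> < \<delta>" using \<open>\<delta> > 0\<close> by (auto simp: \<eta>_def min_def)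
  have U: "U \<in> lmeasurable" "open U" "measure lebesgue U = 2 * \<eta>"
    using \<eta> by (auto simp: U_def)
  have "?S \<in> sets borel"
    using borel_upper_slope_set[OF cont] by auto
  then have SU: "?S \<inter> U \<in> lmeasurable"
    by (intro fmeasurable_Int_fmeasurable[of U, simplified Int_commute] U) auto
  have "measure lebesgue (?S \<inter> U) = 0"
  proof (rule ccontr)
    define \<mu> where "\<mu> = measure lebesgue (?S \<inter> U)"
    assume "measure lebesgue (?S \<inter> U) \<noteq> 0"
    then have "\<mu> > 0"
      by (simp add: \<mu>_def zero_less_measure_iff)
    obtain n :: nat where n: "2 / \<mu> < real n" using reals_Archimedean2 by blast
    define K where "K = {I. fst I < snd I \<and> real n * (snd I - fst I) < f (snd I) - f (fst I)}"
    have fine: "\<exists>I\<in>K. y \<in> cint I \<and> snd I - fst I < d" if "y \<in> ?S \<inter> U" "0 < d" for y d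
      using upper_slope_set_short[of y f "real n" d] that by (auto simp: K_def)
    have lenK: "fst I < snd I" if "I \<in> K" for I using that by (simp add: K_def)
    obtain D where D: "finite D" "D \<subseteq> K" "\<And>I. I \<in> D \<Longrightarrow> cint I \<subseteq> U"
       "separated D"
       "measure lebesgue (?S \<inter> U) - \<mu> / 2 < (\<Sum>I\<in>D. measure lebesgue (?S \<inter> U \<inter> cint I))"
      using finite_Vitali_cover[OF SU \<open>open U\<close> Int_lower2 lenK fine half_gt_zero[OF \<open>\<mu> > 0\<close>]] by blast
    have len: "fst I < snd I" if "I \<in> D" for I using D that by (auto simp: K_def)
    have "\<mu> / 2 < (\<Sum>I\<in>D. measure lebesgue (?S \<inter> U \<inter> cint I))"
      using D by (simp add: \<mu>_def)
    also have "\<dots> \<le> (\<Sum>I\<in>D. snd I - fst I)"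
      by (intro sum_mono measure_Int_cint_le less_imp_le len)
    finally have 1: "\<mu> / 2 < (\<Sum>I\<in>D. snd I - fst I)" .
    have "(\<Sum>I\<in>D. snd I - fst I) \<le> measure lebesgue U"
      by (rule sum_cint_le_measure) (use D len U in \<open>auto intro: less_imp_le\<close>)
    then have 2: "(\<Sum>I\<in>D. snd I - fst I) < \<delta>" using \<eta> U by simp
    have "\<bar>incr f D\<bar> < 1"
    proof (rule \<delta>[rule_format, OF D(1) _ disjnt_cint_imp_disjoint_family[OF D(4)] 2])
      fix I assume I: "I \<in> D"
      then have "fst I \<in> U" "snd I \<in> U" using D(3)[OF I] len[OF I] by auto
      then show "x - 1 \<le> fst I \<and> fst I \<le> snd I \<and> snd I \<le> x + 1"
        using \<eta> len[OF I] by (auto simp: U_def)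
    qed
    moreover have "real n * (\<Sum>I\<in>D. snd I - fst I) \<le> incr f D"
      unfolding sum_distrib_left by (rule sum_mono) (use D in \<open>auto simp: K_def intro: less_imp_le\<close>)
    moreover have "1 < real n * (\<Sum>I\<in>D. snd I - fst I)"
    proof -
      have "1 < real n * (\<mu> / 2)" using n \<open>\<mu> > 0\<close> by (simp add: field_simps)
      also have "\<dots> \<le> real n * (\<Sum>I\<in>D. snd I - fst I)"
        using 1 by (intro mult_left_mono) auto
      finally show ?thesis .
    qed
    ultimately show False by linarith
  qed
  then have "negligible (?S \<inter> U)" using SU by (simp add: negligible_iff_measure)
  moreover have "openin (top_of_set ?S) (?S \<inter> U)" using U by (simp add: openin_open_Int)
  moreover have "x \<in> ?S \<inter> U" using \<open>x \<in> ?S\<close> \<eta> by (auto simp: U_def)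
  ultimately show "\<exists>U. openin (top_of_set ?S) U \<and> x \<in> U \<and> negligible U" by blast
qed

text \<open>Cover the set, of measure \<open>\<mu>\<close>, by disjoint intervals over which f
  decreases, inside an open set of measure at most \<open>\<mu>\<close> + e; within each of them
  cover it again by intervals of slope above q. The total increment is at most 0 over the outer
  intervals and at least q \<open>\<mu>\<close> / 2 over the inner ones, while the gaps between the
  two, of length below 3 e, account for less than q \<open>\<mu>\<close> / 2.\<close>

lemma negligible_oscillating_slope_interval:
  assumes cont: "continuous_on UNIV f" and ac: "abs_continuous_on_interval f a b" and "q > 0"
  shows "negligible (upper_slope_set f q \<inter> upper_slope_set (\<lambda>x. - f x) 0 \<inter> {a<..<b})" (is "negligible ?N")
proof -
  have "upper_slope_set f q \<inter> upper_slope_set (\<lambda>x. - f x) 0 \<in> sets borel"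
    by (intro sets.Int borel_upper_slope_set cont continuous_intros)
  then have N: "?N \<in> lmeasurable"
    by (intro fmeasurable_Int_fmeasurable[of "{a<..<b}", simplified Int_commute]) (auto simp: Int_ac)
  define \<mu> where "\<mu> = measure lebesgue ?N"
  have "\<mu> = 0"
  proof (rule ccontr)
    assume "\<mu> \<noteq> 0"
    then have "\<mu> > 0" by (simp add: \<mu>_def zero_less_measure_iff)
    have "q * \<mu> / 2 > 0" using \<open>\<mu> > 0\<close> \<open>q > 0\<close> by simp
    then obtain \<delta> where "\<delta> > 0" and \<delta>: "\<forall>G. finite G \<longrightarrow> (\<forall>I\<in>G. a \<le> fst I \<and> fst I \<le> snd I \<and> snd I \<le> b)
      \<longrightarrow> nonoverlapping G \<longrightarrow> (\<Sum>I\<in>G. snd I - fst I) < \<delta>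
      \<longrightarrow> \<bar>incr f G\<bar> < q * \<mu> / 2"
      using abs_continuous_on_intervalD[OF ac] by blast
    \<comment> \<open>One e for the excess of U, one for the loss of the outer cover, one for that
      of the inner covers: \<open>3 * e < \<delta>\<close> controls the gaps, and
      \<open>e \<le> \<mu> / 4\<close> leaves an inner length above \<open>\<mu>\<close> /
      2.\<close>
    define e where "e = min (\<delta> / 4) (\<mu> / 4)"
    have e: "e > 0" "3 * e < \<delta>" "e \<le> \<mu> / 4"
      using \<open>\<delta> > 0\<close> \<open>\<mu> > 0\<close> by (auto simp: e_def min_def)
    obtain T where T: "open T" "?N \<subseteq> T" "T - ?N \<in> lmeasurable" "emeasure lebesgue (T - ?N) < ennreal e"
      using sets_lebesgue_outer_open[of ?N e] N e(1) by blast
    define U where "U = T \<inter> {a<..<b}"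
    have U: "open U" "?N \<subseteq> U" "U \<subseteq> {a<..<b}" using T by (auto simp: U_def)
    have Um: "U \<in> lmeasurable"
      unfolding U_def using T(1) by (intro fmeasurable_Int_fmeasurable[of "{a<..<b}" _ T, simplified Int_commute])
         (auto simp: Int_ac)
    have "measure lebesgue U \<le> \<mu> + e"
    proof -
      have "measure lebesgue U \<le> measure lebesgue (?N \<union> (T - ?N))"
        using Um U T N by (intro measure_mono_fmeasurable fmeasurable.Un) (auto simp: U_def)
      also have "\<dots> \<le> \<mu> + measure lebesgue (T - ?N)"
        unfolding \<mu>_def using T N by (intro measure_Un_le) auto
      also have "measure lebesgue (T - ?N) \<le> e"
        using T(4) e(1) by (simp add: measure_def enn2real_leI less_imp_le)
      finally show ?thesis by simp
    qed
    define K where "K = {I. fst I < snd I \<and> f (snd I) < f (fst I)}"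
    define L where "L = {I. fst I < snd I \<and> q * (snd I - fst I) < f (snd I) - f (fst I)}"
    have fineK: "\<exists>I\<in>K. y \<in> cint I \<and> snd I - fst I < d" if "y \<in> ?N" "0 < d" for y d
      using upper_slope_set_short[of y "\<lambda>x. - f x" 0 d] that by (auto simp: K_def)
    have fineL: "\<exists>I\<in>L. y \<in> cint I \<and> snd I - fst I < d" if "y \<in> ?N" "0 < d" for y d
      using upper_slope_set_short[of y f q d] that by (auto simp: L_def)
    have lenK: "fst I < snd I" if "I \<in> K" for I using that by (simp add: K_def)
    have lenL: "fst I < snd I" if "I \<in> L" for I using that by (simp add: L_def)
    obtain C where C: "finite C" "C \<subseteq> K" "\<And>I. I \<in> C \<Longrightarrow> cint I \<subseteq> U"
       "separated C"
       "\<mu> - e < (\<Sum>I\<in>C. measure lebesgue (?N \<inter> cint I))"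
      unfolding \<mu>_def
      using finite_Vitali_cover[OF N U(1,2) lenK fineK e(1)] by blast
    have lenC: "fst I < snd I" if "I \<in> C" for I using C that by (auto simp: K_def)
    have Cab: "a < fst I" "snd I < b" if "I \<in> C" for I
    proof -
      have "fst I \<in> cint I" "snd I \<in> cint I" using lenC[OF that] by auto
      then have "fst I \<in> {a<..<b}" "snd I \<in> {a<..<b}" using C(3)[OF that] U(3) by blast+
      then show "a < fst I" "snd I < b" by auto
    qed
    \<comment> \<open>The loss allowed to the inner covers is shared equally; the added 1 keeps the
      share positive for empty C.\<close>
    define e' where "e' = e / (card C + 1)"
    have "e' > 0" using e by (simp add: e'_def)
    define P where "P = (\<lambda>I D G. finite D \<and> D \<subseteq> L \<and> (\<forall>J\<in>D. fst I \<le> fst J \<and> fst J < snd J \<and> snd J \<le> snd I) \<and>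
        measure lebesgue (?N \<inter> cint I) - e' < (\<Sum>J\<in>D. snd J - fst J) \<and>
        finite G \<and> (\<forall>J\<in>G. fst I \<le> fst J \<and> fst J \<le> snd J \<and> snd J \<le> snd I) \<and>
        nonoverlapping G \<and>
        (\<forall>f::real\<Rightarrow>real. f (snd I) - f (fst I) = incr f D + incr f G))"
    have inner: "\<exists>D G. P I D G" if "I \<in> C" for I
    proof -
      have I: "fst I < snd I" using lenC that by auto
      have NI: "?N \<inter> {fst I<..<snd I} \<in> lmeasurable"
        by (rule fmeasurable_Int_fmeasurable[OF N]) auto
      \<comment> \<open>Dropping the endpoints costs no measure and gives the open set in which the
        inner Vitali cover stays.\<close>
      have eq: "measure lebesgue (?N \<inter> cint I) = measure lebesgue (?N \<inter> {fst I<..<snd I})"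
      proof (rule measure_negligible_symdiff[OF NI], rule negligible_subset)
        show "negligible {fst I, snd I}" by (intro negligible_finite) auto
      qed auto
      have fineI: "\<exists>I\<in>L. x \<in> cint I \<and> snd I - fst I < d"
        if "x \<in> ?N \<inter> {fst I<..<snd I}" "0 < d" for x d
        using fineL[of x d] that by simp
      obtain D where D: "finite D" "D \<subseteq> L" "\<And>J. J \<in> D \<Longrightarrow> cint J \<subseteq> {fst I<..<snd I}"
         "separated D"
         "measure lebesgue (?N \<inter> {fst I<..<snd I}) - e' < (\<Sum>J\<in>D. measure lebesgue (?N \<inter> {fst I<..<snd I} \<inter> cint J))"
        using finite_Vitali_cover[OF NI open_greaterThanLessThan Int_lower2 lenL fineI \<open>e' > 0\<close>] by blast
      have DI: "fst I \<le> fst J \<and> fst J < snd J \<and> snd J \<le> snd I" if "J \<in> D" for J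
      proof -
        have "fst J < snd J" using D(2) that by (auto simp: L_def)
        then have "fst J \<in> cint J" "snd J \<in> cint J" by auto
        then have "fst J \<in> {fst I<..<snd I}" "snd J \<in> {fst I<..<snd I}" using D(3)[OF that] by blast+
        then show ?thesis using \<open>fst J < snd J\<close> by auto
      qed
      have "(\<Sum>J\<in>D. measure lebesgue (?N \<inter> {fst I<..<snd I} \<inter> cint J)) \<le> (\<Sum>J\<in>D. snd J - fst J)"
        using DI by (intro sum_mono measure_Int_cint_le less_imp_le) auto
      then have e5: "measure lebesgue (?N \<inter> cint I) - e' < (\<Sum>J\<in>D. snd J - fst J)"
        using D(5) eq by linarith
      have DIb: "\<forall>J\<in>D. fst I \<le> fst J \<and> fst J < snd J \<and> snd J \<le> snd I" using DI by blast
      have "\<exists>G. finite G \<and> (\<forall>J\<in>G. fst I \<le> fst J \<and> fst J \<le> snd J \<and> snd J \<le> snd I) \<and>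
        nonoverlapping G \<and>
        (\<forall>f::real\<Rightarrow>real. f (snd I) - f (fst I) = incr f D + incr f G)"
        by (rule interval_gaps[OF D(1) less_imp_le[OF I] _ D(4)]) (rule DI)
      then obtain G where G: "finite G \<and> (\<forall>J\<in>G. fst I \<le> fst J \<and> fst J \<le> snd J \<and> snd J \<le> snd I) \<and>
        nonoverlapping G \<and>
        (\<forall>f::real\<Rightarrow>real. f (snd I) - f (fst I) = incr f D + incr f G)"
        by (elim exE)
      show ?thesis
        unfolding P_def by (rule exI[of _ D], rule exI[of _ G], intro conjI[OF D(1)] conjI[OF D(2)] conjI[OF DIb] conjI[OF e5], rule G)
    qed
    have "\<forall>I\<in>C. \<exists>D G. P I D G" using inner by blast
    then obtain D G where "\<And>I. I \<in> C \<Longrightarrow> P I (D I) (G I)" by metis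
    note DG = this[unfolded P_def]
    have GI: "fst I \<le> fst J \<and> fst J \<le> snd J \<and> snd J \<le> snd I" if "I \<in> C" "J \<in> G I" for I J
      using DG[OF that(1)] that(2) by blast
    define GG where "GG = (\<Union>I\<in>C. G I)"
    define s where "s = (\<Sum>I\<in>C. snd I - fst I)"
    define s' where "s' = (\<Sum>I\<in>C. \<Sum>J\<in>D I. snd J - fst J)"
    have disjC: "disjnt (cint I) (cint I')" if "I \<in> C" "I' \<in> C" "I \<noteq> I'" for I I'
      using C(4) that by (auto simp: pairwise_def)
    have sumGG: "(\<Sum>J\<in>GG. h J) = (\<Sum>I\<in>C. \<Sum>J\<in>G I. h J)" for h :: "real \<times> real \<Rightarrow> real"
      unfolding GG_def
    proof (rule sum.UNION_disjoint[OF C(1)])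
      show "\<forall>i\<in>C. finite (G i)" using DG by blast
      show "\<forall>i\<in>C. \<forall>j\<in>C. i \<noteq> j \<longrightarrow> G i \<inter> G j = {}"
      proof (intro ballI impI, rule ccontr)
        fix I I' assume I: "I \<in> C" "I' \<in> C" "I \<noteq> I'" "G I \<inter> G I' \<noteq> {}"
        then obtain J where "J \<in> G I" "J \<in> G I'" by blast
        then have "fst J \<in> cint I" "fst J \<in> cint I'" using GI[OF I(1)] GI[OF I(2)] by fastforce+
        then show False using disjC[OF I(1-3)] by (auto simp: disjnt_def)
      qed
    qed
    have GG: "finite GG" "nonoverlapping GG"
      "\<And>J. J \<in> GG \<Longrightarrow> a \<le> fst J \<and> fst J \<le> snd J \<and> snd J \<le> b"
    proof -
      show "finite GG" using DG C(1) by (auto simp: GG_def)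
      show "a \<le> fst J \<and> fst J \<le> snd J \<and> snd J \<le> b" if J: "J \<in> GG" for J
      proof -
        obtain I where "I \<in> C" "J \<in> G I" using J unfolding GG_def by blast
        then show ?thesis using GI[of I J] Cab[of I] by auto
      qed
      show "nonoverlapping GG"
        unfolding disjoint_family_on_def case_prod_unfold
      proof (intro ballI impI)
        fix J J' assume J: "J \<in> GG" "J' \<in> GG" "J \<noteq> J'"
        obtain I I' where I: "I \<in> C" "I' \<in> C" "J \<in> G I" "J' \<in> G I'" using J by (auto simp: GG_def)
        show "{fst J<..<snd J} \<inter> {fst J'<..<snd J'} = {}"
        proof (cases "I = I'")
          case True
          then show ?thesis using DG[OF I(1)] I J unfolding disjoint_family_on_def case_prod_unfold by blast
        next
          case False
          have "{fst J<..<snd J} \<subseteq> cint I" "{fst J'<..<snd J'} \<subseteq> cint I'"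
            using GI[OF I(1,3)] GI[OF I(2,4)] by auto
          then show ?thesis using disjC[OF I(1,2) False] unfolding disjnt_def by blast
        qed
      qed
    qed
    have decomp: "incr h C = (\<Sum>I\<in>C. \<Sum>J\<in>D I. h (snd J) - h (fst J))
       + incr h GG" for h :: "real \<Rightarrow> real"
      unfolding sumGG sum.distrib[symmetric] by (rule sum.cong) (use DG in blast)+
    have "s \<le> measure lebesgue U"
      unfolding s_def by (rule sum_cint_le_measure) (use C lenC Um in \<open>auto intro: less_imp_le\<close>)
    then have s: "s \<le> \<mu> + e" using \<open>measure lebesgue U \<le> \<mu> + e\<close> by simp
    have s': "\<mu> - 2 * e < s'"
    proof -
      have "card C * e' \<le> e" using e by (simp add: e'_def field_simps)
      then have "\<mu> - 2 * e < (\<Sum>I\<in>C. measure lebesgue (?N \<inter> cint I)) - card C * e'" using C(5) by linarith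
      also have "\<dots> = (\<Sum>I\<in>C. measure lebesgue (?N \<inter> cint I) - e')" by (simp add: sum_subtractf)
      also have "\<dots> \<le> s'" unfolding s'_def by (intro sum_mono less_imp_le) (use DG in blast)
      finally show ?thesis .
    qed
    \<comment> \<open>The decomposition applied to the identity function measures the gaps.\<close>
    have "(\<Sum>J\<in>GG. snd J - fst J) = s - s'"
      using decomp[of "\<lambda>x. x"] by (simp add: s_def s'_def)
    then have "(\<Sum>J\<in>GG. snd J - fst J) < \<delta>" using s s' e by linarith
    then have 1: "\<bar>incr f GG\<bar> < q * \<mu> / 2"
      using \<delta> GG by blast
    have 2: "incr f C \<le> 0"
      by (rule sum_nonpos) (use C(2) in \<open>auto simp: K_def\<close>)
    have 3: "q * s' \<le> (\<Sum>I\<in>C. \<Sum>J\<in>D I. f (snd J) - f (fst J))"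
      unfolding s'_def sum_distrib_left
      by (intro sum_mono) (use DG in \<open>force simp: L_def\<close>)
    have "q * (\<mu> / 2) \<le> q * s'" using s' e \<open>q > 0\<close> by (intro mult_left_mono) auto
    then show False using 1 2 3 decomp[of f] by (simp add: abs_less_iff)
  qed
  then show ?thesis using N by (simp add: negligible_iff_measure \<mu>_def)
qed

lemma locally_abs_continuous_imp_continuous:
  assumes "locally_abs_continuous f"
  shows "continuous_on UNIV f"
  unfolding continuous_on_eq_continuous_at[OF open_UNIV]
proof
  fix x :: real
  show "isCont f x"
    unfolding continuous_at_eps_delta
  proof (intro allI impI)
    fix e :: real assume "e > 0"
    have "abs_continuous_on_interval f (x - 1) (x + 1)"
      using assms by (simp add: locally_abs_continuous_def)
    from abs_continuous_on_intervalD[OF this \<open>e > 0\<close>]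
    obtain \<delta> where "\<delta> > 0" and \<delta>: "\<forall>G. finite G \<longrightarrow> (\<forall>I\<in>G. x - 1 \<le> fst I \<and> fst I \<le> snd I \<and> snd I \<le> x + 1)
      \<longrightarrow> disjoint_family_on (\<lambda>(u, v). {u<..<v}) G \<longrightarrow> (\<Sum>I\<in>G. snd I - fst I) < \<delta>
      \<longrightarrow> \<bar>\<Sum>I\<in>G. f (snd I) - f (fst I)\<bar> < e" by blast
    show "\<exists>d>0. \<forall>x'. dist x' x < d \<longrightarrow> dist (f x') (f x) < e"
    proof (intro exI[of _ "min 1 \<delta>"] conjI allI impI)
      fix y assume "dist y x < min 1 \<delta>"
      then have "y - x < 1" "x - y < 1" "y - x < \<delta>" "x - y < \<delta>" by (auto simp: dist_real_def)
      then have "\<bar>\<Sum>I\<in>{(min x y, max x y)}. f (snd I) - f (fst I)\<bar> < e"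
        by (intro \<delta>[rule_format]) (auto simp: disjoint_family_on_def min_def max_def)
      then show "dist (f y) (f x) < e" by (auto simp: dist_real_def min_def max_def abs_minus_commute split: if_splits)
    qed (use \<open>\<delta> > 0\<close> in auto)
  qed
qed

lemma locally_abs_continuous_uminus:
  "locally_abs_continuous f \<Longrightarrow> locally_abs_continuous (\<lambda>x. - f x)"
proof -
  have "\<bar>- a - - b\<bar> = \<bar>a - b\<bar>" for a b :: real by simp
  then show "locally_abs_continuous f \<Longrightarrow> locally_abs_continuous (\<lambda>x. - f x)"
    unfolding locally_abs_continuous_def abs_continuous_on_interval_def by presburger
qed

lemma upper_slope_set_subtract_linear:
  "upper_slope_set (\<lambda>x. f x - p * x) q = upper_slope_set f (p + q)"
proof -
  have "(f y - p * y - (f x - p * x)) / (y - x) = (f y - f x) / (y - x) - p" if "y \<noteq> x" for x y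
    using that by (simp add: field_simps)
  then have "y \<noteq> x \<and> dist y x < d \<and> q < (f y - p * y - (f x - p * x)) / (y - x) \<longleftrightarrow>
      y \<noteq> x \<and> dist y x < d \<and> p + q < (f y - f x) / (y - x)" for x y d
    by auto
  then show ?thesis
    unfolding upper_slope_set_def frequently_at by simp
qed

text \<open>Subtracting p x turns the levels p < q into 0 < q - p, and the line is exhausted by
  bounded intervals, where absolute continuity is uniform.\<close>

lemma negligible_oscillating_slope:
  assumes "locally_abs_continuous f" "p < q"
  shows "negligible (upper_slope_set f q \<inter> upper_slope_set (\<lambda>x. - f x) (- p))"
proof -
  let ?g = "\<lambda>x. f x - p * x"
  have cont: "continuous_on UNIV ?g"
    using locally_abs_continuous_imp_continuous[OF assms(1)] by (intro continuous_intros)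
  have eq: "upper_slope_set f q = upper_slope_set ?g (q - p)"
    by (simp add: upper_slope_set_subtract_linear)
  have "upper_slope_set (\<lambda>x. - ?g x) 0 = upper_slope_set (\<lambda>x. - f x - (- p) * x) 0"
    by (simp add: algebra_simps)
  then have eq': "upper_slope_set (\<lambda>x. - f x) (- p) = upper_slope_set (\<lambda>x. - ?g x) 0"
    by (simp only: upper_slope_set_subtract_linear) simp
  have "negligible (upper_slope_set ?g (q - p) \<inter> upper_slope_set (\<lambda>x. - ?g x) 0 \<inter> {- real n<..<real n})" for n :: nat
    using assms by (intro negligible_oscillating_slope_interval[OF cont] abs_continuous_on_interval_subtract_linear)
       (auto simp: locally_abs_continuous_def)
  then have "negligible (\<Union>n::nat. upper_slope_set ?g (q - p) \<inter> upper_slope_set (\<lambda>x. - ?g x) 0 \<inter> {- real n<..<real n})"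
    by (intro negligible_countable_Union) auto
  moreover have "\<exists>n::nat. - real n < x \<and> x < real n" for x
  proof -
    obtain n :: nat where "\<bar>x\<bar> < real n" using reals_Archimedean2 by blast
    then show ?thesis by (intro exI[of _ n]) auto
  qed
  then have "upper_slope_set ?g (q - p) \<inter> upper_slope_set (\<lambda>x. - ?g x) 0 \<subseteq>
      (\<Union>n::nat. upper_slope_set ?g (q - p) \<inter> upper_slope_set (\<lambda>x. - ?g x) 0 \<inter> {- real n<..<real n})"
    by auto
  ultimately show ?thesis unfolding eq eq' by (rule negligible_subset)
qed

text \<open>The limit is the infimum of the eventual upper bounds of the difference quotient, finite
  because of c and d. For rational p < q below it, q is not an eventual upper bound, so
  \<open>osc\<close> makes p an eventual lower bound. Restricting to rational levels keeps the
  exceptional set a countable union.\<close>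

lemma differentiable_if_slopes_converge:
  fixes f :: "real \<Rightarrow> real"
  assumes "x \<notin> upper_slope_set f c" "x \<notin> upper_slope_set (\<lambda>x. - f x) d"
    and osc: "\<And>p q. p \<in> \<rat> \<Longrightarrow> q \<in> \<rat> \<Longrightarrow> p < q \<Longrightarrow> x \<in> upper_slope_set f q \<Longrightarrow> x \<notin> upper_slope_set (\<lambda>x. - f x) (- p)"
  shows "f differentiable (at x)"
proof -
  define s where "s = (\<lambda>y. (f y - f x) / (y - x))"
  define Q where "Q = {q. \<forall>\<^sub>F y in at x. s y \<le> q}"
  have up: "x \<notin> upper_slope_set f q \<longleftrightarrow> q \<in> Q" for q
    unfolding upper_slope_set_def Q_def s_def by (simp add: not_frequently not_less)
  have lo: "x \<notin> upper_slope_set (\<lambda>x. - f x) (- p) \<longleftrightarrow> (\<forall>\<^sub>F y in at x. p \<le> s y)" for p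
  proof -
    have "(- f y - - f x) / (y - x) = - s y" for y
      unfolding s_def minus_divide_left by simp
    then show ?thesis unfolding upper_slope_set_def by (simp add: not_frequently not_less)
  qed
  have "c \<in> Q" using assms(1) up by simp
  have bd: "- d \<le> q" if "q \<in> Q" for q
  proof -
    have "\<forall>\<^sub>F y in at x. - d \<le> s y" using assms(2) lo[of "- d"] by simp
    moreover have "\<forall>\<^sub>F y in at x. s y \<le> q" using that by (simp add: Q_def)
    ultimately have "\<forall>\<^sub>F y in at x. - d \<le> q" by eventually_elim simp
    then show ?thesis by (simp add: eventually_const_iff trivial_limit_at)
  qed
  then have bdd: "bdd_below Q" by (rule bdd_belowI)
  have "(s \<longlongrightarrow> Inf Q) (at x)"
  proof (rule order_tendstoI)
    fix a assume "a < Inf Q"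
    obtain p where p: "p \<in> \<rat>" "a < p" "p < Inf Q" using Rats_dense_in_real[OF \<open>a < Inf Q\<close>] by blast
    obtain q where q: "q \<in> \<rat>" "p < q" "q < Inf Q" using Rats_dense_in_real[OF p(3)] by blast
    have "q \<notin> Q" using q cInf_lower[OF _ bdd, of q] by auto
    then have "x \<in> upper_slope_set f q" using up by blast
    then have "\<forall>\<^sub>F y in at x. p \<le> s y" using osc[OF p(1) q(1,2)] lo by blast
    then show "\<forall>\<^sub>F y in at x. a < s y" by eventually_elim (use p in simp)
  next
    fix a assume "Inf Q < a"
    then obtain q where "q \<in> Q" "q < a" using \<open>c \<in> Q\<close> cInf_lessD[of Q a] by blast
    then have "\<forall>\<^sub>F y in at x. s y \<le> q" by (simp add: Q_def)
    then show "\<forall>\<^sub>F y in at x. s y < a" by eventually_elim (use \<open>q < a\<close> in simp)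
  qed
  then have "(f has_field_derivative Inf Q) (at x)"
    unfolding has_field_derivative_iff s_def .
  then show ?thesis using real_differentiable_def by blast
qed

text \<open>At a point without derivative, the upper derivate of f or of -f is infinite, or the
  slopes oscillate across a pair of rational levels; these are countably many null sets.\<close>

theorem negligible_not_differentiable:
  assumes "locally_abs_continuous f"
  shows "negligible {x. \<not> f differentiable (at x)}"
proof -
  note cont = locally_abs_continuous_imp_continuous[OF assms]
  let ?A = "\<Inter>n::nat. upper_slope_set f (real n)" and ?B = "\<Inter>n::nat. upper_slope_set (\<lambda>x. - f x) (real n)"
  let ?C = "\<lambda>(p, q). if p < q then upper_slope_set f q \<inter> upper_slope_set (\<lambda>x. - f x) (- p) else {}"
  have "negligible (\<Union>r\<in>\<rat> \<times> \<rat>. ?C r)"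
  proof (rule negligible_countable_Union)
    show "countable (?C ` (\<rat> \<times> \<rat>))" by (intro countable_image countable_SIGMA countable_rat)
    show "negligible S" if "S \<in> ?C ` (\<rat> \<times> \<rat>)" for S
      using that negligible_oscillating_slope[OF assms] by (auto split: if_splits)
  qed
  moreover have "negligible ?A" by (rule negligible_infinite_upper_slope[OF cont assms])
  moreover have "negligible ?B"
    by (rule negligible_infinite_upper_slope) (intro continuous_intros cont locally_abs_continuous_uminus assms)+
  ultimately have "negligible (?A \<union> ?B \<union> (\<Union>r\<in>\<rat> \<times> \<rat>. ?C r))" by (intro negligible_Un)
  then show ?thesis
  proof (rule negligible_subset, intro subsetI)
    fix x assume x: "x \<in> {x. \<not> f differentiable (at x)}"
    show "x \<in> ?A \<union> ?B \<union> (\<Union>r\<in>\<rat> \<times> \<rat>. ?C r)"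
    proof (rule ccontr)
      assume *: "x \<notin> ?A \<union> ?B \<union> (\<Union>r\<in>\<rat> \<times> \<rat>. ?C r)"
      then obtain n m :: nat where n: "x \<notin> upper_slope_set f (real n)" "x \<notin> upper_slope_set (\<lambda>x. - f x) (real m)"
        by blast
      have "x \<notin> upper_slope_set (\<lambda>x. - f x) (- p)"
        if "p \<in> \<rat>" "q \<in> \<rat>" "p < q" "x \<in> upper_slope_set f q" for p q
      proof
        assume "x \<in> upper_slope_set (\<lambda>x. - f x) (- p)"
        then have "x \<in> ?C (p, q)" using that by simp
        then show False using * that(1,2) by blast
      qed
      then have "f differentiable (at x)" by (rule differentiable_if_slopes_converge[OF n])
      then show False using x by simp
    qed
  qed
qed

section \<open>The seminorm as a Lipschitz constant\<close>

lemma AE_lebesgue_iff_negligible: "(AE x in lebesgue. P x) \<longleftrightarrow> negligible {x. \<not> P x}"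
  by (simp add: completion.AE_iff_null_sets negligible_iff_null_sets)

text \<open>Stands in for the fundamental theorem of calculus for the Lebesgue integral. Almost
  every point lies in arbitrarily short intervals over which the slope is at most K +
  \<open>\<epsilon>\<close> in absolute value; a finite disjoint selection misses length less than
  \<open>\<delta>\<close>, where absolute continuity allows an increment below
  \<open>\<epsilon>\<close>.\<close>

lemma AE_deriv_bound_imp_increment_le:
  assumes ac: "locally_abs_continuous f" and K: "0 \<le> K"
    and bd: "AE x in lebesgue. \<bar>deriv f x\<bar> \<le> K" and "a < b"
  shows "\<bar>f b - f a\<bar> \<le> K * (b - a)"
proof -
  have main: "\<bar>f b - f a\<bar> \<le> (K + \<epsilon>) * (b - a) + \<epsilon>" if "\<epsilon> > 0" for \<epsilon>
  proof -
    have acab: "abs_continuous_on_interval f a b"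
      using ac \<open>a < b\<close> by (simp add: locally_abs_continuous_def)
    from abs_continuous_on_intervalD[OF this \<open>\<epsilon> > 0\<close>]
    obtain \<delta> where "\<delta> > 0" and \<delta>: "\<forall>G. finite G \<longrightarrow> (\<forall>I\<in>G. a \<le> fst I \<and> fst I \<le> snd I \<and> snd I \<le> b)
      \<longrightarrow> nonoverlapping G \<longrightarrow> (\<Sum>I\<in>G. snd I - fst I) < \<delta>
      \<longrightarrow> \<bar>incr f G\<bar> < \<epsilon>" by blast
    define N where "N = {x. \<not> f differentiable (at x)} \<union> {x. \<not> \<bar>deriv f x\<bar> \<le> K}"
    define S where "S = {a<..<b} - N"
    have N: "negligible N"
      using bd unfolding N_def AE_lebesgue_iff_negligible
      by (intro negligible_Un negligible_not_differentiable ac)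
    have S: "S \<in> lmeasurable"
      unfolding S_def by (intro fmeasurable_Diff negligible_imp_sets N) auto
    have "measure lebesgue {a<..<b} = measure lebesgue S"
      by (rule measure_negligible_symdiff[OF S], rule negligible_subset[OF N]) (auto simp: S_def)
    then have mS: "measure lebesgue S = b - a" using \<open>a < b\<close> by simp
    define L where "L = {I. fst I < snd I \<and> \<bar>f (snd I) - f (fst I)\<bar> \<le> (K + \<epsilon>) * (snd I - fst I)}"
    have lenL: "fst I < snd I" if "I \<in> L" for I using that by (simp add: L_def)
    have fine: "\<exists>I\<in>L. x \<in> cint I \<and> snd I - fst I < d" if "x \<in> S" "0 < d" for x d
    proof -
      have "f differentiable (at x)" "\<bar>deriv f x\<bar> \<le> K" using that by (auto simp: S_def N_def)
      then have "((\<lambda>y. (f y - f x) / (y - x)) \<longlongrightarrow> deriv f x) (at x)"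
        using DERIV_deriv_iff_real_differentiable has_field_derivative_iff by blast
      then have "\<forall>\<^sub>F y in at x. dist ((f y - f x) / (y - x)) (deriv f x) < \<epsilon>"
        using \<open>\<epsilon> > 0\<close> by (rule tendstoD)
      then obtain d' where d': "d' > 0" "\<And>y. y \<noteq> x \<Longrightarrow> dist y x < d' \<Longrightarrow> dist ((f y - f x) / (y - x)) (deriv f x) < \<epsilon>"
        unfolding eventually_at by auto
      define y where "y = x + min d d' / 2"
      have y: "x < y" "y - x < d" "y - x < d'" using \<open>d > 0\<close> \<open>d' > 0\<close> by (auto simp: y_def min_def)
      then have "\<bar>(f y - f x) / (y - x)\<bar> \<le> K + \<epsilon>"
        using d'(2)[of y] \<open>\<bar>deriv f x\<bar> \<le> K\<close> by (auto simp: dist_real_def)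
      then have "\<bar>f y - f x\<bar> \<le> (K + \<epsilon>) * (y - x)"
        using y by (simp add: abs_divide divide_le_eq)
      then show ?thesis using y by (intro bexI[of _ "(x, y)"]) (auto simp: L_def)
    qed
    have SU: "S \<subseteq> {a<..<b}" by (auto simp: S_def)
    obtain D where D: "finite D" "D \<subseteq> L" "\<forall>I\<in>D. cint I \<subseteq> {a<..<b}"
       "separated D"
       "measure lebesgue S - \<delta> < (\<Sum>I\<in>D. measure lebesgue (S \<inter> cint I))"
      using finite_Vitali_cover[OF S open_greaterThanLessThan SU lenL fine \<open>\<delta> > 0\<close>] by blast
    have DI: "a \<le> fst J \<and> fst J < snd J \<and> snd J \<le> b" if "J \<in> D" for J
    proof -
      have "fst J < snd J" using D(2) that lenL by blast
      then have "fst J \<in> cint J" "snd J \<in> cint J" by auto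
      then have "fst J \<in> {a<..<b}" "snd J \<in> {a<..<b}" using D(3) that by blast+
      then show ?thesis using \<open>fst J < snd J\<close> by auto
    qed
    have "(\<Sum>J\<in>D. measure lebesgue (S \<inter> cint J)) \<le> (\<Sum>J\<in>D. snd J - fst J)"
      using DI by (intro sum_mono measure_Int_cint_le less_imp_le) auto
    then have lenD: "b - a - \<delta> < (\<Sum>J\<in>D. snd J - fst J)" using D(5) mS by linarith
    have "(\<Sum>I\<in>D. snd I - fst I) \<le> measure lebesgue {a<..<b}"
      by (rule sum_cint_le_measure[OF D(1,4)]) (use D(3) DI in \<open>auto intro: less_imp_le\<close>)
    then have lenD': "(\<Sum>I\<in>D. snd I - fst I) \<le> b - a" using \<open>a < b\<close> by simp
    have "\<exists>G. finite G \<and> (\<forall>J\<in>G. a \<le> fst J \<and> fst J \<le> snd J \<and> snd J \<le> b) \<and>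
        nonoverlapping G \<and>
        (\<forall>f::real\<Rightarrow>real. f b - f a = incr f D + incr f G)"
      by (rule interval_gaps[OF D(1) less_imp_le[OF \<open>a < b\<close>] _ D(4)]) (rule DI)
    then obtain G where G: "finite G" "\<forall>J\<in>G. a \<le> fst J \<and> fst J \<le> snd J \<and> snd J \<le> b"
        "nonoverlapping G"
        and G4: "\<And>f::real\<Rightarrow>real. f b - f a = incr f D + incr f G"
      by (elim exE conjE) (rule that, assumption+, erule spec)
    have "(\<Sum>I\<in>G. snd I - fst I) < \<delta>"
      using G4[of "\<lambda>x. x"] lenD by simp
    then have 1: "\<bar>incr f G\<bar> < \<epsilon>"
      using \<delta> G by blast
    have "\<bar>incr f D\<bar> \<le> (\<Sum>I\<in>D. (K + \<epsilon>) * (snd I - fst I))"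
      by (rule order_trans[OF sum_abs sum_mono]) (use D(2) in \<open>auto simp: L_def\<close>)
    also have "\<dots> = (K + \<epsilon>) * (\<Sum>I\<in>D. snd I - fst I)"
      by (simp add: sum_distrib_left)
    also have "\<dots> \<le> (K + \<epsilon>) * (b - a)"
      using lenD' K \<open>\<epsilon> > 0\<close> by (intro mult_left_mono) auto
    finally show ?thesis using 1 G4[of f] by linarith
  qed
  show ?thesis
  proof (rule field_le_epsilon)
    fix e :: real assume "e > 0"
    define \<epsilon> where "\<epsilon> = e / (b - a + 1)"
    have "\<epsilon> > 0" using \<open>e > 0\<close> \<open>a < b\<close> by (simp add: \<epsilon>_def)
    moreover have "(K + \<epsilon>) * (b - a) + \<epsilon> = K * (b - a) + e"
    proof -
      have "\<epsilon> * (b - a + 1) = e" using \<open>a < b\<close> by (simp add: \<epsilon>_def)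
      then show ?thesis by (simp add: algebra_simps)
    qed
    ultimately show "\<bar>f b - f a\<bar> \<le> K * (b - a) + e" using main[of \<epsilon>] by simp
  qed
qed

lemma locally_abs_continuous_lipschitz:
  assumes "\<And>x y. \<bar>f x - f y\<bar> \<le> K * \<bar>x - y\<bar>"
  shows "locally_abs_continuous f"
  unfolding locally_abs_continuous_def abs_continuous_on_interval_def
proof (intro allI impI)
  fix a b \<epsilon> :: real assume "\<epsilon> > 0"
  have "K \<ge> 0" using assms[of 1 0] by simp
  show "\<exists>\<delta>>0. \<forall>I. finite I \<and> (\<forall>(u, v)\<in>I. a \<le> u \<and> u \<le> v \<and> v \<le> b)
        \<and> disjoint_family_on (\<lambda>(u, v). {u<..<v}) I \<and> (\<Sum>(u, v)\<in>I. v - u) < \<delta>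
        \<longrightarrow> (\<Sum>(u, v)\<in>I. \<bar>f v - f u\<bar>) < \<epsilon>"
  proof (intro exI[of _ "\<epsilon> / (K + 1)"] conjI allI impI; (elim conjE)?)
    fix I :: "(real \<times> real) set"
    assume I: "finite I" "\<forall>(u, v)\<in>I. a \<le> u \<and> u \<le> v \<and> v \<le> b" "(\<Sum>(u, v)\<in>I. v - u) < \<epsilon> / (K + 1)"
    have "(\<Sum>(u, v)\<in>I. \<bar>f v - f u\<bar>) \<le> (\<Sum>(u, v)\<in>I. (K + 1) * (v - u))"
    proof (rule sum_mono, clarify)
      fix u v assume "(u, v) \<in> I"
      then have "u \<le> v" using I by auto
      then have "\<bar>f v - f u\<bar> \<le> K * (v - u)" using assms[of v u] by simp
      then show "\<bar>f v - f u\<bar> \<le> (K + 1) * (v - u)" using \<open>u \<le> v\<close> by (simp add: algebra_simps)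
    qed
    also have "\<dots> = (K + 1) * (\<Sum>(u, v)\<in>I. v - u)" by (simp add: case_prod_unfold sum_distrib_left)
    also have "\<dots> < \<epsilon>" using I(3) \<open>K \<ge> 0\<close> by (simp add: field_simps)
    finally show "(\<Sum>(u, v)\<in>I. \<bar>f v - f u\<bar>) < \<epsilon>" .
  qed (use \<open>\<epsilon> > 0\<close> \<open>K \<ge> 0\<close> in simp)
qed

text \<open>Where f has no derivative the value of \<open>deriv\<close> is unspecified, so it is the
  limit of difference quotients only almost everywhere; completeness of the measure makes that
  enough. Measurability matters because \<open>esssup\<close> of a nonmeasurable function is
  infinite.\<close>

lemma borel_measurable_deriv:
  fixes f :: "real \<Rightarrow> real"
  assumes "locally_abs_continuous f"
  shows "deriv f \<in> borel_measurable lebesgue"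
proof -
  define g where "g = (\<lambda>n::nat. \<lambda>x. (f (x + 1 / Suc n) - f x) / (1 / Suc n))"
  have cont: "continuous_on UNIV f" using locally_abs_continuous_imp_continuous[OF assms] .
  have "g n \<in> borel_measurable borel" for n
  proof -
    have "continuous_on UNIV (\<lambda>x. f (x + 1 / Suc n))"
      by (rule continuous_on_compose2[OF cont]) (auto intro!: continuous_intros)
    then show ?thesis
      unfolding g_def using cont by (intro borel_measurable_continuous_onI continuous_intros) auto
  qed
  then have "(\<lambda>x. lim (\<lambda>n. g n x)) \<in> borel_measurable lborel" by simp
  then have m: "(\<lambda>x. lim (\<lambda>n. g n x)) \<in> borel_measurable lebesgue"
    by (rule measurable_completion)
  have "deriv f x = lim (\<lambda>n. g n x)" if "f differentiable (at x)" for x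
  proof -
    have "DERIV f x :> deriv f x" using that DERIV_deriv_iff_real_differentiable by blast
    then have lim: "((\<lambda>h. (f (x + h) - f x) / h) \<longlongrightarrow> deriv f x) (at 0)" by (simp add: DERIV_def)
    have "filterlim (\<lambda>n. 1 / real (Suc n)) (at 0) sequentially"
      unfolding filterlim_at using LIMSEQ_Suc[OF lim_1_over_n] by (auto simp: field_simps)
    from filterlim_compose[OF lim this] show ?thesis
      unfolding g_def by (simp add: limI)
  qed
  then have sub: "{x. deriv f x \<noteq> lim (\<lambda>n. g n x)} \<subseteq> {x. \<not> f differentiable (at x)}" by auto
  have neg: "negligible {x. deriv f x \<noteq> lim (\<lambda>n. g n x)}"
    by (rule negligible_subset[OF negligible_not_differentiable[OF assms] sub])
  show ?thesis
  proof (rule measurableI)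
    fix A :: "real set" assume "A \<in> sets borel"
    then have A: "(\<lambda>x. lim (\<lambda>n. g n x)) -` A \<inter> space lebesgue \<in> sets lebesgue"
      by (rule measurable_sets[OF m])
    have "AE x in lebesgue. deriv f x = lim (\<lambda>n. g n x)"
      using neg by (simp add: AE_lebesgue_iff_negligible)
    then have ae: "AE x in lebesgue. x \<in> (\<lambda>x. lim (\<lambda>n. g n x)) -` A \<inter> space lebesgue \<longleftrightarrow> x \<in> deriv f -` A \<inter> space lebesgue"
      by eventually_elim simp
    show "deriv f -` A \<inter> space lebesgue \<in> sets lebesgue"
      by (rule completion.in_sets_AE[OF ae A]) auto
  qed auto
qed

text \<open>The working substitute, free of measure theory, for membership in \<open>L_space\<close>
  with seminorm at most K; \<open>smooth_lipschitz_iff\<close> is the bridge.\<close>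

definition smooth_lipschitz :: "nat \<Rightarrow> real \<Rightarrow> (real \<Rightarrow> real) \<Rightarrow> bool" where
  "smooth_lipschitz m K F \<longleftrightarrow>
     (\<forall>k<m - 1. \<forall>x. ((deriv ^^ k) F has_real_derivative (deriv ^^ Suc k) F x) (at x)) \<and>
     (\<forall>x y. \<bar>(deriv ^^ (m - 1)) F x - (deriv ^^ (m - 1)) F y\<bar> \<le> K * \<bar>x - y\<bar>)"

text \<open>Lebesgue measure is not zero, so the almost everywhere bound by the essential supremum
  holds at some point.\<close>

lemma L_seminorm_nonneg: "0 \<le> L_seminorm m F"
proof -
  have "AE x in lebesgue. ereal \<bar>(deriv ^^ m) F x\<bar> \<le> L_seminorm m F"
    unfolding L_seminorm_def by (rule esssup_AE)
  moreover have "\<not> (AE x::real in lebesgue. False)"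
    by (simp add: ae_filter_eq_bot_iff[symmetric] trivial_limit_def[symmetric])
       (simp add: ae_filter_eq_bot_iff)
  ultimately obtain x where "ereal \<bar>(deriv ^^ m) F x\<bar> \<le> L_seminorm m F"
    by (metis (mono_tags, lifting) eventually_mono)
  then show ?thesis by (rule order_trans[rotated]) simp
qed

text \<open>A Lipschitz function is differentiable almost everywhere, with derivative bounded by its
  constant; conversely an almost everywhere bound on the derivative controls increments because of
  absolute continuity.\<close>

lemma smooth_lipschitz_iff:
  assumes "1 \<le> m" "0 \<le> K"
  shows "smooth_lipschitz m K F \<longleftrightarrow> F \<in> L_space m \<and> L_seminorm m F \<le> ereal K"
proof -
  let ?v = "(deriv ^^ (m - 1)) F"
  have dm: "(deriv ^^ m) F = deriv ?v"
    using assms(1) by (cases m) auto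
  have dk: "(\<forall>k<m - 1. \<forall>x. ((deriv ^^ k) F has_real_derivative (deriv ^^ Suc k) F x) (at x))
     \<longleftrightarrow> (\<forall>k<m - 1. \<forall>x. (deriv ^^ k) F differentiable (at x))"
    by (simp add: DERIV_deriv_iff_real_differentiable)
  show ?thesis
  proof
    assume F: "smooth_lipschitz m K F"
    then have lip: "\<bar>?v x - ?v y\<bar> \<le> K * \<bar>x - y\<bar>" for x y by (simp add: smooth_lipschitz_def)
    then have ac: "locally_abs_continuous ?v" by (rule locally_abs_continuous_lipschitz)
    have bd: "\<bar>deriv ?v x\<bar> \<le> K" if "?v differentiable (at x)" for x
    proof -
      have "DERIV ?v x :> deriv ?v x" using that DERIV_deriv_iff_real_differentiable by blast
      then have lim: "((\<lambda>y. (?v y - ?v x) / (y - x)) \<longlongrightarrow> deriv ?v x) (at x)"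
        by (simp add: has_field_derivative_iff)
      have "\<bar>(?v y - ?v x) / (y - x)\<bar> \<le> K" if "y \<noteq> x" for y
        using lip[of y x] that by (simp add: abs_divide divide_le_eq)
      then have "\<forall>\<^sub>F y in at x. norm ((?v y - ?v x) / (y - x)) \<le> K"
        unfolding eventually_at by (intro exI[of _ 1]) (simp del: abs_divide)
      then show ?thesis
        using tendsto_upperbound[OF tendsto_norm[OF lim]] by (simp add: trivial_limit_at)
    qed
    have "AE x in lebesgue. ereal \<bar>deriv ?v x\<bar> \<le> ereal K"
    proof -
      have "{x. \<not> \<bar>deriv ?v x\<bar> \<le> K} \<subseteq> {x. \<not> ?v differentiable (at x)}" using bd by auto
      then have "negligible {x. \<not> \<bar>deriv ?v x\<bar> \<le> K}"
        by (rule negligible_subset[OF negligible_not_differentiable[OF ac]])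
      then show ?thesis
        by (simp add: AE_lebesgue_iff_negligible)
    qed
    then have "L_seminorm m F \<le> ereal K"
      unfolding L_seminorm_def dm using borel_measurable_deriv[OF ac] by (intro esssup_I) auto
    moreover have "L_seminorm m F < \<infinity>"
      by (rule le_less_trans[OF \<open>L_seminorm m F \<le> ereal K\<close>]) simp
    ultimately show "F \<in> L_space m \<and> L_seminorm m F \<le> ereal K"
      using F ac dk by (simp add: L_space_def smooth_lipschitz_def)
  next
    assume F: "F \<in> L_space m \<and> L_seminorm m F \<le> ereal K"
    then have ac: "locally_abs_continuous ?v" by (simp add: L_space_def)
    have "AE x in lebesgue. ereal \<bar>(deriv ^^ m) F x\<bar> \<le> L_seminorm m F"
      unfolding L_seminorm_def by (rule esssup_AE)
    then have "AE x in lebesgue. \<bar>deriv ?v x\<bar> \<le> K"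
    proof eventually_elim
      fix x assume "ereal \<bar>(deriv ^^ m) F x\<bar> \<le> L_seminorm m F"
      then have "ereal \<bar>deriv ?v x\<bar> \<le> ereal K"
        using F order_trans unfolding dm by blast
      then show "\<bar>deriv ?v x\<bar> \<le> K" by simp
    qed
    note inc = AE_deriv_bound_imp_increment_le[OF ac assms(2) this]
    have "\<bar>?v x - ?v y\<bar> \<le> K * \<bar>x - y\<bar>" for x y
    proof (cases x y rule: linorder_cases)
      case less
      then show ?thesis using inc[OF less] by (simp add: abs_minus_commute)
    next
      case greater
      then show ?thesis using inc[OF greater] by simp
    qed simp
    then show "smooth_lipschitz m K F" using F dk by (simp add: smooth_lipschitz_def L_space_def)
  qed
qed

section \<open>Divided differences\<close>

definition lagrange_poly :: "real set \<Rightarrow> (real \<Rightarrow> real) \<Rightarrow> real poly" where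
  "lagrange_poly S f = (\<Sum>s\<in>S. smult (f s / (\<Prod>t\<in>S - {s}. s - t)) (\<Prod>t\<in>S - {s}. [:- t, 1:]))"

text \<open>The symmetric formula instead of the recursion, so that it applies to an unordered set;
  by \<open>coeff_lagrange_poly\<close> it is the top coefficient of the interpolation
  polynomial.\<close>

definition divided_difference :: "real set \<Rightarrow> (real \<Rightarrow> real) \<Rightarrow> real" where
  "divided_difference S f = (\<Sum>s\<in>S. f s / (\<Prod>t\<in>S - {s}. s - t))"

lemma degree_prod_linear:
  "finite A \<Longrightarrow> degree (\<Prod>t\<in>A. [:- t, 1::real:]) = card A"
  by (simp add: degree_prod_eq_sum_degree)

lemma lead_coeff_prod_linear:
  assumes "finite A"
  shows "coeff (\<Prod>t\<in>A. [:- t, 1::real:]) (card A) = 1"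
  using lead_coeff_prod[of "\<lambda>t. [:- t, 1::real:]" A] degree_prod_linear[OF assms] by simp

lemma poly_lagrange_poly:
  assumes "finite S" "x \<in> S"
  shows "poly (lagrange_poly S f) x = f x"
proof -
  have "poly (lagrange_poly S f) x = (\<Sum>s\<in>S. f s / (\<Prod>t\<in>S - {s}. s - t) * (\<Prod>t\<in>S - {s}. x - t))"
    by (simp add: lagrange_poly_def poly_sum poly_prod)
  also have "\<dots> = (\<Sum>s\<in>S. if s = x then f x else 0)"
  proof (rule sum.cong[OF refl])
    fix s assume "s \<in> S"
    have "(\<Prod>t\<in>S - {x}. x - t) \<noteq> 0" using assms by (simp add: prod_zero_iff)
    moreover have "(\<Prod>t\<in>S - {s}. x - t) = 0" if "s \<noteq> x"
      using assms that by (intro prod_zero) auto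
    ultimately show "f s / (\<Prod>t\<in>S - {s}. s - t) * (\<Prod>t\<in>S - {s}. x - t) = (if s = x then f x else 0)"
      by auto
  qed
  finally show ?thesis using assms by simp
qed

lemma degree_lagrange_poly:
  assumes "finite S"
  shows "degree (lagrange_poly S f) \<le> card S - 1"
  unfolding lagrange_poly_def
proof (rule degree_sum_le[OF assms])
  fix s assume "s \<in> S"
  then show "degree (smult (f s / (\<Prod>t\<in>S - {s}. s - t)) (\<Prod>t\<in>S - {s}. [:- t, 1:])) \<le> card S - 1"
    using assms by (intro order_trans[OF degree_smult_le]) (simp add: degree_prod_linear)
qed

lemma coeff_lagrange_poly:
  assumes "finite S"
  shows "coeff (lagrange_poly S f) (card S - 1) = divided_difference S f"
  unfolding lagrange_poly_def divided_difference_def coeff_sum coeff_smult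
proof (rule sum.cong[OF refl])
  fix s assume "s \<in> S"
  then show "f s / (\<Prod>t\<in>S - {s}. s - t) * coeff (\<Prod>t\<in>S - {s}. [:- t, 1:]) (card S - 1) = f s / (\<Prod>t\<in>S - {s}. s - t)"
    using assms lead_coeff_prod_linear[of "S - {s}"] by simp
qed

lemma poly_eq_0_if_many_roots:
  fixes p :: "real poly"
  assumes "finite S" "\<And>x. x \<in> S \<Longrightarrow> poly p x = 0" "degree p < card S"
  shows "p = 0"
proof (rule ccontr)
  assume "p \<noteq> 0"
  then have "card S \<le> card {x. poly p x = 0}"
    using assms(2) by (intro card_mono poly_roots_finite) auto
  also have "\<dots> \<le> degree p" using \<open>p \<noteq> 0\<close> by (rule card_poly_roots_bound)
  finally show False using assms(3) by simp
qed

lemma higher_deriv_poly: "(deriv ^^ k) (poly p) = poly ((pderiv ^^ k) (p::real poly))"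
proof (induction k)
  case (Suc k)
  have "deriv (poly q) = poly (pderiv q)" for q :: "real poly"
    by (rule ext) (rule DERIV_imp_deriv, rule poly_DERIV)
  then show ?case using Suc by simp
qed simp

lemma poly_higher_pderiv_linear:
  fixes p :: "real poly"
  assumes "1 \<le> m" "degree p \<le> m"
  shows "poly ((pderiv ^^ (m - 1)) p) x - poly ((pderiv ^^ (m - 1)) p) y = fact m * coeff p m * (x - y)"
proof -
  let ?q = "(pderiv ^^ (m - 1)) p"
  have "degree ?q \<le> 1" using assms by (simp add: degree_higher_pderiv)
  then have q: "?q = [:coeff ?q 0, coeff ?q 1:]"
    by (intro poly_eqI) (auto simp: coeff_pCons coeff_eq_0 split: nat.splits)
  \<comment> \<open>After m - 1 derivatives the coefficient of degree m has picked up the factors 2,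
    ..., m, which \<open>coeff_higher_pderiv\<close> delivers as a Pochhammer symbol.\<close>
  have "pochhammer 2 n = (fact (Suc n) :: real)" for n
    using pochhammer_rec[of "1::real" n] by (simp only: pochhammer_fact) simp
  then have "coeff ?q 1 = fact m * coeff p m"
    using assms(1) by (cases m) (simp_all add: coeff_higher_pderiv)
  then show ?thesis
    by (subst (1 2) q) (simp add: algebra_simps)
qed

lemma smooth_lipschitz_poly:
  assumes "1 \<le> m" "degree p \<le> m"
  shows "smooth_lipschitz m (fact m * \<bar>coeff p m\<bar>) (poly p)"
  unfolding smooth_lipschitz_def
proof (intro conjI allI impI)
  fix k x
  show "((deriv ^^ k) (poly p) has_real_derivative (deriv ^^ Suc k) (poly p) x) (at x)"
    unfolding higher_deriv_poly by (simp add: poly_DERIV)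
next
  fix x y
  have "poly ((pderiv ^^ (m - 1)) p) x - poly ((pderiv ^^ (m - 1)) p) y = fact m * coeff p m * (x - y)"
    by (rule poly_higher_pderiv_linear[OF assms])
  then show "\<bar>(deriv ^^ (m - 1)) (poly p) x - (deriv ^^ (m - 1)) (poly p) y\<bar> \<le> fact m * \<bar>coeff p m\<bar> * \<bar>x - y\<bar>"
    by (simp add: higher_deriv_poly abs_mult)
qed

text \<open>Rolle's theorem between the two largest zeros a < b gives a zero of f' above a, while
  those obtained from the remaining zeros lie in \<open>{lo..a}\<close>; confinement to an interval
  is what shows the new zero to be different.\<close>

lemma Rolle_zeros:
  fixes f f' :: "real \<Rightarrow> real"
  assumes d: "\<And>x. (f has_real_derivative f' x) (at x)"
  shows "finite Z \<Longrightarrow> card Z = Suc n \<Longrightarrow> Z \<subseteq> {lo..hi} \<Longrightarrow> (\<And>z. z \<in> Z \<Longrightarrow> f z = 0) \<Longrightarrow>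
    \<exists>Z'. finite Z' \<and> card Z' = n \<and> Z' \<subseteq> {lo..hi} \<and> (\<forall>z\<in>Z'. f' z = 0)"
proof (induction n arbitrary: Z hi)
  case 0
  show ?case by (intro exI[of _ "{}"]) auto
next
  case (Suc n)
  have "Z \<noteq> {}" using Suc.prems by auto
  define b where "b = Max Z"
  define Y where "Y = Z - {b}"
  have b: "b \<in> Z" "\<And>z. z \<in> Z \<Longrightarrow> z \<le> b" using Suc.prems \<open>Z \<noteq> {}\<close> by (auto simp: b_def)
  have Y: "finite Y" "card Y = Suc n"
    using Suc.prems b by (auto simp: Y_def card_Diff_singleton)
  then have "Y \<noteq> {}" by auto
  define a where "a = Max Y"
  have a: "a \<in> Y" "\<And>z. z \<in> Y \<Longrightarrow> z \<le> a" using Y \<open>Y \<noteq> {}\<close> by (auto simp: a_def)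
  have "a < b" using a(1) b(2)[of a] by (auto simp: Y_def)
  obtain Z' where Z': "finite Z'" "card Z' = n" "Z' \<subseteq> {lo..a}" "\<forall>z\<in>Z'. f' z = 0"
    using Suc.IH[OF Y(1,2), of a] a Suc.prems(3,4) by (force simp: Y_def)
  have "\<exists>z. a < z \<and> z < b \<and> f' z = 0"
  proof -
    have "f a = f b" using a b Suc.prems(4) by (auto simp: Y_def)
    moreover have "continuous_on {a..b} f"
      using d by (meson DERIV_continuous_on has_field_derivative_at_within)
    ultimately obtain z where "a < z" "z < b" "DERIV f z :> 0"
      using Rolle[OF \<open>a < b\<close>] d real_differentiable_def by blast
    then show ?thesis using DERIV_unique d by blast
  qed
  then obtain z where z: "a < z" "z < b" "f' z = 0" by blast
  have "z \<notin> Z'" using z Z'(3) by auto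
  moreover have "lo \<le> a" "b \<le> hi" using a b Suc.prems(3) by (auto simp: Y_def)
  ultimately show ?case using Z' z
    by (intro exI[of _ "insert z Z'"]) (auto intro: order_trans less_imp_le)
qed

lemma iterated_Rolle_zeros:
  fixes g :: "nat \<Rightarrow> real \<Rightarrow> real"
  assumes "finite Z" "card Z = n + k" "Z \<subseteq> {lo..hi}" "\<And>z. z \<in> Z \<Longrightarrow> g 0 z = 0"
    and "\<And>j x. j < k \<Longrightarrow> (g j has_real_derivative g (Suc j) x) (at x)"
  shows "\<exists>Z'. finite Z' \<and> card Z' = n \<and> Z' \<subseteq> {lo..hi} \<and> (\<forall>z\<in>Z'. g k z = 0)"
  using assms(2,5)
proof (induction k arbitrary: n)
  case 0
  then show ?case using assms by (intro exI[of _ Z]) auto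
next
  case (Suc k)
  obtain Z' where "finite Z'" "card Z' = Suc n" "Z' \<subseteq> {lo..hi}" "\<forall>z\<in>Z'. g k z = 0"
    using Suc.IH[of "Suc n"] Suc.prems by auto
  then show ?case
    using Rolle_zeros[of "g k" "g (Suc k)" Z' n lo hi] Suc.prems(2)[of k] by auto
qed

text \<open>F minus its interpolation polynomial has m + 1 zeros, so m - 1 applications of Rolle
  leave two points where the derivatives of order m - 1 agree. That of the polynomial is affine with
  slope m! times the divided difference, so its increment between these points meets the Lipschitz
  bound for F.\<close>

lemma smooth_lipschitz_divided_difference_le:
  assumes m: "1 \<le> m" and F: "smooth_lipschitz m K F"
    and S: "finite S" "card S = m + 1" "\<And>x. x \<in> S \<Longrightarrow> F x = f x"
  shows "fact m * \<bar>divided_difference S f\<bar> \<le> K"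
proof -
  define p where "p = lagrange_poly S f"
  define q where "q = (pderiv ^^ (m - 1)) p"
  define g where "g = (\<lambda>k x. (deriv ^^ k) F x - poly ((pderiv ^^ k) p) x)"
  have p: "degree p \<le> m" "coeff p m = divided_difference S f"
    using degree_lagrange_poly[OF S(1)] coeff_lagrange_poly[OF S(1)] S(2) by (simp_all add: p_def)
  have "S \<noteq> {}" using S by auto
  have "\<exists>Z. finite Z \<and> card Z = 2 \<and> Z \<subseteq> {Min S..Max S} \<and> (\<forall>z\<in>Z. g (m - 1) z = 0)"
  proof (rule iterated_Rolle_zeros[OF S(1)])
    show "S \<subseteq> {Min S..Max S}" using S(1) by auto
    show "g 0 z = 0" if "z \<in> S" for z
      using S that by (simp add: g_def p_def poly_lagrange_poly)
    fix j x assume "j < m - 1"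
    then have "((deriv ^^ j) F has_real_derivative (deriv ^^ Suc j) F x) (at x)"
      using F by (simp add: smooth_lipschitz_def)
    then show "(g j has_real_derivative g (Suc j) x) (at x)"
      unfolding g_def by (auto intro!: derivative_eq_intros poly_DERIV)
  qed (use S m in simp)
  then obtain Z where Z: "card Z = 2" "\<forall>z\<in>Z. g (m - 1) z = 0" by blast
  then obtain u w where uw: "Z = {u, w}" "u \<noteq> w" by (meson card_2_iff)
  have "poly q u - poly q w = fact m * divided_difference S f * (u - w)"
    unfolding q_def p(2)[symmetric] by (rule poly_higher_pderiv_linear[OF m p(1)])
  moreover have "(deriv ^^ (m - 1)) F u = poly q u" "(deriv ^^ (m - 1)) F w = poly q w"
    using Z uw by (auto simp: g_def q_def)
  moreover have "\<bar>(deriv ^^ (m - 1)) F u - (deriv ^^ (m - 1)) F w\<bar> \<le> K * \<bar>u - w\<bar>"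
    using F by (simp add: smooth_lipschitz_def)
  ultimately have "fact m * \<bar>divided_difference S f\<bar> * \<bar>u - w\<bar> \<le> K * \<bar>u - w\<bar>"
    by (simp add: abs_mult)
  then show ?thesis using uw(2) by simp
qed

lemma le_trace_seminorm:
  assumes m: "1 \<le> m" and le: "\<And>K F. smooth_lipschitz m K F \<Longrightarrow> (\<And>x. x \<in> A \<Longrightarrow> F x = f x) \<Longrightarrow> c \<le> K"
  shows "ereal c \<le> trace_seminorm m A f"
  unfolding trace_seminorm_def
proof (rule Inf_greatest, clarify)
  fix F assume F: "F \<in> L_space m" "\<forall>x\<in>A. F x = f x"
  have "L_seminorm m F < \<infinity>" using F(1) by (simp add: L_space_def)
  then obtain K where K: "L_seminorm m F = ereal K" "0 \<le> K"
    using L_seminorm_nonneg[of m F] by (cases "L_seminorm m F") auto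
  then have "smooth_lipschitz m K F" using F smooth_lipschitz_iff[OF m K(2)] by simp
  then show "ereal c \<le> L_seminorm m F" using le F K by auto
qed

lemma trace_seminorm_le:
  assumes "1 \<le> m" "0 \<le> K" "smooth_lipschitz m K F" "\<And>x. x \<in> A \<Longrightarrow> F x = f x"
  shows "trace_seminorm m A f \<le> ereal K"
proof -
  have "F \<in> L_space m" "L_seminorm m F \<le> ereal K" using smooth_lipschitz_iff[OF assms(1,2)] assms(3) by auto
  then show ?thesis unfolding trace_seminorm_def using assms(4) by (intro Inf_lower2[of "L_seminorm m F"]) auto
qed

text \<open>The interpolation polynomial attains the lower bound that Rolle's theorem gives for
  every extension.\<close>

lemma trace_seminorm_card_Suc:
  assumes "1 \<le> m" "finite S" "card S = m + 1"
  shows "trace_seminorm m S f = ereal (fact m * \<bar>divided_difference S f\<bar>)"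
proof (rule antisym)
  show "ereal (fact m * \<bar>divided_difference S f\<bar>) \<le> trace_seminorm m S f"
    by (rule le_trace_seminorm[OF assms(1)]) (rule smooth_lipschitz_divided_difference_le[OF assms(1) _ assms(2,3)])
  have "smooth_lipschitz m (fact m * \<bar>divided_difference S f\<bar>) (poly (lagrange_poly S f))"
    using smooth_lipschitz_poly[OF assms(1), of "lagrange_poly S f"] degree_lagrange_poly[OF assms(2), of f]
      coeff_lagrange_poly[OF assms(2), of f] assms(3) by simp
  then show "trace_seminorm m S f \<le> ereal (fact m * \<bar>divided_difference S f\<bar>)"
    by (rule trace_seminorm_le[OF assms(1), rotated]) (simp_all add: poly_lagrange_poly assms(2))
qed

section \<open>Interpolation at finitely many points\<close>

lemma map_poly_of_real_mult:
  "map_poly complex_of_real (p * q) = map_poly of_real p * map_poly of_real q"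
  by (rule poly_eqI) (simp add: coeff_map_poly coeff_mult)

lemma map_poly_of_real_power:
  "map_poly complex_of_real (p ^ n) = map_poly of_real p ^ n"
  by (induction n) (simp_all add: map_poly_of_real_mult)

lemma map_poly_of_real_pderiv:
  "map_poly complex_of_real (pderiv p) = pderiv (map_poly of_real p)"
  by (rule poly_eqI) (simp add: coeff_map_poly coeff_pderiv)

lemma higher_deriv_poly_of_real:
  "(deriv ^^ r) (poly (map_poly complex_of_real p)) (of_real x) = of_real (poly ((pderiv ^^ r) p) x)"
proof -
  have "deriv (poly q) = poly (pderiv q)" for q :: "complex poly"
    by (rule ext) (rule DERIV_imp_deriv, rule poly_DERIV)
  then have "(deriv ^^ r) (poly (map_poly complex_of_real p)) = poly (map_poly of_real ((pderiv ^^ r) p))"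
    by (induction r) (simp_all add: map_poly_of_real_pderiv)
  moreover have "poly (map_poly complex_of_real q) (of_real x) = of_real (poly q x)" for q
    by (induction q) (simp_all add: map_poly_pCons)
  ultimately show ?thesis by simp
qed

text \<open>Cauchy's inequality on the circle of radius \<open>sqrt ((x - a) * (b - x))\<close> around \<open>x\<close>, on which
  \<open>(z - a) * (b - z)\<close> has modulus at most \<open>b - a\<close> times the radius (this is Schlaefli's bound for
  Legendre polynomials).\<close>

lemma higher_pderiv_interval_power_le:
  fixes a b x :: real
  assumes x: "a < x" "x < b" and "r \<le> n"
  shows "\<bar>poly ((pderiv ^^ r) (([:- a, 1:] * [:b, - 1:]) ^ n)) x\<bar>
    \<le> fact r * ((b - a) / 2) ^ (n - r) * (b - a) ^ n"
proof -
  define \<rho> where "\<rho> = sqrt ((x - a) * (b - x))"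
  define W where "W = map_poly complex_of_real ([:- a, 1:] * [:b, - 1:])"
  have \<rho>: "\<rho> > 0" "\<rho>\<^sup>2 = (x - a) * (b - x)" using x by (simp_all add: \<rho>_def)
  have W: "poly W z = (z - of_real a) * (of_real b - z)" for z
    by (simp add: W_def map_poly_of_real_mult map_poly_pCons) (simp add: algebra_simps)
  have circle: "norm (poly (W ^ n) z) \<le> (\<rho> * (b - a)) ^ n" if z: "norm (of_real x - z) = \<rho>" for z
  proof -
    define u v where "u = Re z - x" and "v = Im z"
    have uv: "u\<^sup>2 + v\<^sup>2 = (x - a) * (b - x)"
    proof -
      have "(norm (of_real x - z))\<^sup>2 = u\<^sup>2 + v\<^sup>2"
        by (simp add: cmod_power2 u_def v_def power2_commute)
      then show ?thesis using z \<rho> by simp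
    qed
    have "(norm (poly W z))\<^sup>2 = (norm (z - of_real a))\<^sup>2 * (norm (of_real b - z))\<^sup>2"
      by (simp add: W norm_mult power_mult_distrib)
    also have "\<dots> = ((x - a + u)\<^sup>2 + v\<^sup>2) * ((b - x - u)\<^sup>2 + v\<^sup>2)"
      by (simp add: cmod_power2 u_def v_def)
    also have "(x - a + u)\<^sup>2 + v\<^sup>2 = (x - a) * (b - a + 2 * u)"
      using uv by (simp add: power2_eq_square algebra_simps)
    also have "(b - x - u)\<^sup>2 + v\<^sup>2 = (b - x) * (b - a - 2 * u)"
      using uv by (simp add: power2_eq_square algebra_simps)
    also have "(x - a) * (b - a + 2 * u) * ((b - x) * (b - a - 2 * u)) = \<rho>\<^sup>2 * ((b - a)\<^sup>2 - 4 * u\<^sup>2)"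
      unfolding \<rho> by (simp add: power2_eq_square algebra_simps)
    also have "\<dots> \<le> \<rho>\<^sup>2 * (b - a)\<^sup>2"
      by (intro mult_left_mono) auto
    finally have "(norm (poly W z))\<^sup>2 \<le> (\<rho> * (b - a))\<^sup>2" by (simp add: power_mult_distrib)
    then have "norm (poly W z) \<le> \<rho> * (b - a)"
      by (rule power2_le_imp_le) (use \<rho> x in simp)
    then show ?thesis
      unfolding poly_power norm_power by (intro power_mono) auto
  qed
  have "norm ((deriv ^^ r) (poly (W ^ n)) (of_real x)) \<le> fact r * (\<rho> * (b - a)) ^ n / \<rho> ^ r"
    by (rule Cauchy_inequality[OF _ _ \<rho>(1) circle]) (auto intro!: holomorphic_intros continuous_intros)
  moreover have "(deriv ^^ r) (poly (W ^ n)) (of_real x)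
      = of_real (poly ((pderiv ^^ r) (([:- a, 1:] * [:b, - 1:]) ^ n)) x)"
    unfolding W_def map_poly_of_real_power[symmetric] by (rule higher_deriv_poly_of_real)
  ultimately have "\<bar>poly ((pderiv ^^ r) (([:- a, 1:] * [:b, - 1:]) ^ n)) x\<bar> \<le> fact r * (\<rho> * (b - a)) ^ n / \<rho> ^ r"
    by simp
  also have "\<dots> = fact r * \<rho> ^ (n - r) * (b - a) ^ n"
    using \<open>r \<le> n\<close> \<rho>(1) by (simp add: power_mult_distrib power_diff)
  \<comment> \<open>The arithmetic-geometric mean inequality bounds the radius, which occurs with
    exponent n - r, by half the length; the estimate no longer depends on x.\<close>
  also have "\<dots> \<le> fact r * ((b - a) / 2) ^ (n - r) * (b - a) ^ n"
  proof (intro mult_right_mono mult_left_mono power_mono)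
    have "\<rho> \<le> (x - a + (b - x)) / 2"
      unfolding \<rho>_def by (rule arith_geo_mean_sqrt) (use x in auto)
    then show "\<rho> \<le> (b - a) / 2" by simp
  qed (use x \<rho> in auto)
  finally show ?thesis .
qed

lemma pderiv_sum: "pderiv (sum f A) = (\<Sum>x\<in>A. pderiv (f x))"
  by (induction A rule: infinite_finite_induct) (simp_all add: pderiv_add)

lemma higher_pderiv_eq_0:
  fixes p :: "real poly"
  assumes "degree p < k"
  shows "(pderiv ^^ k) p = 0"
  by (rule poly_eqI) (use assms in \<open>simp add: coeff_higher_pderiv coeff_eq_0\<close>)

lemma higher_pderiv_mult:
  fixes p q :: "'a::{comm_semiring_1,semiring_no_zero_divisors} poly"
  shows "(pderiv ^^ n) (p * q) = (\<Sum>k\<le>n. smult (of_nat (n choose k)) ((pderiv ^^ (n - k)) p * (pderiv ^^ k) q))"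
proof (induction n)
  case (Suc n)
  let ?t = "\<lambda>i j. (pderiv ^^ i) p * (pderiv ^^ j) q"
  have "(pderiv ^^ Suc n) (p * q) = (\<Sum>k\<le>n. smult (of_nat (n choose k)) (?t (n - k) (Suc k) + ?t (Suc (n - k)) k))"
    by (simp add: Suc pderiv_sum pderiv_smult pderiv_mult mult.commute add.commute)
  also have "\<dots> = (\<Sum>k\<le>n. smult (of_nat (n choose k)) (?t (n - k) (Suc k)))
      + (\<Sum>k\<le>n. smult (of_nat (n choose k)) (?t (Suc n - k) k))"
    by (simp add: smult_add_right sum.distrib Suc_diff_le)
  also have "(\<Sum>k\<le>n. smult (of_nat (n choose k)) (?t (Suc n - k) k)) =
      (\<Sum>k\<le>Suc n. smult (of_nat (n choose k)) (?t (Suc n - k) k))"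
    by (simp add: binomial_eq_0)
  also have "\<dots> = ?t (Suc n) 0 + (\<Sum>k\<le>n. smult (of_nat (n choose Suc k)) (?t (n - k) (Suc k)))"
    unfolding sum.atMost_Suc_shift by simp
  also have "(\<Sum>k\<le>n. smult (of_nat (n choose k)) (?t (n - k) (Suc k))) +
      (?t (Suc n) 0 + (\<Sum>k\<le>n. smult (of_nat (n choose Suc k)) (?t (n - k) (Suc k))))
    = ?t (Suc n) 0 + (\<Sum>k\<le>n. smult (of_nat (Suc n choose Suc k)) (?t (n - k) (Suc k)))"
    by (simp add: sum.distrib[symmetric] smult_add_left[symmetric] add_ac)
  also have "\<dots> = (\<Sum>k\<le>Suc n. smult (of_nat (Suc n choose k)) (?t (Suc n - k) k))"
    unfolding sum.atMost_Suc_shift by simp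
  finally show ?case .
qed simp

text \<open>The derivative of order k sums over the ordered choices of k factors to be
  differentiated, and each remaining factor is at most b - a. The induction over the factors needs
  the Leibniz rule only for a linear factor, where two terms survive (\<open>lin\<close>).\<close>

lemma higher_pderiv_prod_linear_le:
  fixes a b x :: real
  assumes "finite A" "A \<subseteq> {a..b}" "x \<in> {a..b}"
  shows "\<bar>poly ((pderiv ^^ k) (\<Prod>t\<in>A. [:- t, 1:])) x\<bar> \<le> fact k * (card A choose k) * (b - a) ^ (card A - k)"
  using assms(1,2)
proof (induction A arbitrary: k rule: finite_induct)
  case empty
  show ?case by (cases k) (simp_all del: funpow.simps add: funpow_Suc_right pderiv_1)
next
  case (insert t A)
  let ?q = "\<Prod>t\<in>A. [:- t, 1:]" and ?n = "card A"
  have lin: "(pderiv ^^ Suc k) ([:- t, 1:] * q) = [:- t, 1:] * (pderiv ^^ Suc k) q + smult (of_nat (Suc k)) ((pderiv ^^ k) q)"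
    for k and q :: "real poly"
  proof (induction k)
    case 0
    show ?case unfolding funpow.simps comp_def id_def pderiv_mult by (simp add: pderiv_pCons)
  next
    case (Suc k)
    have "(pderiv ^^ Suc (Suc k)) ([:- t, 1:] * q) = pderiv ((pderiv ^^ Suc k) ([:- t, 1:] * q))" by simp
    also have "\<dots> = [:- t, 1:] * (pderiv ^^ Suc (Suc k)) q + (pderiv ^^ Suc k) q + smult (of_nat (Suc k)) ((pderiv ^^ Suc k) q)"
      unfolding Suc pderiv_add pderiv_mult pderiv_smult by (simp add: pderiv_pCons)
    finally show ?case
      by (subst of_nat_Suc[of "Suc k"]) (simp only: smult_add_left smult_1_left add_ac)
  qed
  have xt: "\<bar>x - t\<bar> \<le> b - a" "a \<le> b" using insert.prems assms(3) by auto
  have prod: "(\<Prod>t\<in>insert t A. [:- t, 1:]) = [:- t, 1:] * ?q" using insert.hyps by simp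
  show ?case
  proof (cases k)
    case 0
    have "\<bar>poly ?q x\<bar> \<le> (b - a) ^ ?n" using insert.IH[of 0] insert.prems by simp
    then have "\<bar>x - t\<bar> * \<bar>poly ?q x\<bar> \<le> (b - a) * (b - a) ^ ?n"
      using xt by (intro mult_mono) auto
    moreover have "poly ([:- t, 1:] * ?q) x = (x - t) * poly ?q x" by (simp add: algebra_simps)
    ultimately show ?thesis unfolding prod using 0 insert.hyps by (simp only: funpow_0 abs_mult) simp
  next
    case (Suc j)
    have IH: "\<bar>poly ((pderiv ^^ k) ?q) x\<bar> \<le> fact k * (?n choose k) * (b - a) ^ (?n - k)" for k
      using insert.IH[of k] insert.prems by simp
    have "\<bar>poly ((pderiv ^^ Suc j) ([:- t, 1:] * ?q)) x\<bar>
        = \<bar>(x - t) * poly ((pderiv ^^ Suc j) ?q) x + Suc j * poly ((pderiv ^^ j) ?q) x\<bar>"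
      unfolding lin by (simp add: algebra_simps)
    also have "\<dots> \<le> \<bar>x - t\<bar> * \<bar>poly ((pderiv ^^ Suc j) ?q) x\<bar> + Suc j * \<bar>poly ((pderiv ^^ j) ?q) x\<bar>"
      by (rule order_trans[OF abs_triangle_ineq]) (simp add: abs_mult)
    also have "\<dots> \<le> (b - a) * (fact (Suc j) * (?n choose Suc j) * (b - a) ^ (?n - Suc j))
        + Suc j * (fact j * (?n choose j) * (b - a) ^ (?n - j))"
      by (intro add_mono mult_mono IH xt) (use xt in auto)
    also have "(b - a) * (fact (Suc j) * (?n choose Suc j) * (b - a) ^ (?n - Suc j))
        = fact (Suc j) * (?n choose Suc j) * (b - a) ^ (?n - j)"
    proof (cases "Suc j \<le> ?n")
      case True
      then have "?n - j = Suc (?n - Suc j)" by simp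
      then show ?thesis by simp
    qed (simp add: binomial_eq_0)
    also have "fact (Suc j) * (?n choose Suc j) * (b - a) ^ (?n - j) + Suc j * (fact j * (?n choose j) * (b - a) ^ (?n - j))
      = fact (Suc j) * (Suc ?n choose Suc j) * (b - a) ^ (?n - j)"
      by (simp add: algebra_simps)
    finally show ?thesis unfolding prod using Suc insert.hyps by simp
  qed
qed

text \<open>The polynomial that switches from 0 to 1 across \<open>[a, b]\<close> with \<open>n\<close> vanishing derivatives at both
  ends, written as a tail of the binomial expansion of \<open>((x - a) + (b - x)) ^ (2 * n + 1)\<close>.\<close>

definition switch_poly :: "nat \<Rightarrow> real \<Rightarrow> real \<Rightarrow> real poly" where
  "switch_poly n a b = smult (1 / (b - a) ^ (2 * n + 1))
     (\<Sum>j\<in>{Suc n..2 * n + 1}. smult (of_nat ((2 * n + 1) choose j)) ([:- a, 1:] ^ j * [:b, - 1:] ^ (2 * n + 1 - j)))"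

text \<open>The first factor is 1 / B(n + 1, n + 1), B the beta function, which normalises the
  derivative of the switch; the sum collects the binomials of the Leibniz rule, each with the power
  of 1/2 from the Cauchy estimate.\<close>

definition switch_bound :: "nat \<Rightarrow> real" where
  "switch_bound n = real ((2 * n + 1) * (2 * n choose n)) * (\<Sum>k\<le>n. real (Suc n choose k) / 2 ^ k)"

lemma switch_poly_dvd: "[:- a, 1:] ^ Suc n dvd switch_poly n a b"
  unfolding switch_poly_def
  by (intro dvd_smult dvd_sum dvd_mult2 le_imp_power_dvd) auto

text \<open>The full binomial sum is (b - a)^(2 n + 1), so 1 minus the switch is the head j <= n of
  the expansion, whose terms contain b - x to a power of at least n + 1.\<close>

lemma switch_poly_complement_dvd:
  assumes "a < b"
  shows "[:- b, 1:] ^ Suc n dvd 1 - switch_poly n a b"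
proof -
  let ?N = "2 * n + 1"
  let ?T = "\<lambda>j. smult (of_nat (?N choose j)) ([:- a, 1:] ^ j * [:b, - 1:] ^ (?N - j))"
  have AB: "[:- a, 1:] + [:b, - 1:] = [:b - a:]" by simp
  have "(\<Sum>j\<le>?N. ?T j) = ([:- a, 1:] + [:b, - 1:]) ^ ?N"
    unfolding binomial_ring[of "[:- a, 1:]" "[:b, - 1:]"]
    by (intro sum.cong) (auto simp: of_nat_poly)
  also have "\<dots> = [:(b - a) ^ ?N:]" unfolding AB by (rule poly_const_pow)
  finally have "(\<Sum>j\<le>?N. ?T j) = [:(b - a) ^ ?N:]" .
  moreover have "{..?N} = {..n} \<union> {Suc n..?N}" by auto
  then have "(\<Sum>j\<le>?N. ?T j) = (\<Sum>j\<le>n. ?T j) + (\<Sum>j\<in>{Suc n..?N}. ?T j)"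
    by (simp only:) (rule sum.union_disjoint; auto)
  ultimately have "smult (1 / (b - a) ^ ?N) [:(b - a) ^ ?N:] = smult (1 / (b - a) ^ ?N) (\<Sum>j\<le>n. ?T j) + switch_poly n a b"
    unfolding switch_poly_def smult_add_right[symmetric] by simp
  then have eq: "1 - switch_poly n a b = smult (1 / (b - a) ^ ?N) (\<Sum>j\<le>n. ?T j)"
    using assms by (simp add: one_pCons algebra_simps)
  have "[:- b, 1:] ^ Suc n dvd ?T j" if "j \<le> n" for j
  proof -
    have B: "[:b, - 1:] = - [:- b, 1:]" by simp
    have pow: "[:- b, 1:] ^ k dvd [:b, - 1:] ^ k" for k
      unfolding B power_minus[of "[:- b, 1:]"] by (rule dvd_triv_right)
    have "[:- b, 1:] ^ Suc n dvd [:b, - 1:] ^ (?N - j)"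
      by (rule dvd_trans[OF pow le_imp_power_dvd]) (use that in linarith)
    then show ?thesis by (intro dvd_smult dvd_mult)
  qed
  then show ?thesis unfolding eq by (rule dvd_smult[OF dvd_sum]) (simp only: atMost_iff)
qed

text \<open>Absorption identities turn the derivative of each summand into a difference of
  neighbouring \<open>V j\<close>, and the sum telescopes to \<open>V n\<close>. Thus the switch is
  a regularised incomplete beta function.\<close>

lemma pderiv_switch_poly:
  "pderiv (switch_poly n a b) =
     smult (real ((2 * n + 1) * (2 * n choose n)) / (b - a) ^ (2 * n + 1)) (([:- a, 1:] * [:b, - 1:]) ^ n)"
proof -
  let ?N = "2 * n + 1" and ?A = "[:- a, 1:]" and ?B = "[:b, - 1:]"
  define V where "V = (\<lambda>j. smult (of_nat (?N * (2 * n choose j))) (?A ^ j * ?B ^ (2 * n - j)))"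
  have "pderiv ?A = 1" "pderiv ?B = - 1" by (simp_all add: pderiv_pCons one_pCons)
  then have dA: "pderiv (?A ^ j) = smult (of_nat j) (?A ^ (j - 1))"
    and dB: "pderiv (?B ^ j) = - smult (of_nat j) (?B ^ (j - 1))" for j
    by (simp_all only: pderiv_power mult_1_right mult_minus_right smult_minus_right)
  have "pderiv (smult (of_nat (?N choose j)) (?A ^ j * ?B ^ (?N - j))) = - (V j - V (j - 1))"
    if j: "j \<in> {Suc n..?N}" for j
  proof -
    have e1: "j * (?N choose j) = ?N * (2 * n choose (j - 1))"
      using times_binomial_minus1_eq[of j ?N] j by simp
    have e2: "(?N - j) * (?N choose j) = ?N * (2 * n choose j)"
      using binomial_absorb_comp[of ?N j] by simp
    have e3: "2 * n - (j - 1) = ?N - j" "2 * n - j = ?N - j - 1" using j by auto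
    have "pderiv (smult (of_nat (?N choose j)) (?A ^ j * ?B ^ (?N - j)))
       = smult (of_nat (j * (?N choose j))) (?A ^ (j - 1) * ?B ^ (?N - j))
         - smult (of_nat ((?N - j) * (?N choose j))) (?A ^ j * ?B ^ (?N - j - 1))"
      unfolding pderiv_smult pderiv_mult dA dB
      by (simp add: smult_add_right smult_diff_right mult.commute)
    also have "\<dots> = - (V j - V (j - 1))"
      unfolding V_def e1[symmetric] e2[symmetric] e3 by simp
    finally show ?thesis .
  qed
  then have "pderiv (\<Sum>j\<in>{Suc n..?N}. smult (of_nat (?N choose j)) (?A ^ j * ?B ^ (?N - j)))
      = - (\<Sum>j\<in>{Suc n..?N}. V j - V (j - 1))"
    unfolding pderiv_sum by (simp add: sum_negf[symmetric] del: sum_negf)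
  also have "\<dots> = - (V ?N - V n)"
    by (subst sum_telescope'') simp_all
  also have "V ?N = 0"
  proof -
    have "2 * n choose ?N = 0" by (simp add: binomial_eq_0)
    then show ?thesis unfolding V_def by (simp only: mult_0_right of_nat_0 smult_0_left)
  qed
  finally have "pderiv (\<Sum>j\<in>{Suc n..?N}. smult (of_nat (?N choose j)) (?A ^ j * ?B ^ (?N - j))) = V n"
    by (simp only: diff_0 minus_minus)
  moreover have "V n = smult (of_nat (?N * (2 * n choose n))) ((?A * ?B) ^ n)"
  proof -
    have "2 * n - n = n" by simp
    then show ?thesis unfolding V_def by (simp only: power_mult_distrib)
  qed
  ultimately show ?thesis
    unfolding switch_poly_def pderiv_smult by (simp only: smult_smult) simp
qed

text \<open>In the Leibniz sum the factorials combine as (n - k)! k! (n choose k) = n!, and the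
  lengths to L^(2 n) for every k; against L^(2 n + 1) in the normalisation one 1 / L remains, which
  the factor b - a cancels. The term k = n + 1 drops out because the product has degree n.\<close>

lemma switch_poly_product_bound:
  fixes a b x :: real
  assumes A: "finite A" "card A = n" "A \<subseteq> {a..b}" and x: "a < x" "x < b"
  shows "\<bar>poly ((pderiv ^^ Suc n) (switch_poly n a b * (\<Prod>t\<in>A. [:- t, 1:]))) x\<bar> * (b - a)
    \<le> fact n * switch_bound n"
proof -
  let ?q = "\<Prod>t\<in>A. [:- t, 1::real:]" and ?w = "([:- a, 1:] * [:b, - 1:]) ^ n"
  define L where "L = b - a"
  have L: "L > 0" using x by (simp add: L_def)
  define c where "c = real ((2 * n + 1) * (2 * n choose n)) / L ^ (2 * n + 1)"
  have c: "c \<ge> 0" using L by (simp add: c_def)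
  have q0: "(pderiv ^^ Suc n) ?q = 0"
    by (rule higher_pderiv_eq_0) (simp add: degree_prod_linear A)
  have dS: "(pderiv ^^ (Suc n - k)) (switch_poly n a b) = smult c ((pderiv ^^ (n - k)) ?w)" if "k \<le> n" for k
    using that by (simp add: Suc_diff_le funpow_Suc_right pderiv_switch_poly higher_pderiv_smult c_def L_def del: funpow.simps)
  have summand: "\<bar>real (Suc n choose k) * (poly ((pderiv ^^ (Suc n - k)) (switch_poly n a b)) x * poly ((pderiv ^^ k) ?q) x)\<bar>
     \<le> c * fact n * L ^ (2 * n) * (real (Suc n choose k) / 2 ^ k)" if "k \<le> n" for k
  proof -
    have "\<bar>poly ((pderiv ^^ (n - k)) ?w) x\<bar> \<le> fact (n - k) * (L / 2) ^ (n - (n - k)) * L ^ n"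
      unfolding L_def by (rule higher_pderiv_interval_power_le) (use x in auto)
    then have 1: "\<bar>poly ((pderiv ^^ (n - k)) ?w) x\<bar> \<le> fact (n - k) * (L / 2) ^ k * L ^ n"
      using that by simp
    have 2: "\<bar>poly ((pderiv ^^ k) ?q) x\<bar> \<le> fact k * (n choose k) * L ^ (n - k)"
      using higher_pderiv_prod_linear_le[OF A(1,3), of x k] x A(2) by (simp add: L_def)
    have "\<bar>real (Suc n choose k) * (poly ((pderiv ^^ (Suc n - k)) (switch_poly n a b)) x * poly ((pderiv ^^ k) ?q) x)\<bar>
      = real (Suc n choose k) * (c * (\<bar>poly ((pderiv ^^ (n - k)) ?w) x\<bar> * \<bar>poly ((pderiv ^^ k) ?q) x\<bar>))"
      using c by (simp add: dS[OF that] abs_mult)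
    also have "\<dots> \<le> real (Suc n choose k) * (c * ((fact (n - k) * (L / 2) ^ k * L ^ n) * (fact k * (n choose k) * L ^ (n - k))))"
      by (intro mult_left_mono mult_mono 1 2) (use c L in auto)
    also have "\<dots> = c * (fact k * fact (n - k) * (n choose k)) * (L ^ k * L ^ (n - k) * L ^ n) * (real (Suc n choose k) / 2 ^ k)"
      by (simp add: power_divide field_simps)
    also have "\<dots> = c * fact n * L ^ (2 * n) * (real (Suc n choose k) / 2 ^ k)"
    proof -
      have "real (fact k * fact (n - k) * (n choose k)) = fact n"
        using binomial_fact_lemma[OF that] by (metis of_nat_fact)
      moreover have "L ^ k * L ^ (n - k) * L ^ n = L ^ (2 * n)"
        using that by (simp add: power_add[symmetric] mult_2)
      ultimately show ?thesis by (simp only:)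
    qed
    finally show ?thesis .
  qed
  have "poly ((pderiv ^^ Suc n) (switch_poly n a b * ?q)) x
     = (\<Sum>k\<le>Suc n. real (Suc n choose k) * (poly ((pderiv ^^ (Suc n - k)) (switch_poly n a b)) x * poly ((pderiv ^^ k) ?q) x))"
    unfolding higher_pderiv_mult poly_sum by simp
  also have "\<dots> = (\<Sum>k\<le>n. real (Suc n choose k) * (poly ((pderiv ^^ (Suc n - k)) (switch_poly n a b)) x * poly ((pderiv ^^ k) ?q) x))"
    using q0 by simp
  finally have "\<bar>poly ((pderiv ^^ Suc n) (switch_poly n a b * ?q)) x\<bar>
     \<le> (\<Sum>k\<le>n. c * fact n * L ^ (2 * n) * (real (Suc n choose k) / 2 ^ k))"
    by (simp only:) (rule order_trans[OF sum_abs sum_mono], use summand in auto)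
  also have "\<dots> = c * fact n * L ^ (2 * n) * (\<Sum>k\<le>n. real (Suc n choose k) / 2 ^ k)"
    by (simp only: sum_distrib_left)
  finally have "\<bar>poly ((pderiv ^^ Suc n) (switch_poly n a b * ?q)) x\<bar> * L
      \<le> c * fact n * L ^ (2 * n) * (\<Sum>k\<le>n. real (Suc n choose k) / 2 ^ k) * L"
    using L by (intro mult_right_mono) auto
  also have "\<dots> = fact n * switch_bound n"
    using L by (simp add: c_def switch_bound_def field_simps)
  finally show ?thesis by (simp add: L_def)
qed

section \<open>Truncated polynomials and their smoothness\<close>

definition truncated_poly :: "real \<Rightarrow> real poly \<Rightarrow> real \<Rightarrow> real" where
  "truncated_poly a p x = (if a \<le> x then poly p x else 0)"

lemma linear_power_dvd_pderiv:
  fixes p :: "real poly"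
  assumes "[:- a, 1:] ^ Suc j dvd p"
  shows "[:- a, 1:] ^ j dvd pderiv p"
proof -
  obtain q where q: "p = [:- a, 1:] ^ Suc j * q" using assms by (rule dvdE)
  have "[:- a, 1:] ^ j dvd [:- a, 1:] ^ Suc j * pderiv q"
    by (intro dvd_mult2 le_imp_power_dvd) simp
  moreover have "[:- a, 1:] ^ j dvd q * pderiv ([:- a, 1:] ^ Suc j)"
    unfolding pderiv_power_Suc by (intro dvd_mult dvd_mult2 dvd_smult) simp
  ultimately show ?thesis unfolding q pderiv_mult by (rule dvd_add)
qed

lemma linear_power_dvd_higher_pderiv:
  fixes p :: "real poly"
  assumes "[:- a, 1:] ^ (j + k) dvd p"
  shows "[:- a, 1:] ^ j dvd (pderiv ^^ k) p"
  using assms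
proof (induction k arbitrary: j)
  case (Suc k)
  then have "[:- a, 1:] ^ Suc j dvd (pderiv ^^ k) p" by (intro Suc.IH) simp
  then show ?case using linear_power_dvd_pderiv by simp
qed simp

lemma poly_eq_0_if_dvd:
  assumes "[:- a, 1:] ^ Suc j dvd (p :: real poly)"
  shows "poly p a = 0"
  using assms by (auto elim!: dvdE)

lemma has_real_derivative_truncated_poly_off_knot:
  assumes "x \<noteq> a"
  shows "(truncated_poly a p has_real_derivative truncated_poly a (pderiv p) x) (at x)"
proof (cases "x < a")
  case True
  have "((\<lambda>x. 0) has_real_derivative 0) (at x)" by simp
  then have "(truncated_poly a p has_real_derivative 0) (at x)"
    by (rule has_field_derivative_transform_within_open[of _ _ _ "{..<a}"])
       (use True in \<open>auto simp: truncated_poly_def\<close>)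
  then show ?thesis using True by (simp add: truncated_poly_def)
next
  case False
  then have "a < x" using assms by simp
  have "(poly p has_real_derivative poly (pderiv p) x) (at x)" by (rule poly_DERIV)
  then have "(truncated_poly a p has_real_derivative poly (pderiv p) x) (at x)"
    by (rule has_field_derivative_transform_within_open[of _ _ _ "{a<..}"])
       (use \<open>a < x\<close> in \<open>auto simp: truncated_poly_def\<close>)
  then show ?thesis using \<open>a < x\<close> by (simp add: truncated_poly_def)
qed

text \<open>At the knot, a double zero makes the difference quotient of p tend to 0, and truncation
  only decreases its absolute value.\<close>

lemma has_real_derivative_truncated_poly:
  assumes "[:- a, 1:] ^ Suc (Suc j) dvd p"
  shows "(truncated_poly a p has_real_derivative truncated_poly a (pderiv p) x) (at x)"
proof (cases "x = a")
  case False
  then show ?thesis by (rule has_real_derivative_truncated_poly_off_knot)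
next
  case equal: True
  have p0: "poly p a = 0" by (rule poly_eq_0_if_dvd[OF assms])
  have d0: "poly (pderiv p) a = 0" by (rule poly_eq_0_if_dvd[OF linear_power_dvd_pderiv[OF assms]])
  have "(poly p has_real_derivative 0) (at a)" using poly_DERIV[of p a] d0 by simp
  then have lim: "((\<lambda>y. poly p y / (y - a)) \<longlongrightarrow> 0) (at a)"
    by (simp add: has_field_derivative_iff p0)
  have "((\<lambda>y. truncated_poly a p y / (y - a)) \<longlongrightarrow> 0) (at a)"
    by (rule Lim_null_comparison[OF _ tendsto_rabs_zero[OF lim]])
       (auto simp: truncated_poly_def intro!: always_eventually)
  then have "(truncated_poly a p has_real_derivative 0) (at a)"
    by (simp add: has_field_derivative_iff truncated_poly_def p0)
  then show ?thesis using equal d0 by (simp add: truncated_poly_def)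
qed

lemma continuous_on_truncated_poly:
  assumes "[:- a, 1:] ^ Suc j dvd p"
  shows "continuous_on UNIV (truncated_poly a p)"
proof -
  have "continuous_on ({a..} \<union> {..a}) (\<lambda>x. if a \<le> x then poly p x else 0)"
    by (rule continuous_on_If) (use poly_eq_0_if_dvd[OF assms] in \<open>auto intro!: continuous_intros\<close>)
  moreover have "{a..} \<union> {..a} = UNIV" by auto
  ultimately show ?thesis unfolding truncated_poly_def by simp
qed

text \<open>Meant for the derivative of order m - 1 of a spline, which has corners at the knots; the
  fundamental theorem of calculus tolerates finitely many.\<close>

lemma lipschitz_if_derivative_bound_off_finite:
  fixes v w :: "real \<Rightarrow> real"
  assumes "finite S" "continuous_on UNIV v" "0 \<le> K"
    and d: "\<And>x. x \<notin> S \<Longrightarrow> (v has_real_derivative w x) (at x)" and bd: "\<And>x. x \<notin> S \<Longrightarrow> \<bar>w x\<bar> \<le> K"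
  shows "\<bar>v x - v y\<bar> \<le> K * \<bar>x - y\<bar>"
proof -
  have main: "\<bar>v y - v x\<bar> \<le> K * (y - x)" if "x \<le> y" for x y
  proof -
    define w' where "w' = (\<lambda>x. if x \<in> S then 0 else w x)"
    have "(w' has_integral (v y - v x)) {x..y}"
      by (rule fundamental_theorem_of_calculus_interior_strong[OF \<open>finite S\<close> that])
         (use d assms(2) in \<open>auto simp: w'_def has_real_derivative_iff_has_vector_derivative intro: continuous_on_subset\<close>)
    then have "norm (v y - v x) \<le> K * measure lborel {x..y}"
      by (rule has_integral_bound_real[OF assms(3), rotated]) (use bd assms(3) in \<open>auto simp: w'_def\<close>)
    then show ?thesis using that by simp
  qed
  show ?thesis using main[of x y] main[of y x] by (cases "x \<le> y") (auto simp: abs_minus_commute)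
qed

lemma higher_deriv_chain:
  assumes "\<And>k x. k < n \<Longrightarrow> (G k has_real_derivative G (Suc k) x) (at x)" "k \<le> n"
  shows "(deriv ^^ k) (G 0) = G k"
  using assms(2)
proof (induction k)
  case (Suc k)
  have "deriv (G k) = G (Suc k)"
    by (rule ext) (rule DERIV_imp_deriv, rule assms(1), use Suc in simp)
  then show ?case using Suc by simp
qed simp

text \<open>A family in which each member is the derivative of the one before must consist of the
  iterates of \<open>deriv\<close>; constructions can thus exhibit their derivatives and never
  compute \<open>deriv ^^ k\<close>.\<close>

lemma smooth_lipschitz_chain:
  assumes "\<And>k x. k < m - 1 \<Longrightarrow> (G k has_real_derivative G (Suc k) x) (at x)"
    and "\<And>x y. \<bar>G (m - 1) x - G (m - 1) y\<bar> \<le> K * \<bar>x - y\<bar>"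
  shows "smooth_lipschitz m K (G 0)"
proof -
  have "(deriv ^^ k) (G 0) = G k" if "k \<le> m - 1" for k
    by (rule higher_deriv_chain[of "m - 1" G]) (use assms(1) that in auto)
  then show ?thesis using assms unfolding smooth_lipschitz_def by (auto simp del: funpow.simps)
qed

text \<open>A zero of order n + 1 at its knot keeps the derivatives of each piece up to order n
  continuous; only order n + 1 jumps, and its bound off the knots is a Lipschitz constant for order
  n.\<close>

lemma smooth_lipschitz_truncated_poly_sum:
  assumes "finite J" "0 \<le> K" and dvd: "\<And>j. j \<in> J \<Longrightarrow> [:- c j, 1:] ^ Suc n dvd r j"
    and bd: "\<And>x. x \<notin> c ` J \<Longrightarrow> \<bar>poly ((pderiv ^^ Suc n) P) x
       + (\<Sum>j\<in>J. truncated_poly (c j) ((pderiv ^^ Suc n) (r j)) x)\<bar> \<le> K"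
  shows "smooth_lipschitz (Suc n) K (\<lambda>x. poly P x + (\<Sum>j\<in>J. truncated_poly (c j) (r j) x))"
proof -
  define G where "G = (\<lambda>k x. poly ((pderiv ^^ k) P) x + (\<Sum>j\<in>J. truncated_poly (c j) ((pderiv ^^ k) (r j)) x))"
  have "smooth_lipschitz (Suc n) K (G 0)"
  proof (rule smooth_lipschitz_chain)
    fix k x assume "k < Suc n - 1"
    then have "[:- c j, 1:] ^ Suc (Suc (n - k - 1)) dvd (pderiv ^^ k) (r j)" if "j \<in> J" for j
      using dvd[OF that] by (intro linear_power_dvd_higher_pderiv) simp
    then show "(G k has_real_derivative G (Suc k) x) (at x)"
      unfolding G_def by (auto intro!: DERIV_add DERIV_sum poly_DERIV has_real_derivative_truncated_poly)
  next
    fix x y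
    show "\<bar>G (Suc n - 1) x - G (Suc n - 1) y\<bar> \<le> K * \<bar>x - y\<bar>"
    proof (rule lipschitz_if_derivative_bound_off_finite[of "c ` J" _ K "G (Suc n)"])
      have "[:- c j, 1:] ^ Suc 0 dvd (pderiv ^^ n) (r j)" if "j \<in> J" for j
        using dvd[OF that] by (intro linear_power_dvd_higher_pderiv) simp
      then show "continuous_on UNIV (G (Suc n - 1))"
        unfolding G_def by (auto simp del: power_Suc intro!: continuous_on_add continuous_on_sum continuous_on_poly continuous_on_truncated_poly[where j=0])
      show "(G (Suc n - 1) has_real_derivative G (Suc n) x) (at x)" if "x \<notin> c ` J" for x
        using that unfolding G_def
        by (auto intro!: DERIV_add DERIV_sum poly_DERIV has_real_derivative_truncated_poly_off_knot)
      show "\<bar>G (Suc n) x\<bar> \<le> K" if "x \<notin> c ` J" for x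
        using bd[OF that] by (simp only: G_def)
    qed (use assms in auto)
  qed
  then show ?thesis by (simp add: G_def)
qed

section \<open>Interpolation by overlapping switches\<close>

lemma degree_less_if_coeff_0:
  assumes "degree p \<le> Suc n" "coeff p (Suc n) = 0"
  shows "degree p < Suc n"
  using assms le_neq_implies_less leading_coeff_0_iff[of p] by (metis degree_0 zero_less_Suc)

text \<open>Newton's step: the interpolant Q on all nodes exceeds the one that has u but not the
  other endpoint by c (x - u) q, where c is the divided difference. Subtracting the cases u = a and
  u = b leaves c (b - a) q.\<close>

lemma lagrange_poly_diff:
  fixes a b :: real
  assumes A: "finite A" "a \<notin> A" "b \<notin> A" "a \<noteq> b"
  shows "lagrange_poly (insert b A) f - lagrange_poly (insert a A) f =
    smult (divided_difference (insert a (insert b A)) f * (b - a)) (\<Prod>t\<in>A. [:- t, 1:])"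
proof -
  let ?S = "insert a (insert b A)" and ?q = "\<Prod>t\<in>A. [:- t, 1::real:]"
  define c where "c = divided_difference ?S f"
  define Q where "Q = lagrange_poly ?S f"
  have cardS: "card ?S = Suc (Suc (card A))" using A by simp
  have Q: "degree Q \<le> Suc (card A)" "coeff Q (Suc (card A)) = c"
    using degree_lagrange_poly[of ?S f] coeff_lagrange_poly[of ?S f] A cardS by (simp_all add: Q_def c_def)
  have step: "Q - lagrange_poly (insert u A) f = smult c ([:- u, 1:] * ?q)" if u: "u \<notin> A" "u \<in> ?S" for u
  proof -
    define P where "P = lagrange_poly (insert u A) f"
    let ?D = "Q - P - smult c ([:- u, 1:] * ?q)"
    have cardu: "card (insert u A) = Suc (card A)" using A u by simp
    have P: "degree P \<le> card A"
      using degree_lagrange_poly[of "insert u A" f] A cardu by (simp add: P_def)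
    have prod: "(\<Prod>t\<in>insert u A. [:- t, 1:]) = [:- u, 1:] * ?q" using A u by simp
    have R: "degree ([:- u, 1:] * ?q) = Suc (card A)" "coeff ([:- u, 1:] * ?q) (Suc (card A)) = 1"
      unfolding prod[symmetric] using degree_prod_linear[of "insert u A"] lead_coeff_prod_linear[of "insert u A"] A cardu
      by simp_all
    have "?D = 0"
    proof (rule poly_eq_0_if_many_roots[of "insert u A"])
      show "poly ?D x = 0" if "x \<in> insert u A" for x
      proof -
        have "poly Q x = f x" unfolding Q_def using that u A by (intro poly_lagrange_poly) auto
        moreover have "poly P x = f x" unfolding P_def using that A by (intro poly_lagrange_poly) auto
        moreover have "poly ([:- u, 1:] * ?q) x = 0"
          unfolding prod[symmetric] poly_prod using that A by (intro prod_zero) auto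
        ultimately show ?thesis by (simp only: poly_diff poly_smult)
      qed
      have "degree (smult c ([:- u, 1:] * ?q)) \<le> Suc (card A)"
        using degree_smult_le[of c "[:- u, 1:] * ?q"] R(1) by simp
      then have "degree ?D \<le> Suc (card A)"
        using Q(1) P by (intro degree_diff_le) auto
      moreover have "coeff ?D (Suc (card A)) = 0"
        unfolding coeff_diff coeff_smult Q(2) R(2) using P by (simp add: coeff_eq_0)
      ultimately have "degree ?D < Suc (card A)"
        using degree_less_if_coeff_0 by blast
      then show "degree ?D < card (insert u A)" unfolding cardu .
    qed (use A in simp)
    then show ?thesis by (simp add: P_def)
  qed
  have "lagrange_poly (insert b A) f - lagrange_poly (insert a A) f
      = smult c ([:- a, 1:] * ?q) - smult c ([:- b, 1:] * ?q)"
    using step[of a] step[of b] A by (simp add: algebra_simps)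
  also have "\<dots> = smult c (([:- a, 1:] - [:- b, 1:]) * ?q)"
    by (simp only: smult_diff_right[symmetric] left_diff_distrib)
  also have "[:- a, 1:] - [:- b, 1:] = [:b - a:]" by simp
  finally show ?thesis by (simp add: c_def)
qed

text \<open>If i0 is the least active index, every index from i0 + m on starts at or after
  \<open>t (i0 + m)\<close>, which is beyond x; the active indices lie in a window of m.\<close>

lemma card_active_le:
  fixes t :: "nat \<Rightarrow> real"
  assumes t: "strict_mono_on {..N} t"
  shows "card {i. i + m \<le> N \<and> t i < x \<and> x < t (i + m)} \<le> m"
proof (cases "{i. i + m \<le> N \<and> t i < x \<and> x < t (i + m)} = {}")
  case False
  let ?I = "{i. i + m \<le> N \<and> t i < x \<and> x < t (i + m)}"
  define i0 where "i0 = (LEAST i. i \<in> ?I)"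
  obtain i where "i \<in> ?I" using False by blast
  then have i0: "i0 \<in> ?I" unfolding i0_def by (rule LeastI)
  have least: "i0 \<le> i" if "i \<in> ?I" for i unfolding i0_def using that by (rule Least_le)
  have "i < i0 + m" if "i \<in> ?I" for i
  proof (rule ccontr)
    assume "\<not> i < i0 + m"
    then have "t (i0 + m) \<le> t i"
      using that i0 strict_mono_on_leD[OF t, of "i0 + m" i] by auto
    then show False using that i0 by auto
  qed
  then have "?I \<subseteq> {i0..<i0 + m}" using least by auto
  then show ?thesis using card_mono[of "{i0..<i0 + m}" ?I] by simp
qed (simp only: card.empty)

lemma sum_abs_le_card_active:
  fixes h :: "nat \<Rightarrow> real"
  assumes "\<And>i. i \<in> I \<Longrightarrow> i \<notin> J \<Longrightarrow> h i = 0" "\<And>i. i \<in> J \<Longrightarrow> \<bar>h i\<bar> \<le> B"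
    and "finite I" "J \<subseteq> I" "card J \<le> m" "0 \<le> B"
  shows "\<bar>\<Sum>i\<in>I. h i\<bar> \<le> real m * B"
proof -
  have "(\<Sum>i\<in>I. h i) = (\<Sum>i\<in>J. h i)"
    by (rule sum.mono_neutral_right) (use assms in auto)
  also have "\<bar>\<dots>\<bar> \<le> (\<Sum>i\<in>J. B)"
    by (rule order_trans[OF sum_abs sum_mono]) (rule assms(2))
  also have "\<dots> \<le> real m * B" using assms by (simp add: mult_right_mono)
  finally show ?thesis .
qed

theorem finite_interpolation:
  fixes t :: "nat \<Rightarrow> real"
  assumes t: "strict_mono_on {..N} t" and "0 \<le> A"
    and dd: "\<And>i. i + Suc n \<le> N \<Longrightarrow> fact (Suc n) * \<bar>divided_difference (t ` {i..i + Suc n}) f\<bar> \<le> A"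
    and N: "Suc n \<le> N"
  shows "\<exists>F. smooth_lipschitz (Suc n) (switch_bound n * A) F \<and> (\<forall>l\<le>N. F (t l) = f (t l))"
proof -
  define m where "m = Suc n"
  define M where "M = N - m"
  define P where "P = (\<lambda>i. lagrange_poly (t ` {i..<i + m}) f)"
  define \<psi> where "\<psi> = (\<lambda>i. P (Suc i) - P i)"
  define q where "q = (\<lambda>i. \<Prod>s\<in>t ` {i<..<i + m}. [:- s, 1::real:])"
  define c where "c = (\<lambda>i. divided_difference (t ` {i..i + m}) f)"
  define S where "S = (\<lambda>i. switch_poly n (t i) (t (i + m)))"
  have lt: "t i < t j" if "i < j" "j \<le> N" for i j
    using strict_mono_onD[OF t] that by auto
  have le: "t i \<le> t j" if "i \<le> j" "j \<le> N" for i j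
    using lt[of i j] that by (cases "i = j") auto
  have inj: "t i = t j \<longleftrightarrow> i = j" if "i \<le> N" "j \<le> N" for i j
    using lt[of i j] lt[of j i] that by (cases i j rule: linorder_cases) auto
  have injon: "inj_on t X" if "X \<subseteq> {..N}" for X
  proof (rule inj_onI)
    fix i j assume "i \<in> X" "j \<in> X" "t i = t j"
    then show "i = j" using inj[of i j] that by auto
  qed
  have \<psi>: "\<psi> i = smult (c i * (t (i + m) - t i)) (q i)" if "i \<le> M" for i
  proof -
    have im: "i + m \<le> N" using that N by (simp add: M_def m_def)
    have notin: "t j \<notin> t ` {i<..<i + m}" if "j \<le> N" "j \<notin> {i<..<i + m}" for j
      using that im inj by auto
    have e1: "t ` {Suc i..<Suc i + m} = insert (t (i + m)) (t ` {i<..<i + m})"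
    proof -
      have "{Suc i..<Suc i + m} = insert (i + m) {i<..<i + m}" by (auto simp: m_def)
      then show ?thesis by simp
    qed
    have e2: "t ` {i..<i + m} = insert (t i) (t ` {i<..<i + m})"
    proof -
      have "{i..<i + m} = insert i {i<..<i + m}" by (auto simp: m_def)
      then show ?thesis by simp
    qed
    have e3: "t ` {i..i + m} = insert (t i) (insert (t (i + m)) (t ` {i<..<i + m}))"
    proof -
      have "{i..i + m} = insert i (insert (i + m) {i<..<i + m})" by (auto simp: m_def)
      then show ?thesis by simp
    qed
    show ?thesis
      unfolding \<psi>_def P_def c_def q_def e1 e2 e3
      by (rule lagrange_poly_diff) (use notin[of i] notin[of "i + m"] lt[of i "i + m"] im in \<open>auto simp: m_def\<close>)
  qed
  \<comment> \<open>Each switch enters as two truncated polynomials: S times \<open>\<psi>\<close>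
    from \<open>t i\<close> on, and (1 - S) times \<open>\<psi>\<close> from
    \<open>t (i + m)\<close> on, which completes it to \<open>\<psi>\<close>. The orders of
    vanishing of S and 1 - S make both joints smooth.\<close>
  define knot where "knot = (\<lambda>(i, b). if b then t (i + m) else t i)"
  define r where "r = (\<lambda>(i, b). if b then (1 - S i) * \<psi> i else S i * \<psi> i)"
  define F where "F = (\<lambda>x. poly (P 0) x + (\<Sum>j\<in>{..M} \<times> UNIV. truncated_poly (knot j) (r j) x))"
  have split: "(\<Sum>j\<in>{..M} \<times> UNIV. truncated_poly (knot j) (h j) x)
     = (\<Sum>i\<le>M. truncated_poly (t i) (h (i, False)) x + truncated_poly (t (i + m)) (h (i, True)) x)" for h x
  proof -
    have "(\<Sum>j\<in>{..M} \<times> UNIV. truncated_poly (knot j) (h j) x)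
       = (\<Sum>i\<le>M. \<Sum>b\<in>UNIV. truncated_poly (knot (i, b)) (h (i, b)) x)"
      by (simp only: sum.cartesian_product case_prod_unfold prod.collapse)
    then show ?thesis by (simp add: UNIV_bool knot_def)
  qed
  have q_deg: "degree (q i) = n" and q_set: "finite (t ` {i<..<i + m})" "card (t ` {i<..<i + m}) = n"
      "t ` {i<..<i + m} \<subseteq> {t i..t (i + m)}" if "i \<le> M" for i
  proof -
    have im: "i + m \<le> N" using that N by (simp add: M_def m_def)
    show "card (t ` {i<..<i + m}) = n"
      using im by (subst card_image[OF injon]) (auto simp: m_def)
    then show "degree (q i) = n" unfolding q_def by (simp add: degree_prod_linear)
    show "t ` {i<..<i + m} \<subseteq> {t i..t (i + m)}"
      using im by (auto intro!: le)
  qed simp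
  have q_root: "poly (q i) (t l) = 0" if "i < l" "l < i + m" for i l
    unfolding q_def poly_prod using that by (intro prod_zero) auto
  have dP0: "(pderiv ^^ Suc n) (P 0) = 0"
  proof (rule higher_pderiv_eq_0)
    have "card (t ` {0..<0 + m}) = m"
      using N by (subst card_image[OF injon]) (auto simp: m_def)
    then show "degree (P 0) < Suc n"
      using degree_lagrange_poly[of "t ` {0..<0 + m}" f] by (simp add: P_def m_def)
  qed
  have d\<psi>: "(pderiv ^^ Suc n) (\<psi> i) = 0" if "i \<le> M" for i
  proof (rule higher_pderiv_eq_0)
    show "degree (\<psi> i) < Suc n"
      unfolding \<psi>[OF that] using degree_smult_le[of _ "q i"] q_deg[OF that] by (simp add: le_imp_less_Suc)
  qed
  have sb: "switch_bound n \<ge> 0" by (simp add: switch_bound_def sum_nonneg)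
  have smooth: "smooth_lipschitz (Suc n) (switch_bound n * A) F"
    unfolding F_def
  proof (rule smooth_lipschitz_truncated_poly_sum)
    show "[:- knot j, 1:] ^ Suc n dvd r j" if j: "j \<in> {..M} \<times> UNIV" for j
    proof -
      obtain i b where ib: "j = (i, b)" "i \<le> M" using j by (cases j) auto
      have "t i < t (i + m)" using ib N by (intro lt) (auto simp: M_def m_def)
      then show ?thesis
        unfolding ib knot_def r_def S_def using switch_poly_dvd switch_poly_complement_dvd
        by (cases b) (simp_all only: prod.case if_True if_False dvd_mult2)
    qed
    fix x assume x: "x \<notin> knot ` ({..M} \<times> UNIV)"
    define h where "h = (\<lambda>i. truncated_poly (t i) ((pderiv ^^ Suc n) (r (i, False))) x
        + truncated_poly (t (i + m)) ((pderiv ^^ Suc n) (r (i, True))) x)"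
    have "poly ((pderiv ^^ Suc n) (P 0)) x
       + (\<Sum>j\<in>{..M} \<times> UNIV. truncated_poly (knot j) ((pderiv ^^ Suc n) (r j)) x) = (\<Sum>i\<le>M. h i)"
      unfolding dP0 split[of "\<lambda>j. (pderiv ^^ Suc n) (r j)"] h_def by simp
    \<comment> \<open>An active switch gets the share 1 / m, since the product bound supplies n! and
      the hypothesis m!; the number of active switches makes up for it.\<close>
    also have "\<bar>\<dots>\<bar> \<le> real m * (switch_bound n * A / m)"
    proof (rule sum_abs_le_card_active)
      let ?J = "{i. i + m \<le> N \<and> t i < x \<and> x < t (i + m)}"
      show "card ?J \<le> m" by (rule card_active_le[OF t])
      show "?J \<subseteq> {..M}" by (auto simp: M_def)
      show "0 \<le> switch_bound n * A / m" using sb \<open>0 \<le> A\<close> by simp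
      show "h i = 0" if i: "i \<in> {..M}" "i \<notin> ?J" for i
      proof -
        have im: "i + m \<le> N" "t i \<le> t (i + m)" using i(1) N by (auto simp: M_def m_def intro: le)
        have "(i, False) \<in> {..M} \<times> UNIV" "(i, True) \<in> {..M} \<times> UNIV" using i by auto
        then have "x \<noteq> t i" "x \<noteq> t (i + m)"
          using x by (force simp: knot_def)+
        then consider "x < t i" | "t (i + m) < x" using i im by fastforce
        then show ?thesis
        proof cases
          case 1
          then show ?thesis using im by (simp add: h_def truncated_poly_def)
        next
          case 2
          have "r (i, False) + r (i, True) = \<psi> i" by (simp add: r_def algebra_simps)
          then have "(pderiv ^^ Suc n) (r (i, False)) + (pderiv ^^ Suc n) (r (i, True)) = 0"
            using d\<psi>[of i] i(1) by (simp only: higher_pderiv_add[symmetric] atMost_iff)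
          then have "poly ((pderiv ^^ Suc n) (r (i, False))) x + poly ((pderiv ^^ Suc n) (r (i, True))) x = 0"
            by (simp only: poly_add[symmetric] poly_0)
          then show ?thesis using 2 im by (simp add: h_def truncated_poly_def del: funpow.simps)
        qed
      qed
      show "\<bar>h i\<bar> \<le> switch_bound n * A / m" if i: "i \<in> ?J" for i
      proof -
        have iM: "i \<le> M" using i by (auto simp: M_def)
        have "r (i, False) = smult (c i * (t (i + m) - t i)) (S i * q i)"
          unfolding r_def using \<psi>[OF iM] by simp
        then have "h i = c i * (t (i + m) - t i) * poly ((pderiv ^^ Suc n) (S i * q i)) x"
          using i by (simp add: h_def truncated_poly_def higher_pderiv_smult del: funpow.simps)
        then have "\<bar>h i\<bar> = \<bar>c i\<bar> * (\<bar>poly ((pderiv ^^ Suc n) (S i * q i)) x\<bar> * (t (i + m) - t i))"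
          using i by (simp add: abs_mult del: funpow.simps)
        also have "\<dots> \<le> \<bar>c i\<bar> * (fact n * switch_bound n)"
          unfolding S_def q_def
          by (intro mult_left_mono switch_poly_product_bound) (use q_set[OF iM] i in auto)
        also have "\<dots> = (fact (Suc n) * \<bar>c i\<bar>) * switch_bound n / m"
          by (simp add: m_def field_simps)
        also have "\<dots> \<le> A * switch_bound n / m"
          using dd[of i] i sb by (intro divide_right_mono mult_right_mono) (auto simp: c_def m_def)
        finally show ?thesis by (simp add: mult.commute)
      qed
    qed simp
    also have "\<dots> = switch_bound n * A" by (simp add: m_def)
    finally show "\<bar>poly ((pderiv ^^ Suc n) (P 0)) x
       + (\<Sum>j\<in>{..M} \<times> UNIV. truncated_poly (knot j) ((pderiv ^^ Suc n) (r j)) x)\<bar> \<le> switch_bound n * A" .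
  qed (use sb \<open>0 \<le> A\<close> in auto)
  have "F (t l) = f (t l)" if l: "l \<le> N" for l
  proof -
    have P: "poly (P i) (t l) = f (t l)" if "i \<le> l" "l < i + m" for i
      unfolding P_def using that by (intro poly_lagrange_poly) auto
    \<comment> \<open>At a node only completed switches count. During a switch \<open>\<psi>\<close>
      has a root at each inner node; at the starting node, which the truncation includes, S has
      one.\<close>
    have summand: "truncated_poly (t i) (r (i, False)) (t l) + truncated_poly (t (i + m)) (r (i, True)) (t l)
       = (if i + m \<le> l then poly (\<psi> i) (t l) else 0)" if iM: "i \<le> M" for i
    proof -
      have im: "i + m \<le> N" using iM N by (simp add: M_def m_def)
      consider "i + m \<le> l" | "i < l" "l < i + m" | "l \<le> i" by linarith
      then show ?thesis
      proof cases
        case 1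
        then have "t i \<le> t l" "t (i + m) \<le> t l" using l im by (auto intro!: le)
        then show ?thesis using 1 by (simp add: truncated_poly_def r_def algebra_simps)
      next
        case 2
        then have "t i \<le> t l" "\<not> t (i + m) \<le> t l" using l im lt[of l "i + m"] by (auto intro!: le)
        then show ?thesis using 2 q_root[OF 2] by (simp add: truncated_poly_def r_def \<psi>[OF iM])
      next
        case 3
        then have "\<not> t (i + m) \<le> t l" using im lt[of l "i + m"] by (auto simp: m_def)
        moreover have "poly (S i) (t i) = 0"
          unfolding S_def by (rule poly_eq_0_if_dvd[OF switch_poly_dvd])
        moreover have "t i \<le> t l \<Longrightarrow> t l = t i"
          using 3 le[of l i] im by auto
        ultimately show ?thesis using 3 by (auto simp: truncated_poly_def r_def m_def)
      qed
    qed
    have "F (t l) = poly (P 0) (t l) + (\<Sum>i\<le>M. if i + m \<le> l then poly (\<psi> i) (t l) else 0)"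
      unfolding F_def split[of r] by (simp add: summand)
    also have "(\<Sum>i\<le>M. if i + m \<le> l then poly (\<psi> i) (t l) else 0) = (\<Sum>i\<in>{i. i + m \<le> l}. poly (\<psi> i) (t l))"
    proof -
      have "{i. i + m \<le> l} \<subseteq> {..M}" using l N by (auto simp: M_def)
      then show ?thesis
        by (intro sum.mono_neutral_cong_right) auto
    qed
    \<comment> \<open>The completed switches telescope to the interpolant that has
      \<open>t l\<close> as its last node; for l < m there are none, and \<open>P 0\<close> already
      has the right value.\<close>
    also have "poly (P 0) (t l) + (\<Sum>i\<in>{i. i + m \<le> l}. poly (\<psi> i) (t l)) = f (t l)"
    proof (cases "m \<le> l")
      case True
      then have "{i. i + m \<le> l} = {..<Suc (l - m)}" by auto
      then have "(\<Sum>i\<in>{i. i + m \<le> l}. poly (\<psi> i) (t l)) = poly (P (Suc (l - m))) (t l) - poly (P 0) (t l)"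
        using sum_lessThan_telescope[of "\<lambda>i. poly (P i) (t l)" "Suc (l - m)"] by (simp only: \<psi>_def poly_diff)
      then show ?thesis using P[of "Suc (l - m)"] True by (simp add: m_def)
    next
      case False
      then have "{i. i + m \<le> l} = {}" by auto
      then show ?thesis using P[of 0] False by simp
    qed
    finally show ?thesis .
  qed
  then show ?thesis using smooth by blast
qed

lemma switch_bound_0: "switch_bound 0 = 1"
  by (simp add: switch_bound_def)

text \<open>Completing the sum gives (3 / 2)^(n + 1) by the binomial theorem, and the central
  binomial is at most 4^n; together this is (2 n + 1) / 4 times 6^(n + 1), well below the base
  9.\<close>

lemma switch_bound_less:
  assumes "2 \<le> n"
  shows "switch_bound n < real n * 9 ^ Suc n"
proof -
  have "(\<Sum>k\<le>n. real (Suc n choose k) / 2 ^ k) \<le> (\<Sum>k\<le>Suc n. real (Suc n choose k) / 2 ^ k)"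
    by simp
  also have "\<dots> = (1 / 2 + 1) ^ Suc n"
    unfolding binomial_ring by (intro sum.cong) (simp_all add: power_one_over)
  also have "\<dots> = (3 / 2) ^ Suc n" by simp
  finally have 1: "(\<Sum>k\<le>n. real (Suc n choose k) / 2 ^ k) \<le> (3 / 2) ^ Suc n" .
  have "2 * n choose n \<le> 2 ^ (2 * n)" by (rule binomial_le_pow2)
  then have "real (2 * n choose n) \<le> 4 ^ n"
    by (metis of_nat_le_iff of_nat_numeral of_nat_power power_mult power2_eq_square numeral_Bit0 mult_2 num_double numeral_times_numeral)
  then have "switch_bound n \<le> (real (2 * n + 1) * 4 ^ n) * (3 / 2) ^ Suc n"
    unfolding switch_bound_def of_nat_mult by (intro mult_mono 1 mult_left_mono) (auto intro!: sum_nonneg)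
  also have "\<dots> = (real (2 * n + 1) / 4) * 6 ^ Suc n"
  proof -
    have "(4::real) ^ Suc n * (3 / 2) ^ Suc n = 6 ^ Suc n" by (simp only: power_mult_distrib[symmetric]) simp
    then show ?thesis by (simp add: field_simps)
  qed
  also have "\<dots> \<le> real n * 6 ^ Suc n"
    using assms by (intro mult_right_mono) auto
  also have "\<dots> < real n * 9 ^ Suc n"
    using assms by (intro mult_strict_left_mono power_strict_mono) auto
  finally show ?thesis .
qed

section \<open>Quadratic splines for m = 2\<close>

lemma truncated_square_second_derivative:
  "truncated_poly a ((pderiv ^^ Suc 1) (smult c ([:- a, 1:] ^ Suc 1))) x = (if a \<le> x then 2 * c else 0)"
  by (simp add: truncated_poly_def pderiv_pCons)

text \<open>On each interval the second derivative takes two values, with the jump at the midpoint.\<close>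

lemma quadratic_spline:
  fixes t y s :: "nat \<Rightarrow> real"
  assumes t: "strict_mono_on {..N} t" and "0 \<le> A"
    and s: "\<And>j. j < N \<Longrightarrow> \<bar>s j * (t (Suc j) - t j) - (y (Suc j) - y j)\<bar> \<le> A / 2 * (t (Suc j) - t j)\<^sup>2"
      "\<And>j. j < N \<Longrightarrow> \<bar>s (Suc j) * (t (Suc j) - t j) - (y (Suc j) - y j)\<bar> \<le> A / 2 * (t (Suc j) - t j)\<^sup>2"
  shows "\<exists>F. smooth_lipschitz 2 (2 * A) F \<and> (\<forall>l\<le>N. F (t l) = y l)"
proof -
  have lt: "t i < t j" if "i < j" "j \<le> N" for i j
    using strict_mono_onD[OF t] that by auto
  have le: "t i \<le> t j" if "i \<le> j" "j \<le> N" for i j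
    using lt[of i j] that by (cases "i = j") auto
  define h where "h = (\<lambda>j. t (Suc j) - t j)"
  define c where "c = (\<lambda>j. (t j + t (Suc j)) / 2)"
  \<comment> \<open>The two values of the second derivative solve two linear conditions: the slope
    must change by (\<open>\<sigma>1\<close> + \<open>\<sigma>2\<close>) h / 2, and the increment of
    y must be s h + (3 \<open>\<sigma>1\<close> + \<open>\<sigma>2\<close>) h^2 / 8.\<close>
  define \<sigma>1 where "\<sigma>1 = (\<lambda>j. (4 * (y (Suc j) - y j) - (3 * s j + s (Suc j)) * h j) / (h j)\<^sup>2)"
  define \<sigma>2 where "\<sigma>2 = (\<lambda>j. ((3 * s (Suc j) + s j) * h j - 4 * (y (Suc j) - y j)) / (h j)\<^sup>2)"
  have h: "h j > 0" if "j < N" for j using lt[of j "Suc j"] that by (simp add: h_def)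
  have \<sigma>: "\<bar>\<sigma>1 j\<bar> \<le> 2 * A" "\<bar>\<sigma>2 j\<bar> \<le> 2 * A" if "j < N" for j
  proof -
    let ?a = "s j * h j - (y (Suc j) - y j)" and ?b = "s (Suc j) * h j - (y (Suc j) - y j)"
    have ab: "\<bar>?a\<bar> \<le> A / 2 * (h j)\<^sup>2" "\<bar>?b\<bar> \<le> A / 2 * (h j)\<^sup>2" using s that by (simp_all add: h_def)
    have e: "\<sigma>1 j = - (3 * ?a + ?b) / (h j)\<^sup>2" "\<sigma>2 j = (3 * ?b + ?a) / (h j)\<^sup>2"
      unfolding \<sigma>1_def \<sigma>2_def by (simp_all add: algebra_simps)
    \<comment> \<open>The weights 3 and 1 turn the deviation A / 2, allowed to both end slopes, into
      four times A / 2; this is where the constant 2 originates.\<close>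
    have "\<bar>3 * u + v\<bar> \<le> 4 * X" if "\<bar>u\<bar> \<le> X" "\<bar>v\<bar> \<le> X" for u v X :: real
      using that by linarith
    from this[OF ab] this[OF ab(2,1)]
    have "\<bar>3 * ?a + ?b\<bar> \<le> 2 * A * (h j)\<^sup>2" "\<bar>3 * ?b + ?a\<bar> \<le> 2 * A * (h j)\<^sup>2"
      by simp_all
    then show "\<bar>\<sigma>1 j\<bar> \<le> 2 * A" "\<bar>\<sigma>2 j\<bar> \<le> 2 * A"
      unfolding e abs_divide abs_minus using h[OF that] by (simp_all add: divide_le_eq)
  qed
  define knot where "knot = (\<lambda>(j, k::nat). if k = 0 then t j else if k = 1 then c j else t (Suc j))"
  \<comment> \<open>Half the jump of the second derivative at each of the three knots of an
    interval; the last jump returns to 0, so the intervals do not interact.\<close>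
  define coef where "coef = (\<lambda>(j, k::nat). if k = 0 then \<sigma>1 j / 2 else if k = 1 then (\<sigma>2 j - \<sigma>1 j) / 2 else - \<sigma>2 j / 2)"
  define r where "r = (\<lambda>p. smult (coef p) ([:- knot p, 1:] ^ Suc 1))"
  define P where "P = [:y 0 - s 0 * t 0, s 0:]"
  define J where "J = {..<N} \<times> {0, 1, 2::nat}"
  define F where "F = (\<lambda>x. poly P x + (\<Sum>p\<in>J. truncated_poly (knot p) (r p) x))"
  have split: "(\<Sum>p\<in>J. g p) = (\<Sum>j<N. g (j, 0) + g (j, 1) + g (j, 2))" for g :: "nat \<times> nat \<Rightarrow> real"
  proof -
    have "(\<Sum>p\<in>J. g p) = (\<Sum>j<N. \<Sum>k\<in>{0, 1, 2}. g (j, k))"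
      unfolding J_def by (simp only: sum.cartesian_product case_prod_unfold prod.collapse)
    then show ?thesis by (simp add: add.assoc)
  qed
  have c: "t j < c j" "c j < t (Suc j)" if "j < N" for j
    using h[OF that] by (simp_all add: c_def h_def field_simps)
  have "smooth_lipschitz (Suc 1) (2 * A) F"
    unfolding F_def
  proof (rule smooth_lipschitz_truncated_poly_sum)
    show "finite J" by (simp add: J_def)
    show "[:- knot p, 1:] ^ Suc 1 dvd r p" for p unfolding r_def by (rule dvd_smult) simp
    fix x assume x: "x \<notin> knot ` J"
    define g where "g = (\<lambda>p. truncated_poly (knot p) ((pderiv ^^ Suc 1) (r p)) x)"
    have g: "g p = (if knot p \<le> x then 2 * coef p else 0)" for p
      unfolding g_def r_def by (rule truncated_square_second_derivative)
    have "(pderiv ^^ Suc 1) P = 0" by (rule higher_pderiv_eq_0) (simp add: P_def)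
    then have "poly ((pderiv ^^ Suc 1) P) x + (\<Sum>p\<in>J. truncated_poly (knot p) ((pderiv ^^ Suc 1) (r p)) x)
        = (\<Sum>j<N. g (j, 0) + g (j, 1) + g (j, 2))"
      unfolding g_def[symmetric] split by (simp del: funpow.simps)
    also have "\<bar>\<dots>\<bar> \<le> real 1 * (2 * A)"
    proof (rule sum_abs_le_card_active)
      let ?J = "{i. i + 1 \<le> N \<and> t i < x \<and> x < t (i + 1)}"
      show "card ?J \<le> 1" by (rule card_active_le[OF t])
      show "?J \<subseteq> {..<N}" by auto
      show "g (j, 0) + g (j, 1) + g (j, 2) = 0" if j: "j \<in> {..<N}" "j \<notin> ?J" for j
      proof -
        have "(j, 0) \<in> J" "(j, 2) \<in> J" using j by (auto simp: J_def)
        then have "x \<noteq> t j" "x \<noteq> t (Suc j)" using x by (force simp: knot_def)+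
        then consider "x < t j" | "t (Suc j) < x" using j by fastforce
        then show ?thesis using c[of j] j(1) by cases (auto simp: g knot_def coef_def field_simps)
      qed
      show "\<bar>g (j, 0) + g (j, 1) + g (j, 2)\<bar> \<le> 2 * A" if j: "j \<in> ?J" for j
      proof -
        have "\<sigma>1 j + (2 * \<sigma>2 j - 2 * \<sigma>1 j) / 2 = \<sigma>2 j" by (simp add: field_simps)
        then show ?thesis using \<sigma>[of j] j c[of j] by (auto simp: g knot_def coef_def)
      qed
    qed (use \<open>0 \<le> A\<close> in auto)
    finally show "\<bar>poly ((pderiv ^^ Suc 1) P) x + (\<Sum>p\<in>J. truncated_poly (knot p) ((pderiv ^^ Suc 1) (r p)) x)\<bar> \<le> 2 * A"
      by simp
  qed (use \<open>0 \<le> A\<close> in auto)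
  moreover have "F (t l) = y l" if l: "l \<le> N" for l
  proof -
    \<comment> \<open>To the right of an interval its three parabolas add up to the difference of
      the tangent lines at its two ends; starting from P, the tangent line at \<open>t 0\<close>,
      the sum telescopes to the tangent line at \<open>t l\<close>.\<close>
    let ?v = "\<lambda>x j. y (Suc j) - y j - s j * h j + (s (Suc j) - s j) * (x - t (Suc j))"
    have *: "truncated_poly (knot (j, 0)) (r (j, 0)) (t l) + truncated_poly (knot (j, 1)) (r (j, 1)) (t l)
        + truncated_poly (knot (j, 2)) (r (j, 2)) (t l) = (if j < l then ?v (t l) j else 0)" if j: "j < N" for j
    proof (cases "j < l")
      case True
      then have ord: "t j \<le> t l" "c j \<le> t l" "t (Suc j) \<le> t l"
        using le[of "Suc j" l] l c[OF j] by auto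
      define z where "z = t l - t (Suc j)"
      have z: "t l = t (Suc j) + z" by (simp add: z_def)
      have hj: "t (Suc j) = t j + h j" by (simp add: h_def)
      have "truncated_poly (knot (j, 0)) (r (j, 0)) (t l) + truncated_poly (knot (j, 1)) (r (j, 1)) (t l)
        + truncated_poly (knot (j, 2)) (r (j, 2)) (t l)
        = \<sigma>1 j / 2 * (z + h j)\<^sup>2 + (\<sigma>2 j - \<sigma>1 j) / 2 * (z + h j / 2)\<^sup>2 - \<sigma>2 j / 2 * z\<^sup>2"
        using ord unfolding truncated_poly_def r_def knot_def coef_def
        by (simp add: z c_def hj power2_eq_square field_simps)
      also have "\<dots> = (\<sigma>1 j + \<sigma>2 j) * (h j)\<^sup>2 / 2 * (z / h j) + (3 * \<sigma>1 j + \<sigma>2 j) * (h j)\<^sup>2 / 8"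
        using h[OF j] by (simp add: power2_eq_square field_simps)
      also have "(\<sigma>1 j + \<sigma>2 j) * (h j)\<^sup>2 = 2 * (s (Suc j) - s j) * h j"
        using h[OF j] unfolding \<sigma>1_def \<sigma>2_def by (simp add: field_simps)
      also have "(3 * \<sigma>1 j + \<sigma>2 j) * (h j)\<^sup>2 = 8 * (y (Suc j) - y j - s j * h j)"
        using h[OF j] unfolding \<sigma>1_def \<sigma>2_def by (simp add: field_simps)
      also have "2 * (s (Suc j) - s j) * h j / 2 * (z / h j) + 8 * (y (Suc j) - y j - s j * h j) / 8 = ?v (t l) j"
        using h[OF j] by (simp add: z_def field_simps)
      finally show ?thesis using True by simp
    next
      case False
      then have "t l \<le> t j" using le[of l j] j by auto
      then show ?thesis using False c[OF j]
        by (auto simp: truncated_poly_def r_def knot_def)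
    qed
    have "F (t l) = poly P (t l) + (\<Sum>j<N. if j < l then ?v (t l) j else 0)"
      unfolding F_def split using * by simp
    also have "(\<Sum>j<N. if j < l then ?v (t l) j else 0) = (\<Sum>j<l. ?v (t l) j)"
      using l by (intro sum.mono_neutral_cong_right) auto
    also have "poly P x + (\<Sum>j<l. ?v x j) = y l + s l * (x - t l)" for x
      by (induction l) (simp_all add: P_def h_def algebra_simps)
    finally show ?thesis by simp
  qed
  ultimately show ?thesis by (auto simp: numeral_2_eq_2)
qed

lemma divided_difference_3:
  fixes a b c :: real
  assumes "a < b" "b < c"
  shows "divided_difference {a, b, c} f * (c - a) = (f c - f b) / (c - b) - (f b - f a) / (b - a)"
proof -
  have s: "{a, b, c} - {a} = {b, c}" "{a, b, c} - {b} = {a, c}" "{a, b, c} - {c} = {a, b}"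
    using assms by auto
  have "divided_difference {a, b, c} f = f a / ((a - b) * (a - c)) + f b / ((b - a) * (b - c)) + f c / ((c - a) * (c - b))"
    unfolding divided_difference_def using assms by (simp add: s)
  moreover have "f a / ((a - b) * (a - c)) * (c - a) = f a / (b - a)"
    "f b / ((b - a) * (b - c)) * (c - a) = - (f b / (b - a)) - f b / (c - b)"
    "f c / ((c - a) * (c - b)) * (c - a) = f c / (c - b)"
    using assms by (simp_all add: divide_simps) (simp_all add: algebra_simps)
  ultimately show ?thesis by (simp add: distrib_right diff_divide_distrib)
qed

text \<open>The slope at an inner node is that of the parabola through it and its neighbours. It
  differs from the secant slope on either side by a divided difference, at most A / 2, times the
  length of that side, as \<open>quadratic_spline\<close> demands. At the two ends the secant slope
  itself serves.\<close>

lemma finite_interpolation_2: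
  fixes t :: "nat \<Rightarrow> real"
  assumes t: "strict_mono_on {..N} t" and "0 \<le> A" and N: "2 \<le> N"
    and dd: "\<And>i. i + 2 \<le> N \<Longrightarrow> 2 * \<bar>divided_difference (t ` {i..i + 2}) f\<bar> \<le> A"
  shows "\<exists>F. smooth_lipschitz 2 (2 * A) F \<and> (\<forall>l\<le>N. F (t l) = f (t l))"
proof -
  define h where "h = (\<lambda>j. t (Suc j) - t j)"
  define d where "d = (\<lambda>j. (f (t (Suc j)) - f (t j)) / h j)"
  define e where "e = (\<lambda>j. divided_difference (t ` {j..j + 2}) f)"
  define s where "s = (\<lambda>j. if j = 0 then d 0 else if j < N then d (j - 1) + e (j - 1) * h (j - 1) else d (j - 1))"
  have h: "h j > 0" if "j < N" for j
    using strict_mono_onD[OF t, of j "Suc j"] that by (simp add: h_def)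
  have d: "f (t (Suc j)) - f (t j) = d j * h j" if "j < N" for j
    using h[OF that] by (simp add: d_def)
  have e: "\<bar>e j\<bar> \<le> A / 2" if "Suc j < N" for j
    using dd[of j] that by (simp add: e_def)
  have de: "d (Suc j) = d j + e j * (h j + h (Suc j))" if "Suc j < N" for j
  proof -
    have "{j..j + 2} = {j, Suc j, Suc (Suc j)}" by auto
    then have "e j = divided_difference {t j, t (Suc j), t (Suc (Suc j))} f"
      by (simp add: e_def)
    then have "e j * (t (Suc (Suc j)) - t j) = d (Suc j) - d j"
      using divided_difference_3[of "t j" "t (Suc j)" "t (Suc (Suc j))" f] h[of j] h[of "Suc j"] that
      by (simp add: d_def h_def)
    then show ?thesis by (simp add: h_def)
  qed
  have bound: "\<bar>u * h j\<bar> \<le> A / 2 * (h j)\<^sup>2" if "\<bar>u\<bar> \<le> A / 2 * h j" "j < N" for u j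
    using mult_right_mono[OF that(1), of "h j"] h[OF that(2)]
    by (simp add: abs_mult power2_eq_square)
  have eh: "\<bar>e i * h j\<bar> \<le> A / 2 * h j" if "Suc i < N" "j < N" for i j
    using mult_right_mono[OF e[OF that(1)], of "h j"] h[OF that(2)] by (simp add: abs_mult)
  show ?thesis
  proof (rule quadratic_spline[OF t \<open>0 \<le> A\<close>, of s])
    fix j assume j: "j < N"
    have "\<bar>s j - d j\<bar> \<le> A / 2 * h j"
    proof (cases j)
      case 0
      then show ?thesis using \<open>0 \<le> A\<close> h[OF j] by (simp add: s_def)
    next
      case (Suc i)
      then have "s j - d j = - (e i * h j)" using j de[of i] by (simp add: s_def algebra_simps)
      then show ?thesis using eh[of i j] Suc j by simp
    qed
    from bound[OF this j] show "\<bar>s j * (t (Suc j) - t j) - (f (t (Suc j)) - f (t j))\<bar> \<le> A / 2 * (t (Suc j) - t j)\<^sup>2"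
      unfolding d[OF j] by (simp add: h_def algebra_simps)
    have "\<bar>s (Suc j) - d j\<bar> \<le> A / 2 * h j"
    proof (cases "Suc j < N")
      case True
      then show ?thesis using eh[of j j] j by (simp add: s_def)
    next
      case False
      then show ?thesis using \<open>0 \<le> A\<close> h[OF j] by (simp add: s_def)
    qed
    from bound[OF this j] show "\<bar>s (Suc j) * (t (Suc j) - t j) - (f (t (Suc j)) - f (t j))\<bar> \<le> A / 2 * (t (Suc j) - t j)\<^sup>2"
      unfolding d[OF j] by (simp add: h_def algebra_simps)
  qed
qed

text \<open>For m = 2 the general construction would give \<open>switch_bound 1\<close>, which is 12
  instead of the sharp 2; for m = 1 it gives 1, which is sharp.\<close>

definition extension_bound :: "nat \<Rightarrow> real" where
  "extension_bound m = (if m = 2 then 2 else switch_bound (m - 1))"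

lemma switch_bound_pos: "0 < switch_bound n"
proof -
  have "0 < (\<Sum>k\<le>n. real (Suc n choose k) / 2 ^ k)"
    by (rule sum_pos) (auto simp: zero_less_binomial_iff)
  then show ?thesis unfolding switch_bound_def by (intro mult_pos_pos) (simp_all add: zero_less_binomial_iff add_pos_nonneg)
qed

lemma extension_bound_pos: "0 < extension_bound m"
  by (simp add: extension_bound_def switch_bound_pos)

lemma finite_set_interpolation:
  assumes m: "1 \<le> m" and T: "finite T" "m + 1 \<le> card T" and "0 \<le> A"
    and dd: "\<And>S. S \<subseteq> T \<Longrightarrow> card S = m + 1 \<Longrightarrow> fact m * \<bar>divided_difference S f\<bar> \<le> A"
  shows "\<exists>F. smooth_lipschitz m (extension_bound m * A) F \<and> (\<forall>x\<in>T. F x = f x)"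
proof -
  define N where "N = card T - 1"
  define t where "t = (\<lambda>i. sorted_list_of_set T ! i)"
  have len: "length (sorted_list_of_set T) = Suc N" using T by (simp add: N_def)
  have t: "strict_mono_on {..N} t"
    unfolding t_def using strict_sorted_list_of_set[of T] len
    by (intro strict_mono_onI) (auto simp: sorted_wrt_iff_nth_less)
  have "set (sorted_list_of_set T) = T" using T by simp
  then have tT: "t ` {..N} = T"
    using len unfolding t_def by (metis atLeast0LessThan lessThan_Suc_atMost list.set_map map_nth set_upt)
  have ddt: "fact m * \<bar>divided_difference (t ` {i..i + m}) f\<bar> \<le> A" if "i + m \<le> N" for i
  proof (rule dd)
    have sub: "{i..i + m} \<subseteq> {..N}" using that by auto
    then show "t ` {i..i + m} \<subseteq> T" using tT by blast
    have "inj_on t {i..i + m}"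
      using strict_mono_on_imp_inj_on[OF t] sub by (rule inj_on_subset)
    then show "card (t ` {i..i + m}) = m + 1" by (simp add: card_image)
  qed
  have "\<exists>F. smooth_lipschitz m (extension_bound m * A) F \<and> (\<forall>l\<le>N. F (t l) = f (t l))"
  proof (cases "m = 2")
    case True
    have "\<exists>F. smooth_lipschitz 2 (2 * A) F \<and> (\<forall>l\<le>N. F (t l) = f (t l))"
      by (rule finite_interpolation_2[OF t \<open>0 \<le> A\<close>]) (use ddt T True in \<open>auto simp: N_def\<close>)
    then show ?thesis using True by (simp add: extension_bound_def)
  next
    case False
    obtain n where n: "m = Suc n" using m by (cases m) auto
    have "\<exists>F. smooth_lipschitz (Suc n) (switch_bound n * A) F \<and> (\<forall>l\<le>N. F (t l) = f (t l))"
      by (rule finite_interpolation[OF t \<open>0 \<le> A\<close>]) (use ddt T n in \<open>auto simp: N_def simp del: fact_Suc\<close>)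
    then show ?thesis using False n by (simp add: extension_bound_def)
  qed
  then show ?thesis using tT by blast
qed

section \<open>Passage to closed sets\<close>

lemma smooth_lipschitzD:
  assumes "smooth_lipschitz m K F"
  shows "k < m - 1 \<Longrightarrow> ((deriv ^^ k) F has_real_derivative (deriv ^^ Suc k) F x) (at x)"
    "\<bar>(deriv ^^ (m - 1)) F x - (deriv ^^ (m - 1)) F y\<bar> \<le> K * \<bar>x - y\<bar>"
  using assms unfolding smooth_lipschitz_def by blast+

lemma smooth_lipschitz_add:
  assumes "smooth_lipschitz m K F" "smooth_lipschitz m L G"
  shows "smooth_lipschitz m (K + L) (\<lambda>x. F x + G x)"
proof -
  define H where "H = (\<lambda>k x. (deriv ^^ k) F x + (deriv ^^ k) G x)"
  have "smooth_lipschitz m (K + L) (H 0)"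
  proof (rule smooth_lipschitz_chain)
    show "(H k has_real_derivative H (Suc k) x) (at x)" if "k < m - 1" for k x
      unfolding H_def using smooth_lipschitzD(1)[OF assms(1) that] smooth_lipschitzD(1)[OF assms(2) that]
      by (rule DERIV_add)
    show "\<bar>H (m - 1) x - H (m - 1) y\<bar> \<le> (K + L) * \<bar>x - y\<bar>" for x y
      using smooth_lipschitzD(2)[OF assms(1), of x y] smooth_lipschitzD(2)[OF assms(2), of x y]
      unfolding H_def by (simp add: algebra_simps abs_le_iff)
  qed
  then show ?thesis by (simp add: H_def)
qed

lemma smooth_lipschitz_cmult:
  assumes "smooth_lipschitz m K F"
  shows "smooth_lipschitz m (\<bar>c\<bar> * K) (\<lambda>x. c * F x)"
proof -
  define H where "H = (\<lambda>k x. c * (deriv ^^ k) F x)"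
  have "smooth_lipschitz m (\<bar>c\<bar> * K) (H 0)"
  proof (rule smooth_lipschitz_chain)
    show "(H k has_real_derivative H (Suc k) x) (at x)" if "k < m - 1" for k x
      unfolding H_def using smooth_lipschitzD(1)[OF assms that] by (rule DERIV_cmult)
    show "\<bar>H (m - 1) x - H (m - 1) y\<bar> \<le> \<bar>c\<bar> * K * \<bar>x - y\<bar>" for x y
      using mult_left_mono[OF smooth_lipschitzD(2)[OF assms, of x y] abs_ge_zero[of c]]
      unfolding H_def by (simp add: right_diff_distrib[symmetric] abs_mult mult.assoc)
  qed
  then show ?thesis by (simp add: H_def)
qed

lemma smooth_lipschitz_poly_less:
  assumes "degree p < m"
  shows "smooth_lipschitz m 0 (poly p)"
  using smooth_lipschitz_poly[of m p] assms by (simp add: coeff_eq_0)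

text \<open>Descending from order m - 1: by Rolle the derivative of order k has m - k zeros in the
  interval, and starting at one of them the bound for the next order (the Lipschitz bound at order m
  - 1) acts over a length of at most hi - lo. These a priori bounds give the compactness of families
  of extensions.\<close>

lemma smooth_lipschitz_zeros_bound:
  assumes F: "smooth_lipschitz m K F" and "0 \<le> K" and Z: "finite Z" "card Z = m" "Z \<subseteq> {lo..hi}"
    and zero: "\<And>z. z \<in> Z \<Longrightarrow> F z = 0" and "k < m" and x: "x \<in> {lo..hi}"
  shows "\<bar>(deriv ^^ k) F x\<bar> \<le> K * (hi - lo) ^ (m - k)"
  using \<open>k < m\<close> x
proof (induction "m - k" arbitrary: k x)
  case (Suc j)
  have "\<exists>Z'. finite Z' \<and> card Z' = m - k \<and> Z' \<subseteq> {lo..hi} \<and> (\<forall>z\<in>Z'. (deriv ^^ k) F z = 0)"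
  proof (rule iterated_Rolle_zeros[OF Z(1)])
    show "card Z = m - k + k" using Z Suc.prems by simp
    show "((deriv ^^ j) F has_real_derivative (deriv ^^ Suc j) F x) (at x)" if "j < k" for j x
      using that Suc.prems by (intro smooth_lipschitzD(1)[OF F]) simp
  qed (use Z zero in auto)
  then obtain Z' where Z': "card Z' = m - k" "Z' \<subseteq> {lo..hi}" "\<forall>z\<in>Z'. (deriv ^^ k) F z = 0" by blast
  then have "Z' \<noteq> {}" using Suc.prems by auto
  then obtain u where u: "u \<in> {lo..hi}" "(deriv ^^ k) F u = 0" using Z' by blast
  have xu: "\<bar>x - u\<bar> \<le> hi - lo" using u Suc.prems by auto
  show ?case
  proof (cases "k = m - 1")
    case True
    have "\<bar>(deriv ^^ k) F x\<bar> \<le> K * \<bar>x - u\<bar>"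
      using smooth_lipschitzD(2)[OF F, of x u] u True by simp
    also have "\<dots> \<le> K * (hi - lo)" using xu \<open>0 \<le> K\<close> by (rule mult_left_mono)
    finally show ?thesis using True Suc.prems by simp
  next
    case False
    then have k: "k < m - 1" "m - k = Suc (m - Suc k)" using Suc.prems by auto
    have bd: "\<bar>(deriv ^^ Suc k) F y\<bar> \<le> K * (hi - lo) ^ (m - Suc k)" if "y \<in> {lo..hi}" for y
      by (rule Suc.hyps(1)) (use Suc.hyps(2) k that in auto)
    have "norm ((deriv ^^ k) F x - (deriv ^^ k) F u) \<le> K * (hi - lo) ^ (m - Suc k) * norm (x - u)"
    proof (rule field_differentiable_bound[of "{lo..hi}" "(deriv ^^ k) F" "(deriv ^^ Suc k) F"])
      show "((deriv ^^ k) F has_field_derivative (deriv ^^ Suc k) F z) (at z within {lo..hi})" if "z \<in> {lo..hi}" for z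
        using smooth_lipschitzD(1)[OF F k(1)] by (rule has_field_derivative_at_within)
    qed (use bd u Suc.prems in \<open>auto simp del: funpow.simps\<close>)
    then have "\<bar>(deriv ^^ k) F x\<bar> \<le> K * (hi - lo) ^ (m - Suc k) * \<bar>x - u\<bar>" using u by simp
    also have "\<dots> \<le> K * (hi - lo) ^ (m - Suc k) * (hi - lo)"
      using xu \<open>0 \<le> K\<close> u by (intro mult_left_mono) auto
    finally show ?thesis unfolding k(2) by (simp add: mult_ac)
  qed
qed simp

text \<open>Tychonoff's theorem, for the topology of pointwise convergence that function types
  carry.\<close>

lemma compact_bounded_functions:
  fixes B :: "'a \<Rightarrow> real"
  shows "compact {g. \<forall>p. \<bar>g p\<bar> \<le> B p}"
proof -
  have "compactin (product_topology (\<lambda>i. euclidean) UNIV) (PiE UNIV (\<lambda>p. {- B p..B p}))"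
    unfolding compactin_PiE by (simp add: compactin_euclidean_iff)
  then have "compact (PiE UNIV (\<lambda>p. {- B p..B p}))"
    by (simp add: euclidean_product_topology compactin_euclidean_iff)
  moreover have "PiE UNIV (\<lambda>p. {- B p..B p}) = {g. \<forall>p. \<bar>g p\<bar> \<le> B p}"
    by (auto simp: abs_le_iff PiE_iff minus_le_iff)
  ultimately show ?thesis by simp
qed

text \<open>Differentiability in a form that passes to pointwise limits: inequalities between
  finitely many values, with a fixed constant.\<close>

lemma has_real_derivative_if_quadratic_remainder:
  fixes f :: "real \<Rightarrow> real"
  assumes "\<And>y. \<bar>y - x\<bar> < 1 \<Longrightarrow> \<bar>f y - f x - d * (y - x)\<bar> \<le> C * (y - x)\<^sup>2"
  shows "(f has_real_derivative d) (at x)"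
proof -
  have "((\<lambda>y. C * \<bar>y - x\<bar>) \<longlongrightarrow> C * \<bar>x - x\<bar>) (at x)" by (intro tendsto_intros)
  then have lim: "((\<lambda>y. C * \<bar>y - x\<bar>) \<longlongrightarrow> 0) (at x)" by simp
  have "norm ((f y - f x) / (y - x) - d) \<le> C * \<bar>y - x\<bar>" if "y \<noteq> x" "dist y x < 1" for y
  proof -
    have "(f y - f x) / (y - x) - d = (f y - f x - d * (y - x)) / (y - x)" using that by (simp add: field_simps)
    then have "norm ((f y - f x) / (y - x) - d) = \<bar>f y - f x - d * (y - x)\<bar> / \<bar>y - x\<bar>" by simp
    also have "\<dots> \<le> C * (y - x)\<^sup>2 / \<bar>y - x\<bar>"
      using assms[of y] that by (intro divide_right_mono) (auto simp: dist_real_def)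
    also have "\<dots> = C * \<bar>y - x\<bar>"
      using that by (simp add: power2_eq_square abs_mult_self_eq[of "y - x", symmetric] del: abs_mult_self_eq)
    finally show ?thesis .
  qed
  then have "\<forall>\<^sub>F y in at x. norm ((f y - f x) / (y - x) - d) \<le> C * \<bar>y - x\<bar>"
    unfolding eventually_at by (intro exI[of _ 1]) auto
  then have "((\<lambda>y. (f y - f x) / (y - x) - d) \<longlongrightarrow> 0) (at x)"
    by (rule Lim_null_comparison) (rule lim)
  then show ?thesis unfolding has_field_derivative_iff by (simp add: LIM_zero_iff)
qed

text \<open>The jets \<open>(k, x) \<mapsto> F\<^sup>(\<^sup>k\<^sup>) x\<close> of the admissible functions lie in a set that is compact for pointwise
  convergence: the Taylor conditions that make a family of functions a jet are closed.\<close>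

lemma smooth_lipschitz_compactness:
  fixes P :: "'j \<Rightarrow> (real \<Rightarrow> real) \<Rightarrow> bool"
  assumes m: "1 \<le> m" and "0 \<le> K" and Z: "finite Z" "card Z = m"
    and closed: "\<And>j. j \<in> J \<Longrightarrow> closed {F. P j F}"
    and ex: "\<And>J'. finite J' \<Longrightarrow> J' \<subseteq> J \<Longrightarrow> \<exists>F. smooth_lipschitz m K F \<and> (\<forall>z\<in>Z. F z = b z) \<and> (\<forall>j\<in>J'. P j F)"
  shows "\<exists>F. smooth_lipschitz m K F \<and> (\<forall>j\<in>J. P j F)"
proof -
  \<comment> \<open>Subtracting this polynomial turns the points of Z into zeros, which bound all
    derivatives; the derivative of order m - 1 changes only by a constant.\<close>
  define p where "p = lagrange_poly Z b"
  have p: "degree p < m" "\<And>z. z \<in> Z \<Longrightarrow> poly p z = b z"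
    using degree_lagrange_poly[OF Z(1), of b] poly_lagrange_poly[OF Z(1)] Z m by (auto simp: p_def)
  obtain R0 where R0: "\<And>z. z \<in> Z \<Longrightarrow> \<bar>z\<bar> \<le> R0"
    using finite_imp_bounded[OF Z(1)] by (auto simp: bounded_iff)
  \<comment> \<open>The zeros and the point lie in an interval of length 2 max r R0; the added 1
    makes the base at least 1, so that the exponent m serves every order.\<close>
  define \<beta> where "\<beta> = (\<lambda>r. K * (1 + 2 * max r R0) ^ m)"
  have Z0: "0 \<le> R0"
  proof -
    have "Z \<noteq> {}" using Z m by auto
    then show ?thesis using R0 by (meson abs_ge_zero all_not_in_conv order_trans)
  qed
  have \<beta>_mono: "\<beta> r \<le> \<beta> s" if "r \<le> s" for r s
    unfolding \<beta>_def using \<open>0 \<le> K\<close> Z0 that by (intro mult_left_mono power_mono) auto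
  have \<beta>_nonneg: "0 \<le> \<beta> r" for r
    unfolding \<beta>_def using \<open>0 \<le> K\<close> Z0 by (intro mult_nonneg_nonneg zero_le_power) auto
  define Q where "Q = {g :: nat \<times> real \<Rightarrow> real. \<forall>q. \<bar>g q\<bar> \<le> \<beta> \<bar>snd q\<bar>}"
  \<comment> \<open>The remainder is bounded through a Lipschitz constant of the next derivative:
    \<open>\<beta>\<close> if a further derivative exists, K at order m - 1, so the sum covers both
    cases. Each condition involves finitely many coordinates and is closed.\<close>
  define T where "T = {g :: nat \<times> real \<Rightarrow> real.
     (\<forall>k x y. k < m - 1 \<longrightarrow> \<bar>g (k, y) - g (k, x) - g (Suc k, x) * (y - x)\<bar> \<le> (\<beta> (max \<bar>x\<bar> \<bar>y\<bar>) + K) * (y - x)\<^sup>2) \<and>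
     (\<forall>x y. \<bar>g (m - 1, x) - g (m - 1, y)\<bar> \<le> K * \<bar>x - y\<bar>)}"
  define A where "A = (\<lambda>j. {g :: nat \<times> real \<Rightarrow> real. P j (\<lambda>x. g (0, x) + poly p x)})"
  have coord: "continuous_on UNIV (\<lambda>g. g q)" for q :: "nat \<times> real"
    by (rule continuous_on_product_coordinates)
  have "closed T"
    unfolding T_def
    by (intro closed_Collect_conj closed_Collect_all closed_Collect_imp open_Collect_const closed_Collect_le
        continuous_intros coord)
  moreover have "compact Q"
    unfolding Q_def by (rule compact_bounded_functions)
  ultimately have QT: "compact (Q \<inter> T)" by (intro compact_Int_closed)
  have closedA: "closed (A j)" if "j \<in> J" for j
  proof -
    have "continuous_on UNIV (\<lambda>g x. g (0::nat, x) + poly p x)"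
      by (intro continuous_on_coordinatewise_then_product continuous_intros coord)
    then have "closed ((\<lambda>g x. g (0::nat, x) + poly p x) -` {F. P j F})"
      by (rule closed_vimage[OF closed[OF that]])
    then show ?thesis by (simp add: A_def vimage_def)
  qed
  have "Q \<inter> T \<inter> \<Inter>(A ` J) \<noteq> {}"
  proof (rule compact_imp_fip[OF QT])
    show "closed C" if "C \<in> A ` J" for C using that closedA by blast
    fix \<F> assume \<F>: "finite \<F>" "\<F> \<subseteq> A ` J"
    then obtain J' where J': "finite J'" "J' \<subseteq> J" "\<F> = A ` J'" by (meson finite_subset_image)
    obtain F where F: "smooth_lipschitz m K F" "\<forall>z\<in>Z. F z = b z" "\<forall>j\<in>J'. P j F"
      using ex[OF J'(1,2)] by blast
    define H where "H = (\<lambda>x. F x + (- 1) * poly p x)"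
    have H: "smooth_lipschitz m K H"
      using smooth_lipschitz_add[OF F(1) smooth_lipschitz_cmult[OF smooth_lipschitz_poly_less[OF p(1)], of "- 1"]]
      by (simp add: H_def)
    have bound: "\<bar>(deriv ^^ k) H x\<bar> \<le> \<beta> r" if "k < m" "\<bar>x\<bar> \<le> r" for k x r
    proof -
      define r' where "r' = max r R0"
      have "\<bar>(deriv ^^ k) H x\<bar> \<le> K * (r' - - r') ^ (m - k)"
        by (rule smooth_lipschitz_zeros_bound[OF H \<open>0 \<le> K\<close> Z])
           (use R0 F(2) p(2) that in \<open>fastforce simp: H_def r'_def abs_le_iff\<close>)+
      also have "\<dots> \<le> K * (1 + 2 * r') ^ (m - k)"
        using \<open>0 \<le> K\<close> Z0 by (intro mult_left_mono power_mono) (auto simp: r'_def)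
      also have "\<dots> \<le> K * (1 + 2 * r') ^ m"
        using \<open>0 \<le> K\<close> Z0 by (intro mult_left_mono power_increasing) (auto simp: r'_def)
      finally show ?thesis by (simp add: \<beta>_def r'_def)
    qed
    \<comment> \<open>Coordinates of order m and above are set to 0, since a point of Q needs a
      value at every index.\<close>
    define g where "g = (\<lambda>(k, x). if k < m then (deriv ^^ k) H x else 0)"
    have "g \<in> Q"
      unfolding Q_def g_def using bound \<beta>_nonneg by auto
    moreover have "g \<in> T"
      unfolding T_def
    proof (intro CollectI conjI allI impI)
      fix x y
      show "\<bar>g (m - 1, x) - g (m - 1, y)\<bar> \<le> K * \<bar>x - y\<bar>"
        using smooth_lipschitzD(2)[OF H, of x y] m by (simp add: g_def)
    next
      fix k :: nat and x y :: real assume k: "k < m - 1"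
      define r where "r = max \<bar>x\<bar> \<bar>y\<bar>"
      have xy: "x \<in> {- r..r}" "y \<in> {- r..r}" by (auto simp: r_def)
      have lip: "\<bar>(deriv ^^ Suc k) H u - (deriv ^^ Suc k) H v\<bar> \<le> (\<beta> r + K) * \<bar>u - v\<bar>"
        if "u \<in> {- r..r}" "v \<in> {- r..r}" for u v
      proof (cases "Suc k = m - 1")
        case True
        have "\<bar>(deriv ^^ Suc k) H u - (deriv ^^ Suc k) H v\<bar> \<le> K * \<bar>u - v\<bar>"
          unfolding True by (rule smooth_lipschitzD(2)[OF H])
        also have "\<dots> \<le> (\<beta> r + K) * \<bar>u - v\<bar>"
          using \<beta>_nonneg by (intro mult_right_mono) auto
        finally show ?thesis .
      next
        case False
        then have k2: "Suc k < m - 1" using k by simp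
        have "norm ((deriv ^^ Suc k) H u - (deriv ^^ Suc k) H v) \<le> \<beta> r * norm (u - v)"
        proof (rule field_differentiable_bound[of "{- r..r}" _ "(deriv ^^ Suc (Suc k)) H"])
          show "((deriv ^^ Suc k) H has_field_derivative (deriv ^^ Suc (Suc k)) H z) (at z within {- r..r})" for z
            using smooth_lipschitzD(1)[OF H k2] by (rule has_field_derivative_at_within)
          show "norm ((deriv ^^ Suc (Suc k)) H z) \<le> \<beta> r" if "z \<in> {- r..r}" for z
            unfolding real_norm_def by (rule bound) (use that k2 in auto)
        qed (use that in auto)
        also have "\<dots> \<le> (\<beta> r + K) * \<bar>u - v\<bar>"
          using \<open>0 \<le> K\<close> by (simp add: mult_right_mono)
        finally show ?thesis by simp
      qed
      have "norm ((\<lambda>z. (deriv ^^ k) H z - (deriv ^^ Suc k) H x * z) y - (\<lambda>z. (deriv ^^ k) H z - (deriv ^^ Suc k) H x * z) x)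
          \<le> ((\<beta> r + K) * \<bar>y - x\<bar>) * norm (y - x)"
      proof (rule field_differentiable_bound[of "closed_segment x y" _ "\<lambda>z. (deriv ^^ Suc k) H z - (deriv ^^ Suc k) H x"])
        show "((\<lambda>z. (deriv ^^ k) H z - (deriv ^^ Suc k) H x * z) has_field_derivative
            (deriv ^^ Suc k) H z - (deriv ^^ Suc k) H x) (at z within closed_segment x y)" for z
          by (rule has_field_derivative_at_within)
             (auto intro!: derivative_eq_intros smooth_lipschitzD(1)[OF H k] simp del: funpow.simps)
        show "norm ((deriv ^^ Suc k) H z - (deriv ^^ Suc k) H x) \<le> (\<beta> r + K) * \<bar>y - x\<bar>" if "z \<in> closed_segment x y" for z
        proof -
          have z: "z \<in> {- r..r}" "\<bar>z - x\<bar> \<le> \<bar>y - x\<bar>"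
            using that xy by (auto simp: closed_segment_eq_real_ivl split: if_splits)
          have "norm ((deriv ^^ Suc k) H z - (deriv ^^ Suc k) H x) \<le> (\<beta> r + K) * \<bar>z - x\<bar>"
            unfolding real_norm_def by (rule lip[OF z(1) xy(1)])
          also have "\<dots> \<le> (\<beta> r + K) * \<bar>y - x\<bar>"
            using z \<beta>_nonneg[of r] \<open>0 \<le> K\<close> by (intro mult_left_mono) auto
          finally show ?thesis .
        qed
      qed auto
      moreover have "(\<beta> r + K) * \<bar>y - x\<bar> * norm (y - x) = (\<beta> r + K) * (y - x)\<^sup>2"
        by (simp add: power2_eq_square mult.assoc)
      moreover have "g (k, y) - g (k, x) - g (Suc k, x) * (y - x)
          = (\<lambda>z. (deriv ^^ k) H z - (deriv ^^ Suc k) H x * z) y - (\<lambda>z. (deriv ^^ k) H z - (deriv ^^ Suc k) H x * z) x"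
      proof -
        have "g (k, z) = (deriv ^^ k) H z" "g (Suc k, z) = (deriv ^^ Suc k) H z" for z
          using k by (simp_all add: g_def)
        then show ?thesis by (simp only: right_diff_distrib)
      qed
      ultimately show "\<bar>g (k, y) - g (k, x) - g (Suc k, x) * (y - x)\<bar> \<le> (\<beta> (max \<bar>x\<bar> \<bar>y\<bar>) + K) * (y - x)\<^sup>2"
        by (simp only: real_norm_def r_def)
    qed
    moreover have "g \<in> \<Inter>\<F>"
      using F(3) m unfolding J'(3) A_def g_def H_def by auto
    ultimately show "Q \<inter> T \<inter> \<Inter>\<F> \<noteq> {}" by blast
  qed
  then obtain g where g: "g \<in> T" "\<And>j. j \<in> J \<Longrightarrow> P j (\<lambda>x. g (0, x) + poly p x)"
    unfolding A_def by blast
  define G where "G = (\<lambda>k x. g (k, x))"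
  have "smooth_lipschitz m K (G 0)"
  proof (rule smooth_lipschitz_chain)
    fix k x assume k: "k < m - 1"
    show "(G k has_real_derivative G (Suc k) x) (at x)"
    proof (rule has_real_derivative_if_quadratic_remainder[of _ _ _ "\<beta> (\<bar>x\<bar> + 1) + K"])
      fix y :: real assume y: "\<bar>y - x\<bar> < 1"
      have "\<bar>g (k, y) - g (k, x) - g (Suc k, x) * (y - x)\<bar> \<le> (\<beta> (max \<bar>x\<bar> \<bar>y\<bar>) + K) * (y - x)\<^sup>2"
        using g(1) k unfolding T_def by blast
      also have "\<dots> \<le> (\<beta> (\<bar>x\<bar> + 1) + K) * (y - x)\<^sup>2"
        using y by (intro mult_right_mono add_right_mono \<beta>_mono) auto
      finally show "\<bar>G k y - G k x - G (Suc k) x * (y - x)\<bar> \<le> (\<beta> (\<bar>x\<bar> + 1) + K) * (y - x)\<^sup>2"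
        by (simp add: G_def)
    qed
  next
    show "\<bar>G (m - 1) x - G (m - 1) y\<bar> \<le> K * \<bar>x - y\<bar>" for x y
      using g(1) unfolding T_def G_def by blast
  qed
  from smooth_lipschitz_add[OF this smooth_lipschitz_poly_less[OF p(1)]]
  have "smooth_lipschitz m K (\<lambda>x. g (0, x) + poly p x)" by (simp add: G_def)
  then show ?thesis using g(2) by blast
qed

lemma closed_point_condition: "closed {F :: real \<Rightarrow> real. F x = c}"
  by (rule closed_Collect_eq) (intro continuous_on_product_coordinates continuous_on_const)+

text \<open>Compactness over the finite subsets of E. Joining Y to each of them guarantees the m + 1
  points that the finite case requires, and m points of Y are the anchors Z.\<close>

lemma closed_set_extension:
  assumes m: "1 \<le> m" and E: "infinite E \<or> m + 1 \<le> card E" and "0 \<le> A"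
    and dd: "\<And>S. S \<subseteq> E \<Longrightarrow> card S = m + 1 \<Longrightarrow> fact m * \<bar>divided_difference S f\<bar> \<le> A"
  shows "\<exists>F. smooth_lipschitz m (extension_bound m * A) F \<and> (\<forall>x\<in>E. F x = f x)"
proof -
  obtain Y where Y: "Y \<subseteq> E" "finite Y" "card Y = m + 1"
    using E by (meson obtain_subset_with_card_n infinite_arbitrarily_large)
  obtain Z where Z: "Z \<subseteq> Y" "card Z = m" "finite Z"
    using obtain_subset_with_card_n[of m Y] Y by (metis finite_subset le_add1)
  show ?thesis
  proof (rule smooth_lipschitz_compactness[OF m _ Z(3,2), where P="\<lambda>e F. F e = f e" and b=f])
    show "0 \<le> extension_bound m * A" using extension_bound_pos[of m] \<open>0 \<le> A\<close> by simp
    fix J' assume J': "finite J'" "J' \<subseteq> E"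
    have "\<exists>F. smooth_lipschitz m (extension_bound m * A) F \<and> (\<forall>x\<in>J' \<union> Y. F x = f x)"
    proof (rule finite_set_interpolation[OF m _ _ \<open>0 \<le> A\<close>])
      show "m + 1 \<le> card (J' \<union> Y)"
        using card_mono[of "J' \<union> Y" Y] J' Y by simp
      show "fact m * \<bar>divided_difference S f\<bar> \<le> A" if "S \<subseteq> J' \<union> Y" "card S = m + 1" for S
        using dd[of S] that J' Y by blast
    qed (use J' Y in auto)
    then show "\<exists>F. smooth_lipschitz m (extension_bound m * A) F \<and> (\<forall>z\<in>Z. F z = f z) \<and> (\<forall>j\<in>J'. F j = f j)"
      using Z by blast
  qed (rule closed_point_condition)
qed

lemma finiteness_constant_extension_bound:
  assumes m: "1 \<le> m"
  shows "finiteness_constant m (extension_bound m)"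
  unfolding finiteness_constant_def
proof (intro conjI allI impI)
  show "0 < extension_bound m" by (rule extension_bound_pos)
  fix E f assume E: "closed E \<and> (infinite E \<or> m + 1 \<le> card E) \<and> f \<in> trace_space m E"
  define \<S> where "\<S> = {S. S \<subseteq> E \<and> card S = m + 1}"
  have tr: "trace_seminorm m S f = ereal (fact m * \<bar>divided_difference S f\<bar>)" if "S \<in> \<S>" for S
    using that m by (intro trace_seminorm_card_Suc) (auto simp: \<S>_def intro: card_ge_0_finite)
  obtain Y where Y: "Y \<subseteq> E" "card Y = m + 1"
    using E by (meson obtain_subset_with_card_n infinite_arbitrarily_large)
  then have "Y \<in> \<S>" by (simp add: \<S>_def)
  define s where "s = (SUP S\<in>\<S>. trace_seminorm m S f)"
  have le: "ereal (fact m * \<bar>divided_difference S f\<bar>) \<le> s" if "S \<in> \<S>" for S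
    unfolding s_def tr[OF that, symmetric] by (rule SUP_upper[OF that])
  have s0: "0 \<le> s" by (rule order_trans[OF _ le[OF \<open>Y \<in> \<S>\<close>]]) simp
  have "trace_seminorm m E f \<le> ereal (extension_bound m) * s"
  proof (cases s)
    case (real A)
    then have "\<exists>F. smooth_lipschitz m (extension_bound m * A) F \<and> (\<forall>x\<in>E. F x = f x)"
      using le s0 E by (intro closed_set_extension[OF m]) (auto simp: \<S>_def)
    then obtain F where F: "smooth_lipschitz m (extension_bound m * A) F" "\<forall>x\<in>E. F x = f x" by blast
    then have "trace_seminorm m E f \<le> ereal (extension_bound m * A)"
      using real s0 extension_bound_pos[of m] F(2) by (intro trace_seminorm_le[OF m _ F(1)]) auto
    then show ?thesis by (simp add: real)
  qed (use s0 extension_bound_pos[of m] in auto)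
  then show "trace_seminorm m E f \<le> ereal (extension_bound m) *
      (SUP S\<in>{S. S \<subseteq> E \<and> card S = m + 1}. trace_seminorm m S f)"
    by (simp add: s_def \<S>_def)
qed

lemma gamma_sharp_le_extension_bound:
  assumes "1 \<le> m"
  shows "gamma_sharp m \<le> ereal (extension_bound m)"
  unfolding gamma_sharp_def using finiteness_constant_extension_bound[OF assms] by (intro Inf_lower) auto

section \<open>Lower bounds\<close>

text \<open>Writing \<open>T = \<pi> cot(\<pi> x) H\<^sup>2\<close>, one has \<open>H'\<^sup>2 - \<pi>\<^sup>2 H\<^sup>2 = (H' - \<pi> cot(\<pi> x) H)\<^sup>2 + T'\<close>, and \<open>T\<close> vanishes at
  both ends.\<close>

lemma Wirtinger_unit_interval:
  fixes H H' :: "real \<Rightarrow> real"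
  assumes d: "\<And>x. (H has_real_derivative H' x) (at x)" and c': "continuous_on UNIV H'"
    and "H 0 = 0" "H 1 = 0"
  shows "pi\<^sup>2 * integral {0..1} (\<lambda>x. (H x)\<^sup>2) \<le> integral {0..1} (\<lambda>x. (H' x)\<^sup>2)"
proof -
  have c: "continuous_on A H" for A
    using d by (meson DERIV_continuous_on has_field_derivative_at_within)
  have c'A: "continuous_on A H'" for A using c' continuous_on_subset by blast
  define p where "p = (\<lambda>x. (H' x)\<^sup>2 - pi\<^sup>2 * (H x)\<^sup>2)"
  have cp: "continuous_on A p" for A unfolding p_def by (intro continuous_intros c c'A)
  have int: "p integrable_on {a..b}" for a b by (intro integrable_continuous_real cp)
  obtain M where "\<forall>x\<in>{0..1}. \<bar>H' x\<bar> \<le> M"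
    using compact_imp_bounded[OF compact_continuous_image[OF c'A compact_Icc, of 0 1]]
    by (auto simp: bounded_iff)
  then have M: "\<bar>H' x\<bar> \<le> M" if "x \<in> {0..1}" for x using that by blast
  obtain B where "\<forall>x\<in>{0..1}. \<bar>p x\<bar> \<le> B"
    using compact_imp_bounded[OF compact_continuous_image[OF cp compact_Icc, of 0 1]]
    by (auto simp: bounded_iff)
  then have B: "\<bar>p x\<bar> \<le> B" if "x \<in> {0..1}" for x using that by blast
  have B0: "0 \<le> B" using B[of 0] by simp
  have lip: "\<bar>H x - H y\<bar> \<le> M * \<bar>x - y\<bar>" if "x \<in> {0..1}" "y \<in> {0..1}" for x y
  proof -
    have "norm (H x - H y) \<le> M * norm (x - y)"
      by (rule field_differentiable_bound[of "{0..1}" H H']) (use that M d in \<open>auto intro: has_field_derivative_at_within\<close>)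
    then show ?thesis by simp
  qed
  \<comment> \<open>Jordan's inequality, from the concavity of the sine; it bounds the cotangent by
    1 / (2 a) at distance a from either end.\<close>
  have sin_ge: "2 * a \<le> sin (pi * a)" if "0 \<le> a" "a \<le> 1 / 2" for a
  proof -
    have "concave_on {0..pi} sin" 
      by (rule f''_le0_imp_concave[where f'=cos and f''="\<lambda>x. - sin x"]) (auto intro!: derivative_eq_intros sin_ge_zero)
    from concave_onD[OF this, of "2 * a" 0 "pi / 2"] that show ?thesis
      by (simp add: field_simps)
  qed
  define \<Theta> where "\<Theta> = (\<lambda>x. pi * cot (pi * x) * (H x)\<^sup>2)"
  \<comment> \<open>H vanishes linearly at both ends, so its square beats the simple pole of the
    cotangent.\<close>
  have \<Theta>_bound: "\<bar>pi * cot (pi * x) * (H x)\<^sup>2\<bar> \<le> pi * M\<^sup>2 * a"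
    if a: "0 < a" "a < 1 / 2" and x: "x = a \<or> x = 1 - a" for a x
  proof -
    have "sin (pi * x) = sin (pi * a)"
      using x sin_pi_minus[of "pi * a"] by (auto simp: right_diff_distrib)
    then have s: "2 * a \<le> \<bar>sin (pi * x)\<bar>" using sin_ge[of a] a by auto
    have "\<bar>H x\<bar> \<le> M * a"
      using lip[of a 0] lip[of "1 - a" 1] a x assms(3,4) by auto
    then have H: "(H x)\<^sup>2 \<le> (M * a)\<^sup>2" by (metis abs_ge_zero power2_abs power_mono)
    have "\<bar>cot (pi * x)\<bar> \<le> 1 / (2 * a)"
      unfolding cot_def abs_divide using s a by (intro frac_le) auto
    then have "\<bar>pi * cot (pi * x) * (H x)\<^sup>2\<bar> \<le> pi * (1 / (2 * a)) * (M * a)\<^sup>2"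
      unfolding abs_mult using H a by (intro mult_mono) auto
    also have "\<dots> = pi * M\<^sup>2 * a / 2" using a by (simp add: power2_eq_square)
    also have "\<dots> \<le> pi * M\<^sup>2 * a" using a by simp
    finally show ?thesis .
  qed
  \<comment> \<open>The identity is integrated over [a, 1 - a] only, away from the poles; the
    boundary terms and the two end strips cost a multiple of a, which is then made small.\<close>
  have key: "- (2 * pi * M\<^sup>2 + 2 * B) * a \<le> integral {0..1} p" if a: "0 < a" "a < 1 / 2" for a
  proof -
    let ?\<Theta>' = "\<lambda>x. p x - (H' x - pi * cot (pi * x) * H x)\<^sup>2"
    have "(?\<Theta>' has_integral \<Theta> (1 - a) - \<Theta> a) {a..1 - a}"
    proof (rule fundamental_theorem_of_calculus)
      fix x assume x: "x \<in> {a..1 - a}"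
      have "sin (pi * x) > 0" using x a by (intro sin_gt_zero) auto
      then have s: "sin (pi * x) \<noteq> 0" by simp
      have cs: "inverse ((sin (pi * x))\<^sup>2) = 1 + (cot (pi * x))\<^sup>2"
        using s sin_cos_squared_add[of "pi * x"] by (simp add: cot_def field_simps)
      have "((\<lambda>x. pi * x) has_real_derivative pi) (at x)" by (auto intro!: derivative_eq_intros)
      from DERIV_chain2[OF DERIV_cot[OF s] this]
      have dcot: "((\<lambda>x. cot (pi * x)) has_real_derivative - (1 + (cot (pi * x))\<^sup>2) * pi) (at x)"
        by (simp only: cs)
      have dH: "((\<lambda>x. (H x)\<^sup>2) has_real_derivative 2 * H x * H' x) (at x)"
        by (auto intro!: derivative_eq_intros d)
      from DERIV_mult[OF DERIV_cmult[OF dcot, of pi] dH]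
      have "(\<Theta> has_real_derivative ?\<Theta>' x) (at x)"
        unfolding \<Theta>_def p_def
        by (rule DERIV_cong) (simp add: power2_eq_square algebra_simps)
      then show "(\<Theta> has_vector_derivative ?\<Theta>' x) (at x within {a..1 - a})"
        by (simp add: has_real_derivative_iff_has_vector_derivative has_vector_derivative_at_within)
    qed (use a in auto)
    then have "\<Theta> (1 - a) - \<Theta> a \<le> integral {a..1 - a} p"
      by (rule has_integral_le[OF _ integrable_integral[OF int]]) simp
    moreover have "\<bar>\<Theta> (1 - a)\<bar> \<le> pi * M\<^sup>2 * a" "\<bar>\<Theta> a\<bar> \<le> pi * M\<^sup>2 * a"
      unfolding \<Theta>_def using \<Theta>_bound[OF a] by auto
    moreover have "integral {0..1} p = integral {0..a} p + integral {a..1 - a} p + integral {1 - a..1} p"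
      using a int by (simp add: Henstock_Kurzweil_Integration.integral_combine)
    moreover have "\<bar>integral {0..a} p\<bar> \<le> B * a" "\<bar>integral {1 - a..1} p\<bar> \<le> B * a"
      using integral_bound[of 0 a p B] integral_bound[of "1 - a" 1 p B] B a cp by auto
    ultimately show ?thesis by (simp add: algebra_simps)
  qed
  have "0 \<le> integral {0..1} p"
  proof (rule ccontr)
    assume "\<not> 0 \<le> integral {0..1} p"
    then have neg: "integral {0..1} p < 0" by simp
    define C where "C = 2 * pi * M\<^sup>2 + 2 * B + 1"
    have C: "C > 0" using B0 by (simp add: C_def add_nonneg_pos)
    define a where "a = min (1 / 4) (- integral {0..1} p / (2 * C))"
    have a: "0 < a" "a < 1 / 2" using neg C by (auto simp: a_def min_def divide_neg_pos)
    have "C * a \<le> - integral {0..1} p / 2"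
    proof -
      have "C * a \<le> C * (- integral {0..1} p / (2 * C))" using C by (intro mult_left_mono) (auto simp: a_def)
      then show ?thesis using C by simp
    qed
    moreover have "- C * a \<le> - (2 * pi * M\<^sup>2 + 2 * B) * a"
      unfolding C_def using a by (intro mult_right_mono) auto
    ultimately show False using key[OF a] neg by simp
  qed
  moreover have "integral {0..1} p = integral {0..1} (\<lambda>x. (H' x)\<^sup>2) - pi\<^sup>2 * integral {0..1} (\<lambda>x. (H x)\<^sup>2)"
    unfolding p_def
    by (subst integral_diff) (auto intro!: integrable_continuous_real continuous_intros c c'A)
  ultimately show ?thesis by simp
qed

section \<open>Integral inequalities for antiperiodic functions\<close>

lemma integral_periodic_shift:
  fixes h :: "real \<Rightarrow> real"
  assumes c: "continuous_on UNIV h" and per: "\<And>x. h (x + 1) = h x" and "0 \<le> a" "a \<le> 1"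
  shows "integral {0..1} (\<lambda>x. h (x + a)) = integral {0..1} h"
proof -
  have cA: "continuous_on A h" for A using c continuous_on_subset by blast
  have int: "h integrable_on {u..v}" for u v by (intro integrable_continuous_real cA)
  have "integral {0..1} (h \<circ> (\<lambda>x. x + a)) = integral {0 + a..1 + a} h"
    by (rule integral_shift) (rule cA)
  moreover have "integral {0..a} (h \<circ> (\<lambda>x. x + 1)) = integral {0 + 1..a + 1} h"
    by (rule integral_shift) (rule cA)
  moreover have "integral {a..1 + a} h = integral {a..1} h + integral {1..1 + a} h"
    using assms(3,4) int by (simp add: Henstock_Kurzweil_Integration.integral_combine)
  moreover have "integral {0..1} h = integral {0..a} h + integral {a..1} h"
    using assms(3,4) int by (simp add: Henstock_Kurzweil_Integration.integral_combine)
  ultimately show ?thesis by (simp add: o_def per add.commute)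
qed

lemma antiperiodic_zero:
  fixes H :: "real \<Rightarrow> real"
  assumes "continuous_on UNIV H" "\<And>x. H (x + 1) = - H x"
  obtains c where "0 \<le> c" "c \<le> 1" "H c = 0"
proof -
  have H1: "H 1 = - H 0" using assms(2)[of 0] by simp
  have cont: "continuous_on {0..1} H" using assms(1) continuous_on_subset by blast
  consider "H 0 \<le> 0" | "0 \<le> H 0" by linarith
  then show thesis
  proof cases
    case 1
    then show thesis using IVT'[of H 0 0 1] cont H1 that by auto
  next
    case 2
    then show thesis using IVT2'[of H 1 0 0] cont H1 that by auto
  qed
qed

text \<open>An antiperiodic function has a zero; translating it to 0 puts another at 1, and the
  integrals of the squares, which have period 1, are unchanged by the translation.\<close>

lemma Wirtinger_antiperiodic:
  fixes H H' :: "real \<Rightarrow> real"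
  assumes d: "\<And>x. (H has_real_derivative H' x) (at x)" and c': "continuous_on UNIV H'"
    and anti: "\<And>x. H (x + 1) = - H x" and anti': "\<And>x. H' (x + 1) = - H' x"
  shows "pi\<^sup>2 * integral {0..1} (\<lambda>x. (H x)\<^sup>2) \<le> integral {0..1} (\<lambda>x. (H' x)\<^sup>2)"
proof -
  have c: "continuous_on UNIV H"
    using d by (meson DERIV_continuous_on has_field_derivative_at_within)
  obtain a where a: "0 \<le> a" "a \<le> 1" "H a = 0" using antiperiodic_zero[OF c anti] by blast
  have "pi\<^sup>2 * integral {0..1} (\<lambda>x. (H (x + a))\<^sup>2) \<le> integral {0..1} (\<lambda>x. (H' (x + a))\<^sup>2)"
  proof (rule Wirtinger_unit_interval)
    show "((\<lambda>x. H (x + a)) has_real_derivative H' (x + a)) (at x)" for x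
      using d[of "x + a"] by (simp add: DERIV_shift)
    show "continuous_on UNIV (\<lambda>x. H' (x + a))"
      by (rule continuous_on_compose2[OF c']) (auto intro!: continuous_intros)
    show "H (1 + a) = 0" using anti[of a] a by (simp add: add.commute)
  qed (use a in simp)
  moreover have "continuous_on UNIV (\<lambda>x. (H x)\<^sup>2)" "continuous_on UNIV (\<lambda>x. (H' x)\<^sup>2)"
    by (intro continuous_intros c c')+
  ultimately show ?thesis
    using integral_periodic_shift[of "\<lambda>x. (H x)\<^sup>2" a] integral_periodic_shift[of "\<lambda>x. (H' x)\<^sup>2" a] a anti anti'
    by simp
qed

text \<open>Between two zeros at distance 1 the function is at most K times the distance to the
  nearer one, and twice the integral of K^2 x^2 over [0, 1/2] is K^2 / 12. This takes the place of a
  Wirtinger step at order m - 1, where only a Lipschitz bound is at hand.\<close>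

lemma integral_square_antiperiodic_lipschitz:
  fixes H :: "real \<Rightarrow> real"
  assumes lip: "\<And>x y. \<bar>H x - H y\<bar> \<le> K * \<bar>x - y\<bar>" and anti: "\<And>x. H (x + 1) = - H x"
  shows "integral {0..1} (\<lambda>x. (H x)\<^sup>2) \<le> K\<^sup>2 / 12"
proof -
  have "K-lipschitz_on UNIV H"
    using lip[of 1 0] lip by (auto intro!: lipschitz_onI simp: dist_real_def)
  then have c: "continuous_on UNIV H" by (rule lipschitz_on_continuous_on)
  obtain a where a: "0 \<le> a" "a \<le> 1" "H a = 0" using antiperiodic_zero[OF c anti] by blast
  have a1: "H (1 + a) = 0" using anti[of a] a by (simp add: add.commute)
  define g where "g = (\<lambda>x. (H (x + a))\<^sup>2)"
  have cg: "continuous_on A g" for A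
    unfolding g_def by (intro continuous_intros continuous_on_compose2[OF c]) auto
  have K: "0 \<le> K" using lip[of 1 0] by simp
  have g1: "g x \<le> K\<^sup>2 * x\<^sup>2" for x
  proof -
    have "\<bar>H (x + a)\<bar> \<le> K * \<bar>x\<bar>" using lip[of "x + a" a] a by simp
    then have "\<bar>H (x + a)\<bar>\<^sup>2 \<le> (K * \<bar>x\<bar>)\<^sup>2" by (intro power_mono) auto
    then show ?thesis by (simp add: g_def power_mult_distrib)
  qed
  have g2: "g x \<le> K\<^sup>2 * (x - 1)\<^sup>2" for x
  proof -
    have "\<bar>H (x + a)\<bar> \<le> K * \<bar>x - 1\<bar>" using lip[of "x + a" "1 + a"] a1 by simp
    then have "\<bar>H (x + a)\<bar>\<^sup>2 \<le> (K * \<bar>x - 1\<bar>)\<^sup>2" by (intro power_mono) auto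
    then show ?thesis by (simp add: g_def power_mult_distrib)
  qed
  have i1: "((\<lambda>x. K\<^sup>2 * x\<^sup>2) has_integral (K\<^sup>2 * (1 / 2) ^ 3 / 3 - K\<^sup>2 * 0 ^ 3 / 3)) {0..1/2}"
    by (rule fundamental_theorem_of_calculus)
       (auto intro!: derivative_eq_intros simp: has_real_derivative_iff_has_vector_derivative[symmetric] power2_eq_square)
  have i2: "((\<lambda>x. K\<^sup>2 * (x - 1)\<^sup>2) has_integral (K\<^sup>2 * (1 - 1) ^ 3 / 3 - K\<^sup>2 * (1 / 2 - 1) ^ 3 / 3)) {1/2..1}"
    by (rule fundamental_theorem_of_calculus)
       (auto intro!: derivative_eq_intros simp: has_real_derivative_iff_has_vector_derivative[symmetric] power2_eq_square)
  have int: "g integrable_on {u..v}" for u v by (intro integrable_continuous_real cg)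
  have "integral {0..1/2} g \<le> K\<^sup>2 / 24"
    using has_integral_le[OF integrable_integral[OF int] i1 g1] by (simp add: power3_eq_cube)
  moreover have "integral {1/2..1} g \<le> K\<^sup>2 / 24"
    using has_integral_le[OF integrable_integral[OF int] i2 g2] by (simp add: power3_eq_cube)
  moreover have "integral {0..1} g = integral {0..1/2} g + integral {1/2..1} g"
    using int by (simp add: Henstock_Kurzweil_Integration.integral_combine)
  ultimately have "integral {0..1} g \<le> K\<^sup>2 / 12" by simp
  moreover have "integral {0..1} g = integral {0..1} (\<lambda>x. (H x)\<^sup>2)"
    unfolding g_def using a c anti by (intro integral_periodic_shift) (auto intro!: continuous_intros)
  ultimately show ?thesis by simp
qed

text \<open>The difference of the two sides is a variance.\<close>

lemma square_integral_le:
  fixes f :: "real \<Rightarrow> real"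
  assumes c: "continuous_on {0..1} f"
  shows "(integral {0..1} f)\<^sup>2 \<le> integral {0..1} (\<lambda>x. (f x)\<^sup>2)"
proof -
  define \<mu> where "\<mu> = integral {0..1} f"
  have "0 \<le> integral {0..1} (\<lambda>x. (f x - \<mu>)\<^sup>2)"
    by (rule integral_nonneg) (auto intro!: integrable_continuous_real continuous_intros c)
  also have "integral {0..1} (\<lambda>x. (f x - \<mu>)\<^sup>2) = integral {0..1} (\<lambda>x. (f x)\<^sup>2 - (2 * \<mu> * f x - \<mu>\<^sup>2))"
    by (simp add: power2_eq_square algebra_simps)
  also have "\<dots> = integral {0..1} (\<lambda>x. (f x)\<^sup>2) - integral {0..1} (\<lambda>x. 2 * \<mu> * f x - \<mu>\<^sup>2)"
    by (rule integral_diff) (auto intro!: integrable_continuous_real continuous_intros c)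
  also have "integral {0..1} (\<lambda>x. 2 * \<mu> * f x - \<mu>\<^sup>2) = integral {0..1} (\<lambda>x. 2 * \<mu> * f x) - integral {0..1::real} (\<lambda>x. \<mu>\<^sup>2)"
    by (rule integral_diff) (auto intro!: integrable_continuous_real continuous_intros c)
  also have "\<dots> = \<mu>\<^sup>2" by (simp add: \<mu>_def power2_eq_square)
  finally show ?thesis by (simp add: \<mu>_def)
qed

text \<open>Each derivative multiplies by pi and advances the phase by pi / 2. This explicit
  extension of (-1)^n puts the data into the trace space.\<close>

lemma smooth_lipschitz_cos_pi: "smooth_lipschitz m (pi ^ m) (\<lambda>x. cos (pi * x))" if m: "1 \<le> m"
proof -
  define G where "G = (\<lambda>k x. pi ^ k * cos (pi * x + real k * (pi / 2)))"
  have d: "(G k has_real_derivative G (Suc k) x) (at x)" for k x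
  proof -
    have "cos (pi * x + real (Suc k) * (pi / 2)) = - sin (pi * x + real k * (pi / 2))"
    proof -
      have "pi * x + real (Suc k) * (pi / 2) = (pi * x + real k * (pi / 2)) + pi / 2"
        by (simp add: field_simps)
      then show ?thesis by (simp only: cos_add) simp
    qed
    then show ?thesis
      unfolding G_def by (auto intro!: derivative_eq_intros)
  qed
  have cont: "continuous_on UNIV (G k)" for k
    unfolding G_def by (intro continuous_intros)
  have "smooth_lipschitz m (pi ^ m) (G 0)"
  proof (rule smooth_lipschitz_chain)
    show "\<bar>G (m - 1) x - G (m - 1) y\<bar> \<le> pi ^ m * \<bar>x - y\<bar>" for x y
    proof (rule lipschitz_if_derivative_bound_off_finite[of "{}" _ _ "G m"])
      show "(G (m - 1) has_real_derivative G m x) (at x)" for x using d[of "m - 1" x] m by simp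
      show "\<bar>G m x\<bar> \<le> pi ^ m" for x
      proof -
        have "\<bar>G m x\<bar> = pi ^ m * \<bar>cos (pi * x + real m * (pi / 2))\<bar>" by (simp add: G_def abs_mult)
        also have "\<dots> \<le> pi ^ m * 1" by (intro mult_left_mono) auto
        finally show ?thesis by simp
      qed
    qed (use cont in auto)
  qed (rule d)
  then show ?thesis by (simp add: G_def)
qed

section \<open>Antiperiodic interpolants by averaging translates\<close>

lemma smooth_lipschitz_shift:
  assumes "smooth_lipschitz m K F"
  shows "smooth_lipschitz m K (\<lambda>x. F (x + c))"
proof -
  define G where "G = (\<lambda>k x. (deriv ^^ k) F (x + c))"
  have "smooth_lipschitz m K (G 0)"
  proof (rule smooth_lipschitz_chain)
    show "(G k has_real_derivative G (Suc k) x) (at x)" if "k < m - 1" for k x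
      using smooth_lipschitzD(1)[OF assms that, of "x + c"] unfolding G_def by (simp only: DERIV_shift)
    show "\<bar>G (m - 1) x - G (m - 1) y\<bar> \<le> K * \<bar>x - y\<bar>" for x y
      using smooth_lipschitzD(2)[OF assms, of "x + c" "y + c"] by (simp add: G_def)
  qed
  then show ?thesis by (simp add: G_def)
qed

lemma smooth_lipschitz_sum:
  assumes "1 \<le> m" "\<And>i. i < N \<Longrightarrow> smooth_lipschitz m K (F i)"
  shows "smooth_lipschitz m (real N * K) (\<lambda>x. \<Sum>i<N. F i x)"
  using assms(2)
proof (induction N)
  case 0
  then show ?case using smooth_lipschitz_poly_less[of 0 m] assms(1) by (simp add: poly_0[abs_def])
next
  case (Suc N)
  have "smooth_lipschitz m (real N * K + K) (\<lambda>x. (\<Sum>i<N. F i x) + F N x)"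
    by (intro smooth_lipschitz_add Suc) simp_all
  then show ?case by (simp add: algebra_simps)
qed

lemma cos_pi_add_nat: "cos (pi * (x + real n)) = (- 1) ^ n * cos (pi * x)"
proof (induction n)
  case (Suc n)
  have "cos (pi * (x + real (Suc n))) = cos (pi * (x + real n) + pi)" by (simp add: algebra_simps)
  then show ?case using Suc by simp
qed simp

text \<open>After subtraction of cos (pi x) all integers are zeros, in particular the m integers
  from the floor of x on; since these move along with x, the bound is uniform. It makes the boundary
  terms of the averages negligible.\<close>

lemma alternating_interpolant_bounded:
  assumes m: "1 \<le> m" and "0 \<le> K" and F: "smooth_lipschitz m K F"
    and alt: "\<And>j::int. F (of_int j) = cos (pi * of_int j)"
  shows "\<bar>F x\<bar> \<le> 1 + (K + pi ^ m) * real m ^ m"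
proof -
  define G where "G = (\<lambda>x. F x + (- 1) * cos (pi * x))"
  have "smooth_lipschitz m (\<bar>- 1\<bar> * pi ^ m) (\<lambda>x. (- 1) * cos (pi * x))"
    by (rule smooth_lipschitz_cmult[OF smooth_lipschitz_cos_pi[OF m]])
  from smooth_lipschitz_add[OF F this] have G: "smooth_lipschitz m (K + pi ^ m) G"
    by (simp add: G_def)
  define lo where "lo = real_of_int \<lfloor>x\<rfloor>"
  define Z where "Z = (\<lambda>i::nat. lo + real i) ` {..<m}"
  have "\<bar>(deriv ^^ 0) G x\<bar> \<le> (K + pi ^ m) * (lo + real m - lo) ^ (m - 0)"
  proof (rule smooth_lipschitz_zeros_bound[OF G])
    show "card Z = m" unfolding Z_def by (subst card_image) (auto simp: inj_on_def)
    show "Z \<subseteq> {lo..lo + real m}" unfolding Z_def by auto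
    show "x \<in> {lo..lo + real m}" using m unfolding lo_def by auto linarith
    show "G z = 0" if z: "z \<in> Z" for z
    proof -
      obtain i where "z = of_int (\<lfloor>x\<rfloor> + int i)" using z by (auto simp: Z_def lo_def)
      then show ?thesis using alt by (simp only: G_def)
    qed
  qed (use m \<open>0 \<le> K\<close> in \<open>auto simp: Z_def\<close>)
  then have "\<bar>G x\<bar> \<le> (K + pi ^ m) * real m ^ m" by simp
  moreover have "F x = G x + cos (pi * x)" by (simp add: G_def)
  ultimately show ?thesis
    using abs_triangle_ineq[of "G x" "cos (pi * x)"] abs_cos_le_one[of "pi * x"] by linarith
qed

text \<open>Averages of the translates \<open>(- 1) ^ n * F (x + n)\<close> satisfy the same hypotheses as \<open>F\<close>; a pointwise
  cluster point of them is antiperiodic.\<close>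

lemma antiperiodic_interpolant:
  assumes m: "1 \<le> m" and "0 \<le> K" and F: "smooth_lipschitz m K F"
    and alt: "\<And>j::int. F (of_int j) = cos (pi * of_int j)"
  shows "\<exists>G. smooth_lipschitz m K G \<and> G 0 = 1 \<and> (\<forall>x. G (x + 1) = - G x)"
proof -
  define C where "C = 1 + (K + pi ^ m) * real m ^ m"
  have C: "\<bar>F x\<bar> \<le> C" for x unfolding C_def by (rule alternating_interpolant_bounded[OF assms])
  \<comment> \<open>Antiperiodicity up to 2 C / N is a closed condition that is weaker for smaller
    N, so finitely many such conditions follow from the one with the largest index.\<close>
  define P where "P = (\<lambda>(N::nat) G. G (0::real) = (1::real) \<and> (\<forall>x. \<bar>G (x + 1) + G x\<bar> \<le> 2 * C / real N))"
  define Z where "Z = real ` {..<m}"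
  have "\<exists>G. smooth_lipschitz m K G \<and> (\<forall>N\<in>{1..}. P N G)"
  proof (rule smooth_lipschitz_compactness[OF m \<open>0 \<le> K\<close>, of Z _ _ "\<lambda>x. cos (pi * x)"])
    show "finite Z" "card Z = m" by (auto simp: Z_def card_image)
    show "closed {G. P N G}" for N
      unfolding P_def
      by (intro closed_Collect_conj closed_Collect_all closed_Collect_le closed_Collect_eq
          continuous_intros continuous_on_product_coordinates)
    fix J' :: "nat set" assume J': "finite J'" "J' \<subseteq> {1..}"
    define N where "N = Max (insert 1 J')"
    have N: "1 \<le> N" "\<And>n. n \<in> J' \<Longrightarrow> n \<le> N" using J' by (auto simp: N_def)
    \<comment> \<open>The signs undo those of the data, so all translates interpolate the same
      values and so does their mean.\<close>
    define G where "G = (\<lambda>x. (1 / real N) * (\<Sum>n<N. (- 1) ^ n * F (x + real n)))"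
    have "smooth_lipschitz m K (\<lambda>x. (- 1) ^ n * F (x + real n))" for n
      using smooth_lipschitz_cmult[OF smooth_lipschitz_shift[OF F], of "(- 1) ^ n"] by (simp add: power_abs)
    from smooth_lipschitz_cmult[OF smooth_lipschitz_sum[OF m this, of N], of "1 / real N"]
    have G: "smooth_lipschitz m K G" using N by (simp add: G_def)
    have Gint: "G (real i) = cos (pi * real i)" for i
    proof -
      have "(- 1) ^ n * F (real i + real n) = cos (pi * real i)" for n
      proof -
        have "F (real i + real n) = F (of_int (int i + int n))" by simp
        also have "\<dots> = cos (pi * (real i + real n))" unfolding alt by simp
        also have "\<dots> = (- 1) ^ n * cos (pi * real i)" by (rule cos_pi_add_nat)
        finally show ?thesis by (simp add: mult.assoc[symmetric] power_mult_distrib[symmetric])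
      qed
      then show ?thesis using N by (simp add: G_def)
    qed
    have anti: "\<bar>G (x + 1) + G x\<bar> \<le> 2 * C / real N" for x
    proof -
      \<comment> \<open>Translation by 1 shifts this sequence with a sign, so the sum telescopes to
        two boundary terms, each at most C.\<close>
      define a where "a = (\<lambda>n. (- 1) ^ n * F (x + real n))"
      have aC: "\<bar>a n\<bar> \<le> C" for n using C by (simp add: a_def abs_mult power_abs)
      have "(- 1) ^ n * F (x + 1 + real n) = - a (Suc n)" for n by (simp add: a_def add_ac)
      then have "G (x + 1) + G x = (1 / real N) * ((\<Sum>n<N. - a (Suc n)) + (\<Sum>n<N. a n))"
        unfolding G_def a_def[symmetric] by (simp add: distrib_left)
      also have "(\<Sum>n<N. - a (Suc n)) + (\<Sum>n<N. a n) = - (\<Sum>n<N. a (Suc n) - a n)"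
        by (simp add: sum_negf sum_subtractf)
      also have "\<dots> = a 0 - a N" by (simp only: sum_lessThan_telescope minus_diff_eq)
      finally have "\<bar>G (x + 1) + G x\<bar> = (1 / real N) * \<bar>a 0 - a N\<bar>" by (simp add: abs_mult)
      also have "\<dots> \<le> (1 / real N) * (2 * C)"
        using aC[of 0] aC[of N] by (intro mult_left_mono) auto
      finally show ?thesis by simp
    qed
    have "P n G" if "n \<in> J'" for n
      unfolding P_def
    proof (intro conjI allI)
      show "G 0 = 1" using Gint[of 0] by simp
      have "0 \<le> C" using C[of 0] by linarith
      then have "2 * C / real N \<le> 2 * C / real n"
        using N that J' by (intro divide_left_mono) auto
      then show "\<bar>G (x + 1) + G x\<bar> \<le> 2 * C / real n" for x using anti[of x] by linarith
    qed
    then show "\<exists>G. smooth_lipschitz m K G \<and> (\<forall>z\<in>Z. G z = cos (pi * z)) \<and> (\<forall>j\<in>J'. P j G)"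
      using G Gint by (intro exI[of _ G]) (auto simp: Z_def)
  qed
  then obtain G where G: "smooth_lipschitz m K G" "\<And>N. 1 \<le> N \<Longrightarrow> P N G" by auto
  have "G (x + 1) = - G x" for x
  proof -
    have "\<bar>G (x + 1) + G x\<bar> \<le> 2 * C / real (Suc n)" for n
      using G(2)[of "Suc n"] by (simp add: P_def)
    moreover have "(\<lambda>n. 2 * C / real (Suc n)) \<longlonglongrightarrow> 0"
      by (rule LIMSEQ_Suc[OF lim_const_over_n])
    ultimately have "\<bar>G (x + 1) + G x\<bar> \<le> 0"
      using LIMSEQ_le_const by blast
    then show ?thesis by simp
  qed
  moreover have "G 0 = 1" using G(2)[of 1] by (simp add: P_def)
  ultimately show ?thesis using G(1) by blast
qed

section \<open>Divided differences on the integers\<close>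

lemma prod_abs_diff_index:
  assumes "i \<le> m"
  shows "(\<Prod>j\<in>{..m} - {i}. \<bar>real i - real j\<bar>) = fact i * fact (m - i)"
proof -
  have 1: "(\<Prod>j<i. \<bar>real i - real j\<bar>) = fact i"
  proof -
    have "(\<Prod>j<i. \<bar>real i - real j\<bar>) = (\<Prod>j<i. real (Suc (i - Suc j)))"
      by (intro prod.cong) auto
    also have "\<dots> = (\<Prod>k<i. real (Suc k))"
      using prod.nat_diff_reindex[of "\<lambda>k. real (Suc k)" i] .
    also have "\<dots> = fact i" by (simp add: fact_prod_Suc atLeast0LessThan)
    finally show ?thesis .
  qed
  have 2: "(\<Prod>j\<in>{i<..i + d}. \<bar>real i - real j\<bar>) = fact d" for d
  proof (induction d)
    case (Suc d)
    have "{i<..i + Suc d} = insert (i + Suc d) {i<..i + d}" by auto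
    then show ?case using Suc by (simp add: algebra_simps)
  qed simp
  have split: "{..m} - {i} = {..<i} \<union> {i<..i + (m - i)}" using assms by auto
  have "(\<Prod>j\<in>{..m} - {i}. \<bar>real i - real j\<bar>)
      = (\<Prod>j<i. \<bar>real i - real j\<bar>) * (\<Prod>j\<in>{i<..i + (m - i)}. \<bar>real i - real j\<bar>)"
    unfolding split by (rule prod.union_disjoint) auto
  then show ?thesis unfolding 1 2 .
qed

text \<open>The i-th and j-th smallest elements are at least |i - j| apart, so the i-th weight is at
  most 1 / (i! (m - i)!), its size for consecutive integers; multiplied by m! these sum to the
  binomial row 2^m.\<close>

lemma divided_difference_Ints_le:
  assumes S: "S \<subseteq> \<int>" "card S = m + 1" and f: "\<And>x. x \<in> S \<Longrightarrow> \<bar>f x\<bar> \<le> 1"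
  shows "fact m * \<bar>divided_difference S f\<bar> \<le> 2 ^ m"
proof -
  have fin: "finite S" using S(2) by (intro card_ge_0_finite) simp
  define t where "t = (\<lambda>i. sorted_list_of_set S ! i)"
  have len: "length (sorted_list_of_set S) = Suc m" using fin S by simp
  have t: "t i < t j" if "i < j" "j \<le> m" for i j
    unfolding t_def using strict_sorted_list_of_set[of S] len that by (auto simp: sorted_wrt_iff_nth_less)
  have "set (sorted_list_of_set S) = S" using fin by simp
  then have tS: "S = t ` {..m}"
    using len unfolding t_def by (metis atLeast0LessThan lessThan_Suc_atMost list.set_map map_nth set_upt)
  have inj: "inj_on t {..m}"
  proof (rule inj_onI)
    fix i j assume "i \<in> {..m}" "j \<in> {..m}" "t i = t j"
    then show "i = j" using t[of i j] t[of j i] by (cases i j rule: linorder_cases) auto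
  qed
  have step: "real d \<le> t (i + d) - t i" if "i + d \<le> m" for i d
    using that
  proof (induction d)
    case (Suc d)
    have "t (i + d) \<in> \<int>" "t (i + Suc d) \<in> \<int>" using S(1) tS Suc.prems by auto
    then obtain p q :: int where pq: "t (i + d) = of_int p" "t (i + Suc d) = of_int q" by (auto elim!: Ints_cases)
    have "t (i + d) < t (i + Suc d)" using t[of "i + d" "i + Suc d"] Suc.prems by simp
    then have "p + 1 \<le> q" unfolding pq by simp
    then have "t (i + d) + 1 \<le> t (i + Suc d)"
      unfolding pq by (metis of_int_1 of_int_add of_int_le_iff)
    then show ?case using Suc by simp
  qed simp
  have gap: "\<bar>real i - real j\<bar> \<le> \<bar>t i - t j\<bar>" if "i \<le> m" "j \<le> m" for i j
    using step[of i "j - i"] step[of j "i - j"] that by (cases "i \<le> j") auto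
  have term_le: "\<bar>f (t i) / (\<Prod>s\<in>S - {t i}. t i - s)\<bar> \<le> 1 / (fact i * fact (m - i))" if i: "i \<le> m" for i
  proof -
    have "S - {t i} = t ` ({..m} - {i})"
      unfolding tS using inj i by (auto simp: inj_on_def)
    then have "\<bar>\<Prod>s\<in>S - {t i}. t i - s\<bar> = (\<Prod>j\<in>{..m} - {i}. \<bar>t i - t j\<bar>)"
      by (simp add: prod.reindex inj_on_subset[OF inj] abs_prod)
    also have "\<dots> \<ge> (\<Prod>j\<in>{..m} - {i}. \<bar>real i - real j\<bar>)"
      using gap i by (intro prod_mono) auto
    finally have ge: "fact i * fact (m - i) \<le> \<bar>\<Prod>s\<in>S - {t i}. t i - s\<bar>"
      unfolding prod_abs_diff_index[OF i] .
    show ?thesis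
      unfolding abs_divide using f[of "t i"] ge tS i by (intro frac_le) auto
  qed
  have "\<bar>divided_difference S f\<bar> = \<bar>\<Sum>i\<le>m. f (t i) / (\<Prod>s\<in>S - {t i}. t i - s)\<bar>"
    unfolding divided_difference_def by (subst (1) tS) (simp add: sum.reindex[OF inj])
  also have "\<dots> \<le> (\<Sum>i\<le>m. 1 / (fact i * fact (m - i)))"
    by (rule order_trans[OF sum_abs sum_mono]) (use term_le in auto)
  finally have "fact m * \<bar>divided_difference S f\<bar> \<le> fact m * (\<Sum>i\<le>m. 1 / (fact i * fact (m - i)))"
    by (intro mult_left_mono) auto
  also have "\<dots> = (\<Sum>i\<le>m. real (m choose i))"
    unfolding sum_distrib_left by (intro sum.cong) (auto simp: binomial_fact)
  also have "\<dots> = 2 ^ m"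
    using choose_row_sum[of m] by (metis of_nat_numeral of_nat_power of_nat_sum)
  finally show ?thesis .
qed

text \<open>On the integers the right-hand supremum is at most 2^m, so any lower bound c on the
  constants of all extensions forces an admissible constant to be at least c / 2^m.\<close>

lemma gamma_sharp_ge:
  assumes m: "1 \<le> m"
    and c: "\<And>K F. 0 \<le> K \<Longrightarrow> smooth_lipschitz m K F \<Longrightarrow> (\<And>j::int. F (of_int j) = cos (pi * of_int j)) \<Longrightarrow> c \<le> K"
  shows "ereal (c / 2 ^ m) \<le> gamma_sharp m"
  unfolding gamma_sharp_def
proof (rule Inf_greatest, clarify)
  fix \<gamma> assume \<gamma>: "finiteness_constant m \<gamma>"
  define f where "f = (\<lambda>x. cos (pi * x))"
  let ?s = "SUP S\<in>{S. S \<subseteq> \<int> \<and> card S = m + 1}. trace_seminorm m S f"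
  have "\<gamma> > 0" using \<gamma> by (simp add: finiteness_constant_def)
  have "f \<in> L_space m"
    using smooth_lipschitz_iff[OF m, of "pi ^ m" f] smooth_lipschitz_cos_pi[OF m] by (simp add: f_def)
  then have "f \<in> trace_space m \<int>" by (auto simp: trace_space_def)
  moreover have "infinite (\<int> :: real set)"
    unfolding Ints_def by (subst finite_image_iff) (auto simp: inj_on_def infinite_UNIV_int)
  ultimately have "trace_seminorm m \<int> f \<le> ereal \<gamma> * ?s"
    using \<gamma> closed_Ints unfolding finiteness_constant_def by blast
  moreover have "ereal c \<le> trace_seminorm m \<int> f"
  proof (rule le_trace_seminorm[OF m])
    fix K F assume F: "smooth_lipschitz m K F" "\<And>x. x \<in> \<int> \<Longrightarrow> F x = f x"
    have "0 \<le> K" using order_trans[OF abs_ge_zero smooth_lipschitzD(2)[OF F(1), of 1 0]] by simp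
    then show "c \<le> K" using F by (intro c) (auto simp: f_def)
  qed
  moreover have "?s \<le> ereal (2 ^ m)"
  proof (rule SUP_least)
    fix S :: "real set" assume S: "S \<in> {S. S \<subseteq> \<int> \<and> card S = m + 1}"
    then have "finite S" by (intro card_ge_0_finite) simp
    then show "trace_seminorm m S f \<le> ereal (2 ^ m)"
      using S divided_difference_Ints_le[of S m f] by (simp add: trace_seminorm_card_Suc[OF m] f_def)
  qed
  then have "ereal \<gamma> * ?s \<le> ereal \<gamma> * ereal (2 ^ m)"
    using \<open>\<gamma> > 0\<close> by (intro ereal_mult_left_mono) auto
  ultimately have "ereal c \<le> ereal \<gamma> * ereal (2 ^ m)" by (meson order_trans)
  then have "c \<le> \<gamma> * 2 ^ m" by simp
  then show "ereal (c / 2 ^ m) \<le> ereal \<gamma>" by (simp add: divide_le_eq)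
qed

lemma increment_le_if_derivative_linear_bound:
  fixes g g' :: "real \<Rightarrow> real"
  assumes d: "\<And>s. (g has_real_derivative g' s) (at s)" and bd: "\<And>s. 0 \<le> s \<Longrightarrow> \<bar>g' s\<bar> \<le> K * s" and h: "0 \<le> h"
  shows "\<bar>g h - g 0\<bar> \<le> K * h\<^sup>2 / 2"
proof -
  have "K * 0\<^sup>2 / 2 - g 0 \<le> K * h\<^sup>2 / 2 - g h"
  proof (rule DERIV_nonneg_imp_nondecreasing[OF h, of "\<lambda>s. K * s\<^sup>2 / 2 - g s"])
    fix s assume "0 \<le> s" "s \<le> h"
    then show "\<exists>y. ((\<lambda>s. K * s\<^sup>2 / 2 - g s) has_real_derivative y) (at s) \<and> 0 \<le> y"
      using bd[of s] by (intro exI[of _ "K * s - g' s"]) (auto intro!: derivative_eq_intros d)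
  qed
  moreover have "K * 0\<^sup>2 / 2 + g 0 \<le> K * h\<^sup>2 / 2 + g h"
  proof (rule DERIV_nonneg_imp_nondecreasing[OF h, of "\<lambda>s. K * s\<^sup>2 / 2 + g s"])
    fix s assume "0 \<le> s" "s \<le> h"
    then show "\<exists>y. ((\<lambda>s. K * s\<^sup>2 / 2 + g s) has_real_derivative y) (at s) \<and> 0 \<le> y"
      using bd[of s] by (intro exI[of _ "K * s + g' s"]) (auto intro!: derivative_eq_intros d)
  qed
  ultimately have "- g 0 \<le> K * h\<^sup>2 / 2 - g h" "g 0 \<le> K * h\<^sup>2 / 2 + g h" by simp_all
  then show ?thesis by linarith
qed

section \<open>Lower bounds for extensions of the alternating data\<close>

lemma alternating_interpolant_1:
  assumes F: "smooth_lipschitz 1 K F" and alt: "\<And>j::int. F (of_int j) = cos (pi * of_int j)"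
  shows "2 \<le> K"
proof -
  have "F 0 = 1" "F 1 = - 1" using alt[of 0] alt[of 1] by simp_all
  then show ?thesis using smooth_lipschitzD(2)[OF F, of 0 1] by simp
qed

text \<open>At a maximum point c of |G| the derivative vanishes, hence also at c + 1, where G has
  the opposite value. From either point to the midpoint the derivative is at most K times the
  distance, so G changes by at most K / 8; thus 2 <= 2 |G c| <= K / 4.\<close>

lemma alternating_interpolant_2:
  assumes "0 \<le> K" and F: "smooth_lipschitz 2 K F" and alt: "\<And>j::int. F (of_int j) = cos (pi * of_int j)"
  shows "8 \<le> K"
proof -
  obtain G where G: "smooth_lipschitz 2 K G" "G 0 = 1" and anti: "\<And>x. G (x + 1) = - G x"
    using antiperiodic_interpolant[OF _ \<open>0 \<le> K\<close> F alt] by auto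
  have d: "(G has_real_derivative deriv G x) (at x)" for x
    using smooth_lipschitzD(1)[OF G(1), of 0 x] by simp
  have lip: "\<bar>deriv G x - deriv G y\<bar> \<le> K * \<bar>x - y\<bar>" for x y
    using smooth_lipschitzD(2)[OF G(1), of x y] by simp
  have cont: "continuous_on A G" for A
    using d by (meson DERIV_continuous_on has_field_derivative_at_within)
  \<comment> \<open>A maximum over a compact interval that covers a period of |G| is one over the
    whole line, so it is a local extremum of G even at an endpoint.\<close>
  obtain c where c: "c \<in> {0..2}" "\<And>x. x \<in> {0..2} \<Longrightarrow> \<bar>G x\<bar> \<le> \<bar>G c\<bar>"
    using continuous_attains_sup[of "{0..2::real}" "\<lambda>x. \<bar>G x\<bar>"] cont by (force intro!: continuous_intros)
  have anti_int: "\<bar>G (x + of_int k)\<bar> = \<bar>G x\<bar>" for x and k :: int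
  proof (induction k rule: int_induct[where k=0])
    case (step1 i)
    then show ?case using anti[of "x + of_int i"] by (simp add: add_ac)
  next
    case (step2 i)
    then show ?case using anti[of "x + of_int (i - 1)"] by (simp add: algebra_simps)
  qed simp
  have max: "\<bar>G x\<bar> \<le> \<bar>G c\<bar>" for x
  proof -
    have "\<bar>G x\<bar> = \<bar>G (frac x)\<bar>" using anti_int[of "frac x" "\<lfloor>x\<rfloor>"] by (simp add: frac_def)
    also have "\<dots> \<le> \<bar>G c\<bar>" using frac_ge_0[of x] frac_lt_1[of x] by (intro c(2)) auto
    finally show ?thesis .
  qed
  have "deriv G c = 0"
  proof (cases "G c \<ge> 0")
    case True
    then have "\<forall>y. \<bar>c - y\<bar> < 1 \<longrightarrow> G y \<le> G c" using max by (smt (verit))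
    then show ?thesis using DERIV_local_max[OF d, of 1 c] by simp
  next
    case False
    then have "\<forall>y. \<bar>c - y\<bar> < 1 \<longrightarrow> G c \<le> G y" using max by (smt (verit))
    then show ?thesis using DERIV_local_min[OF d, of 1 c] by simp
  qed
  have "deriv G (c + 1) = - deriv G c"
  proof -
    have "((\<lambda>x. G (x + 1)) has_real_derivative deriv G (c + 1)) (at c)" using d[of "c + 1"] by (simp add: DERIV_shift)
    moreover have "((\<lambda>x. G (x + 1)) has_real_derivative - deriv G c) (at c)" unfolding anti using d by (rule DERIV_minus)
    ultimately show ?thesis by (rule DERIV_unique)
  qed
  have "\<bar>G (c + 1 / 2) - G (c + 0)\<bar> \<le> K * (1 / 2)\<^sup>2 / 2"
  proof (rule increment_le_if_derivative_linear_bound[of "\<lambda>s. G (c + s)" "\<lambda>s. deriv G (c + s)"])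
    show "((\<lambda>s. G (c + s)) has_real_derivative deriv G (c + s)) (at s)" for s
    proof -
      have "((\<lambda>s. c + s) has_real_derivative 1) (at s)" by (auto intro!: derivative_eq_intros)
      from DERIV_chain2[OF d this] show ?thesis by simp
    qed
    show "\<bar>deriv G (c + s)\<bar> \<le> K * s" if "0 \<le> s" for s
      using lip[of "c + s" c] \<open>deriv G c = 0\<close> that by simp
  qed simp
  moreover have "\<bar>G (c + 1 - 1 / 2) - G (c + 1 - 0)\<bar> \<le> K * (1 / 2)\<^sup>2 / 2"
  proof (rule increment_le_if_derivative_linear_bound[of "\<lambda>s. G (c + 1 - s)" "\<lambda>s. - deriv G (c + 1 - s)"])
    show "((\<lambda>s. G (c + 1 - s)) has_real_derivative - deriv G (c + 1 - s)) (at s)" for s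
    proof -
      have "((\<lambda>s. c + 1 - s) has_real_derivative - 1) (at s)" by (auto intro!: derivative_eq_intros)
      from DERIV_chain2[OF d this] show ?thesis by simp
    qed
    show "\<bar>- deriv G (c + 1 - s)\<bar> \<le> K * s" if "0 \<le> s" for s
      using lip[of "c + 1 - s" "c + 1"] \<open>deriv G c = 0\<close> \<open>deriv G (c + 1) = - deriv G c\<close> that by simp
  qed simp
  moreover have "c + 1 - 1 / 2 = c + 1 / 2" by simp
  ultimately have "\<bar>G (c + 1 / 2) - G c\<bar> \<le> K / 8" "\<bar>G (c + 1 / 2) - G (c + 1)\<bar> \<le> K / 8"
    by (simp_all only: power2_eq_square add_0_right diff_zero)
  moreover have "G (c + 1) = - G c" by (rule anti)
  moreover have "1 \<le> \<bar>G c\<bar>" using max[of 0] G(2) by simp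
  ultimately show ?thesis by linarith
qed

text \<open>G falls from 1 to -1 on [0, 1], so G' has mean -2 and mean square at least 4; m - 2
  Wirtinger steps lead to order m - 1, where the mean square is at most K^2 / 12. The product 4
  times 12 is the 48.\<close>

lemma alternating_interpolant_ge_3:
  assumes m: "3 \<le> m" and "0 \<le> K" and F: "smooth_lipschitz m K F"
    and alt: "\<And>j::int. F (of_int j) = cos (pi * of_int j)"
  shows "sqrt 48 * pi ^ (m - 2) \<le> K"
proof -
  obtain G where G: "smooth_lipschitz m K G" "G 0 = 1" and anti: "\<And>x. G (x + 1) = - G x"
    using antiperiodic_interpolant[OF _ \<open>0 \<le> K\<close> F alt] m by auto
  define D where "D = (\<lambda>k. (deriv ^^ k) G)"
  have d: "(D k has_real_derivative D (Suc k) x) (at x)" if "k < m - 1" for k x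
    using smooth_lipschitzD(1)[OF G(1) that] by (simp add: D_def)
  have lip: "\<bar>D (m - 1) x - D (m - 1) y\<bar> \<le> K * \<bar>x - y\<bar>" for x y
    using smooth_lipschitzD(2)[OF G(1)] by (simp add: D_def)
  have "K-lipschitz_on UNIV (D (m - 1))"
    using lip \<open>0 \<le> K\<close> by (auto intro!: lipschitz_onI simp: dist_real_def)
  then have "continuous_on UNIV (D (m - 1))" by (rule lipschitz_on_continuous_on)
  moreover have "continuous_on UNIV (D k)" if "k < m - 1" for k
    using d[OF that] by (meson DERIV_continuous_on has_field_derivative_at_within)
  ultimately have cont: "continuous_on UNIV (D k)" if "k \<le> m - 1" for k
    using that by (cases "k = m - 1") auto
  have antiD: "D k (x + 1) = - D k x" if "k \<le> m - 1" for k x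
    using that
  proof (induction k arbitrary: x)
    case 0
    then show ?case by (simp add: D_def anti)
  next
    case (Suc k)
    then have k: "k < m - 1" by simp
    have "((\<lambda>x. D k (x + 1)) has_real_derivative D (Suc k) (x + 1)) (at x)" using d[OF k, of "x + 1"] by (simp add: DERIV_shift)
    moreover have "((\<lambda>x. D k (x + 1)) has_real_derivative - D (Suc k) x) (at x)"
      using DERIV_minus[OF d[OF k]] Suc by simp
    ultimately show ?case by (rule DERIV_unique)
  qed
  define I where "I = (\<lambda>k. integral {0..1} (\<lambda>x. (D k x)\<^sup>2))"
  have W: "pi\<^sup>2 * I k \<le> I (Suc k)" if "k < m - 1" for k
    unfolding I_def using that by (intro Wirtinger_antiperiodic d cont antiD) auto
  have chain: "(pi\<^sup>2) ^ j * I 1 \<le> I (Suc j)" if "Suc j \<le> m - 1" for j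
    using that
  proof (induction j)
    case (Suc j)
    then have "pi\<^sup>2 * ((pi\<^sup>2) ^ j * I 1) \<le> pi\<^sup>2 * I (Suc j)" by (intro mult_left_mono) auto
    also have "\<dots> \<le> I (Suc (Suc j))" using Suc.prems by (intro W) simp
    finally show ?case by (simp add: mult.assoc)
  qed simp
  have "(D 1 has_integral (D 0 1 - D 0 0)) {0..1}"
    by (rule fundamental_theorem_of_calculus)
       (use d[of 0] m in \<open>auto simp: has_real_derivative_iff_has_vector_derivative[symmetric] intro: has_field_derivative_at_within\<close>)
  moreover have "D 0 1 - D 0 0 = - 2" using antiD[of 0 0] G(2) by (simp add: D_def)
  ultimately have "integral {0..1} (D 1) = - 2" by (simp add: integral_unique)
  moreover have "continuous_on {0..1} (D 1)"
    using m by (intro continuous_on_subset[OF cont]) auto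
  ultimately have "4 \<le> I 1"
    using square_integral_le[of "D 1"] unfolding I_def by simp
  have "(pi\<^sup>2) ^ (m - 2) * 4 \<le> (pi\<^sup>2) ^ (m - 2) * I 1" using \<open>4 \<le> I 1\<close> by (intro mult_left_mono) auto
  also have "\<dots> \<le> I (Suc (m - 2))" using m by (intro chain) auto
  also have "Suc (m - 2) = m - 1" using m by simp
  also have "I (m - 1) \<le> K\<^sup>2 / 12"
    unfolding I_def by (rule integral_square_antiperiodic_lipschitz[OF lip]) (use antiD m in auto)
  finally have "(sqrt 48 * pi ^ (m - 2))\<^sup>2 \<le> K\<^sup>2"
    by (simp add: power_mult_distrib power_mult[symmetric] mult.commute)
  then show ?thesis using \<open>0 \<le> K\<close> by (rule power2_le_imp_le)
qed

theorem theorem6p3: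
  shows "gamma_sharp 1 = 1 \<and> gamma_sharp 2 = 2 \<and>
    (\<forall>m::nat. m > 2 \<longrightarrow>
       ereal ((pi / 2) ^ (m - 1)) < gamma_sharp m \<and>
       gamma_sharp m < ereal ((real m - 1) * 9 ^ m))"
proof (intro conjI allI impI)
  have "ereal (2 / 2 ^ 1) \<le> gamma_sharp 1"
    by (rule gamma_sharp_ge) (use alternating_interpolant_1 in auto)
  moreover have "gamma_sharp 1 \<le> 1"
    using gamma_sharp_le_extension_bound[of 1] by (simp add: extension_bound_def switch_bound_0 one_ereal_def)
  ultimately show "gamma_sharp 1 = 1" by (intro antisym) (simp_all add: one_ereal_def)
  have "ereal (8 / 2 ^ 2) \<le> gamma_sharp 2"
    by (rule gamma_sharp_ge) (use alternating_interpolant_2 in auto)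
  moreover have "gamma_sharp 2 \<le> 2"
    using gamma_sharp_le_extension_bound[of 2] by (simp add: extension_bound_def)
  ultimately show "gamma_sharp 2 = 2" by (intro antisym) simp_all
next
  fix m :: nat assume m: "m > 2"
  \<comment> \<open>The right side is sqrt 48 / (2 pi) times the left, and (2 pi)^2 < 6.4^2 <
    48.\<close>
  have "ereal ((pi / 2) ^ (m - 1)) < ereal (sqrt 48 * pi ^ (m - 2) / 2 ^ m)"
  proof -
    have "(2 * pi)\<^sup>2 < 48"
    proof -
      have "pi < 3.2" using pi_approx by simp
      then have "(2 * pi)\<^sup>2 < (2 * 3.2)\<^sup>2" by (intro power_strict_mono) auto
      then show ?thesis by (simp add: power2_eq_square)
    qed
    then have "2 * pi < sqrt 48" by (rule real_less_rsqrt)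
    then have "2 * pi * (pi ^ (m - 2) / 2 ^ m) < sqrt 48 * (pi ^ (m - 2) / 2 ^ m)"
      by (intro mult_strict_right_mono) auto
    moreover have "(pi / 2) ^ (m - 1) = 2 * pi * (pi ^ (m - 2) / 2 ^ m)"
    proof -
      obtain n where n: "m = Suc (Suc n)" using m by (metis less_imp_Suc_add add_2_eq_Suc)
      show ?thesis unfolding n by (simp add: power_divide)
    qed
    ultimately show ?thesis by simp
  qed
  also have "\<dots> \<le> gamma_sharp m"
    by (rule gamma_sharp_ge) (use alternating_interpolant_ge_3 m in auto)
  finally show "ereal ((pi / 2) ^ (m - 1)) < gamma_sharp m" .
  have "gamma_sharp m \<le> ereal (switch_bound (m - 1))"
    using gamma_sharp_le_extension_bound[of m] m by (simp add: extension_bound_def)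
  also have "\<dots> < ereal ((real m - 1) * 9 ^ m)"
    using switch_bound_less[of "m - 1"] m by simp
  finally show "gamma_sharp m < ereal ((real m - 1) * 9 ^ m)" .
qed

end
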